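(* Uniformly over integers $k$ with $\sqrt n\le k\le n$, $$m_k(n)\sim\frac{4n^{3/2}}{3\log n}\qquad(n\to\infty),$$ that is, for every $\varepsilon>0$ there is $n_0$ such that for all $n\ge n_0$ and all integers $k$ with $\sqrt n\le k\le n$ one has $\left|\,m_k(n)\frac{3\log n}{4n^{3/2}}-1\right|\le\varepsilon$.
   Context: For $N\in\mathbb N=\{1,2,\dots\}$ write $[N]=\{1,\dots,N\}$. A finite family $(C_d)_{d\in D}$ of finite subsets of $\mathbb Z$ is packed into $[N]$ if there are integers $\sigma_d$ ($d\in D$) such that $\sigma_d+C_d\subseteq[N]$ for every $d\in D$ and the sets $\sigma_d+C_d$ are pairwise disjoint. For $n\in\mathbb N$ and $d\in[n]$ put $A_d=\{jd:1\le j\le\lfloor n/d\rfloor\}$ (depending on $n$). For an integer $1\le k\le n$, $m_k(n)$ is the least $N$ for which $(A_d)_{d\in[k]}$ can be packed into $[N]$. Logarithms are natural. *)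

theory Defs
  imports Complex_Main "HOL-Library.Disjoint_Sets"
begin

definition packed_into :: "'d set \<Rightarrow> ('d \<Rightarrow> int set) \<Rightarrow> nat \<Rightarrow> bool" where
  "packed_into D C N \<longleftrightarrow>
     (\<exists>\<sigma> :: 'd \<Rightarrow> int.
        (\<forall>d\<in>D. (\<lambda>c. \<sigma> d + c) ` C d \<subseteq> {1..int N}) \<and>
        disjoint_family_on (\<lambda>d. (\<lambda>c. \<sigma> d + c) ` C d) D)"

definition multiples :: "nat \<Rightarrow> nat \<Rightarrow> int set" where
  "multiples n d = (\<lambda>j. int (j * d)) ` {1..n div d}"

(* Such an N always exists: a finite family of finite sets can be translated
   so that the translates lie one after another. *)
definition min_pack :: "nat \<Rightarrow> nat \<Rightarrow> nat" where
  "min_pack k n = (LEAST N. 1 \<le> N \<and> packed_into {1..k} (multiples n) N)"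

end

theory Submission
  imports Defs "HOL-Complex_Analysis.Complex_Analysis" "HOL-Number_Theory.Number_Theory"
    "HOL-Real_Asymp.Real_Asymp"
begin

text \<open>
Write A_d for \<open>multiples n d\<close> and let r be the integer part of sqrt n.  Both bounds on the packing number are governed by the sum of
n - p^2 over the primes p \<le> r, which by the prime number theorem is asymptotically (4/3) n^(3/2) / log n.

For the lower bound, note that two progressions with distinct prime differences p, q \<le> r cannot both run through an interval of length p q:
by the Chinese remainder theorem they would meet there.  Order the translates of the A_p by their first elements.
Consecutive ones overlap in length at most about p q \<le> (p^2 + q^2)/2, and each has length about n.  So together they
need about the sum of n - p^2 (\<open>overlap_bound\<close>, \<open>packing_lower_bound\<close>).  Since k \<ge> sqrt n, all these p are present.

For the upper bound it suffices to place all A_d with d \<le> n.  Let l be log n rounded up, W = l^5, V = r div W and D = r l^3.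
The sets with d > D are so sparse that they can be placed greedily.  If d \<le> D has a divisor g between W and V, then A_d is
placed together with up to g - 1 others of the same kind, in different residue classes modulo g.  Every other d between W and D is
d = q m with a prime q > V and m < W (\<open>divisor_trichotomy\<close>).  For q > r and fixed m the unshifted sets are already
disjoint.  Together with the d < W, all of these cost o(n^(3/2) / log n).

There remain the d = p m with a prime p between V and r and m < W, and here the overlaps of the lower bound must be attained for all m at
once.  The idea is to treat H primes p_0, ..., p_(H-1) at a time that lie in a very short interval near Q and whose mutual
distances are lacunary.  Their windows, of length about n, start at multiples of \<Delta>, which is about n - (1 - \<eta>) Q^2, so that any two windows
overlap in less than p_i p_j.  All sets for d = p_i m go into the window of p_i, in the residue classes (w_i + m) G_i
modulo p_i, where G_i is the product of the p_l - p_i over l \<noteq> i.  With this choice the points where the classes of p_i and p_j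
meet are, for all m together, confined to a small part of the residues modulo p_i p_j, and w_j moves that part out of
the overlap.  The conditions on w_j for different i can be satisfied one after the other because their coefficients are lacunary
(\<open>lacunary_phase\<close>, \<open>packed_prime_group\<close>).  A set of boundedly many integers already contains a lacunary sequence of
length H (\<open>exists_lacunary\<close>), so in each short interval all but boundedly many primes can be grouped.  The loss per prime
is O(n/H + \<eta> n), where H and \<eta> are at our disposal.

As to the prime number theorem, Newman's contour argument shows that a Dirichlet series with bounded coefficients converges at 1
if its sum extends holomorphically beyond the line of real part one (\<open>newman_dirichlet\<close>).  It is applied to the coefficients
(\<psi>(n) - n)/n, which are bounded by Chebyshev's estimate.  The extension comes from - \<zeta>'/\<zeta> - \<zeta> and the absence of zeros of \<zeta>
on that line (\<open>reg_zeta_nonzero\<close>).  Since \<psi> is monotone, the convergence forces \<psi>(n) to be asymptotic to n (\<open>psi_asymp\<close>).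
\<close>

section \<open>Packings and their basic constructions\<close>

lemma packed_intoI:
  assumes "\<And>d c. d \<in> D \<Longrightarrow> c \<in> C d \<Longrightarrow> 1 \<le> \<sigma> d + c \<and> \<sigma> d + c \<le> int N"
    and "\<And>d e c c'. d \<in> D \<Longrightarrow> e \<in> D \<Longrightarrow> d \<noteq> e \<Longrightarrow> c \<in> C d \<Longrightarrow> c' \<in> C e \<Longrightarrow> \<sigma> d + c \<noteq> \<sigma> e + c'"
  shows "packed_into D C N"
  unfolding packed_into_def disjoint_family_on_def using assms by (intro exI[of _ \<sigma>]) fastforce

lemma packed_intoE:
  assumes "packed_into D C N"
  obtains \<sigma> where "\<And>d c. d \<in> D \<Longrightarrow> c \<in> C d \<Longrightarrow> 1 \<le> \<sigma> d + c \<and> \<sigma> d + c \<le> int N"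
    "\<And>d e c c'. d \<in> D \<Longrightarrow> e \<in> D \<Longrightarrow> d \<noteq> e \<Longrightarrow> c \<in> C d \<Longrightarrow> c' \<in> C e \<Longrightarrow> \<sigma> d + c \<noteq> \<sigma> e + c'"
proof -
  obtain \<sigma> where s: "\<forall>d\<in>D. (\<lambda>c. \<sigma> d + c) ` C d \<subseteq> {1..int N}" "disjoint_family_on (\<lambda>d. (\<lambda>c. \<sigma> d + c) ` C d) D"
    using assms by (auto simp: packed_into_def)
  show ?thesis
  proof (rule that)
    show "1 \<le> \<sigma> d + c \<and> \<sigma> d + c \<le> int N" if "d \<in> D" "c \<in> C d" for d c using s(1) that by fastforce
    show "\<sigma> d + c \<noteq> \<sigma> e + c'" if "d \<in> D" "e \<in> D" "d \<noteq> e" "c \<in> C d" "c' \<in> C e" for d e c c'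
    proof
      assume eq: "\<sigma> d + c = \<sigma> e + c'"
      have "\<sigma> d + c \<in> (\<lambda>c. \<sigma> e + c) ` C e" by (rule image_eqI[where x = c']) (use eq that in auto)
      hence "\<sigma> d + c \<in> (\<lambda>c. \<sigma> d + c) ` C d \<inter> (\<lambda>c. \<sigma> e + c) ` C e" using that by auto
      thus False using s(2) that unfolding disjoint_family_on_def by blast
    qed
  qed
qed

lemma packed_into_mono: 
  assumes "packed_into D C N" "D' \<subseteq> D" "N \<le> N'" 
  shows "packed_into D' C N'"
  using assms(1)
proof (rule packed_intoE)
  fix \<sigma> assume *: "\<And>d c. d \<in> D \<Longrightarrow> c \<in> C d \<Longrightarrow> 1 \<le> \<sigma> d + c \<and> \<sigma> d + c \<le> int N"
    "\<And>d e c c'. d \<in> D \<Longrightarrow> e \<in> D \<Longrightarrow> d \<noteq> e \<Longrightarrow> c \<in> C d \<Longrightarrow> c' \<in> C e \<Longrightarrow> \<sigma> d + c \<noteq> \<sigma> e + c'"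
  show ?thesis
  proof (rule packed_intoI)
    show "1 \<le> \<sigma> d + c \<and> \<sigma> d + c \<le> int N'" if "d \<in> D'" "c \<in> C d" for d c
      using *(1)[of d c] that assms by auto
    show "\<sigma> d + c \<noteq> \<sigma> e + c'" if "d \<in> D'" "e \<in> D'" "d \<noteq> e" "c \<in> C d" "c' \<in> C e" for d e c c'
      using *(2)[of d e c c'] that assms by auto
  qed
qed

text \<open>The second packing is laid behind the first.  An index in both families keeps its place in the first packing, so that later a
covering of the index set by packed families is enough.\<close>

lemma packed_into_Un:
  assumes "packed_into D1 C N1" "packed_into D2 C N2"
  shows "packed_into (D1 \<union> D2) C (N1 + N2)"
proof -
  obtain s1 where s1: "\<And>d c. d \<in> D1 \<Longrightarrow> c \<in> C d \<Longrightarrow> 1 \<le> s1 d + c \<and> s1 d + c \<le> int N1"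
    "\<And>d e c c'. d \<in> D1 \<Longrightarrow> e \<in> D1 \<Longrightarrow> d \<noteq> e \<Longrightarrow> c \<in> C d \<Longrightarrow> c' \<in> C e \<Longrightarrow> s1 d + c \<noteq> s1 e + c'"
    using packed_intoE[OF assms(1)] by metis
  obtain s2 where s2: "\<And>d c. d \<in> D2 \<Longrightarrow> c \<in> C d \<Longrightarrow> 1 \<le> s2 d + c \<and> s2 d + c \<le> int N2"
    "\<And>d e c c'. d \<in> D2 \<Longrightarrow> e \<in> D2 \<Longrightarrow> d \<noteq> e \<Longrightarrow> c \<in> C d \<Longrightarrow> c' \<in> C e \<Longrightarrow> s2 d + c \<noteq> s2 e + c'"
    using packed_intoE[OF assms(2)] by metis
  define s where "s = (\<lambda>d. if d \<in> D1 then s1 d else s2 d + int N1)"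
  have a: "1 \<le> s d + c \<and> s d + c \<le> int N1" if "d \<in> D1" "c \<in> C d" for d c
    using s1(1)[OF that] that by (auto simp: s_def)
  have b: "int N1 + 1 \<le> s d + c \<and> s d + c \<le> int N1 + int N2" if "d \<notin> D1" "d \<in> D2" "c \<in> C d" for d c
    using s2(1)[OF that(2,3)] that by (auto simp: s_def)
  show ?thesis
  proof (rule packed_intoI[where \<sigma> = s])
    show "1 \<le> s d + c \<and> s d + c \<le> int (N1 + N2)" if "d \<in> D1 \<union> D2" "c \<in> C d" for d c
      using a[of d c] b[of d c] that by (cases "d \<in> D1") auto
    show "s d + c \<noteq> s e + c'" if "d \<in> D1 \<union> D2" "e \<in> D1 \<union> D2" "d \<noteq> e" "c \<in> C d" "c' \<in> C e" for d e c c'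
    proof (cases "d \<in> D1"; cases "e \<in> D1")
      assume "d \<in> D1" "e \<in> D1" thus ?thesis using s1(2)[of d e c c'] that by (simp add: s_def)
    next
      assume "d \<in> D1" "e \<notin> D1" thus ?thesis using a[of d c] b[of e c'] that by fastforce
    next
      assume "d \<notin> D1" "e \<in> D1" thus ?thesis using a[of e c'] b[of d c] that by fastforce
    next
      assume "d \<notin> D1" "e \<notin> D1" thus ?thesis using s2(2)[of d e c c'] that by (auto simp: s_def)
    qed
  qed
qed

lemma packed_into_UN:
  assumes "finite I" "\<And>i. i \<in> I \<Longrightarrow> packed_into (D i) C (N i)"
  shows "packed_into (\<Union>i\<in>I. D i) C (\<Sum>i\<in>I. N i)"
  using assms
proof (induction I rule: finite_induct)
  case empty
  show ?case by (auto intro: packed_intoI)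
next
  case (insert i I)
  have "packed_into (D i \<union> (\<Union>i\<in>I. D i)) C (N i + (\<Sum>i\<in>I. N i))"
    using insert by (intro packed_into_Un) auto
  thus ?case using insert by simp
qed

lemma multiplesE:
  assumes "c \<in> multiples n d" "d \<ge> 1"
  obtains j where "j \<ge> 1" "j * d \<le> n" "c = int (j * d)"
  using assms by (auto simp: multiples_def less_eq_div_iff_mult_less_eq)

lemma multiplesI: "j \<ge> 1 \<Longrightarrow> d \<ge> 1 \<Longrightarrow> j * d \<le> n \<Longrightarrow> int (j * d) \<in> multiples n d"
  by (auto simp: multiples_def less_eq_div_iff_mult_less_eq)

lemma multiples_range: 
  assumes "c \<in> multiples n d" "d \<ge> 1" 
  shows "1 \<le> c \<and> c \<le> int n"
proof -
  obtain j where "j \<ge> 1" "j * d \<le> n" "c = int (j * d)" using multiplesE[OF assms] .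
  moreover have "1 \<le> j * d" using calculation assms by (simp add: Suc_le_eq)
  ultimately show ?thesis by linarith
qed

lemma finite_multiples [simp]: "finite (multiples n d)" by (simp add: multiples_def)

lemma card_multiples: "card (multiples n d) \<le> n div d"
  unfolding multiples_def using card_image_le[of "{1..n div d}"] by fastforce

lemma packed_single: 
  assumes "d \<ge> 1" shows "packed_into {d} (multiples n) n"
  by (rule packed_intoI[where \<sigma> = "\<lambda>_. 0"]) (use multiples_range assms in fastforce)+

text \<open>Shifts by distinct residues modulo g keep sets of multiples of g apart.\<close>

lemma packed_residue_block:
  assumes S: "finite S" "card S \<le> g" "\<And>d. d \<in> S \<Longrightarrow> d \<ge> 1 \<and> g dvd d" and g: "g \<ge> 1"
  shows "packed_into S (multiples n) (n + g)"
proof -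
  obtain f where f: "bij_betw f S {0..<card S}" using ex_bij_betw_finite_nat[OF S(1)] by blast
  have fr: "f d < g" if "d \<in> S" for d using bij_betwE[OF f] that S(2) by fastforce
  show ?thesis
  proof (rule packed_intoI[where \<sigma> = "\<lambda>d. int (f d)"])
    show "1 \<le> int (f d) + c \<and> int (f d) + c \<le> int (n + g)" if "d \<in> S" "c \<in> multiples n d" for d c
      using multiples_range[OF that(2)] S(3)[OF that(1)] fr[OF that(1)] by fastforce
    show "int (f d) + c \<noteq> int (f e) + c'" if de: "d \<in> S" "e \<in> S" "d \<noteq> e" "c \<in> multiples n d" "c' \<in> multiples n e" for d e c c'
    proof
      assume eq: "int (f d) + c = int (f e) + c'"
      obtain j where j: "c = int (j * d)" using multiplesE[OF de(4)] S(3)[OF de(1)] by metis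
      obtain i where i: "c' = int (i * e)" using multiplesE[OF de(5)] S(3)[OF de(2)] by metis
      have "f d + j * d = f e + i * e" using eq i j by (metis of_nat_add of_nat_eq_iff)
      hence "(f d + j * d) mod g = (f e + i * e) mod g" by simp
      moreover have "(f d + j * d) mod g = f d" using S(3)[OF de(1)] fr[OF de(1)] by (auto elim!: dvdE simp: mult.left_commute)
      moreover have "(f e + i * e) mod g = f e" using S(3)[OF de(2)] fr[OF de(2)] by (auto elim!: dvdE simp: mult.left_commute)
      ultimately have "f d = f e" by simp
      thus False using f de by (auto simp: bij_betw_def inj_on_def)
    qed
  qed
qed

lemma packed_divisible:
  assumes g: "g \<ge> 1"
  shows "finite S \<Longrightarrow> (\<And>d. d \<in> S \<Longrightarrow> d \<ge> 1 \<and> g dvd d) \<Longrightarrow> packed_into S (multiples n) ((n + g) * (card S div g + 1))"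
proof (induction "card S" arbitrary: S rule: less_induct)
  case less
  show ?case
  proof (cases "card S \<le> g")
    case True
    have "packed_into S (multiples n) (n + g)" using less.prems True g by (intro packed_residue_block) auto
    thus ?thesis by (rule packed_into_mono) auto
  next
    case False
    obtain T where T: "T \<subseteq> S" "card T = g" "finite T" using obtain_subset_with_card_n[of g S] False by auto
    have c: "card (S - T) = card S - g" using T less.prems by (simp add: card_Diff_subset)
    have "packed_into (S - T) (multiples n) ((n + g) * (card (S - T) div g + 1))"
      using less.prems c g False by (intro less.hyps) auto
    moreover have "packed_into T (multiples n) (n + g)" using T g less.prems by (intro packed_residue_block) auto
    ultimately have "packed_into (T \<union> (S - T)) (multiples n) ((n + g) + (n + g) * (card (S - T) div g + 1))"
      by (intro packed_into_Un)
    moreover have "T \<union> (S - T) = S" using T by auto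
    moreover have "card S div g = card (S - T) div g + 1"
    proof -
      have "card S = card (S - T) + g" using c False by simp
      thus ?thesis using g by simp
    qed
    ultimately show ?thesis by (simp add: algebra_simps)
  qed
qed

text \<open>Zero shifts work: j p m = i q m with primes p \<noteq> q makes q a divisor of j, and then the common element is at least p q m > n.\<close>

lemma packed_large_primes:
  assumes m: "m \<ge> 1" and S: "\<And>d. d \<in> S \<Longrightarrow> \<exists>p. prime p \<and> n < p * p \<and> d = p * m"
  shows "packed_into S (multiples n) n"
proof (rule packed_intoI[where \<sigma> = "\<lambda>_. 0"])
  have pos: "d \<ge> 1" if "d \<in> S" for d using S[OF that] m by (auto simp: prime_gt_0_nat Suc_le_eq)
  show "1 \<le> 0 + c \<and> 0 + c \<le> int n" if "d \<in> S" "c \<in> multiples n d" for d c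
    using multiples_range[OF that(2)] pos[OF that(1)] by auto
  show "0 + c \<noteq> 0 + c'" if de: "d \<in> S" "e \<in> S" "d \<noteq> e" "c \<in> multiples n d" "c' \<in> multiples n e" for d e c c'
  proof
    assume "0 + c = 0 + c'"
    obtain p where p: "prime p" "n < p * p" "d = p * m" using S[OF de(1)] by auto
    obtain q where q: "prime q" "n < q * q" "e = q * m" using S[OF de(2)] by auto
    obtain j where j: "j \<ge> 1" "j * d \<le> n" "c = int (j * d)" using multiplesE[OF de(4)] pos[OF de(1)] by metis
    obtain i where i: "i \<ge> 1" "i * e \<le> n" "c' = int (i * e)" using multiplesE[OF de(5)] pos[OF de(2)] by metis
    have "j * d = i * e" using \<open>0 + c = 0 + c'\<close> i j by (metis add_0 of_nat_eq_iff)
    hence eq: "j * p = i * q" using p q m by simp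
    have "p \<noteq> q" using p q de by auto
    hence "coprime q p" using p q by (metis primes_coprime)
    moreover have "q dvd j * p" using eq by simp
    ultimately have "q dvd j" by (simp add: coprime_dvd_mult_left_iff)
    hence "q \<le> j" using j by (intro dvd_imp_le) auto
    have "p * q \<le> n"
    proof -
      have "p * q \<le> p * j * m" using \<open>q \<le> j\<close> m by (simp add: mult_le_mono le_trans[OF mult_le_mono2])
      also have "\<dots> = j * d" using p by simp
      finally show ?thesis using j by simp
    qed
    moreover have "n < p * q"
    proof (cases "p \<le> q")
      case True
      thus ?thesis using p(2) by (meson le_trans less_le_trans mult_le_mono2)
    next
      case False
      thus ?thesis using q(2) by (meson less_le_trans mult_le_mono1 nat_le_linear)
    qed
    ultimately show False by simp
  qed
qed

text \<open>When a set is added, each occupied point together with each element of the new set rules out one shift.  These are at most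
b a of the a b + 1 available shifts.\<close>

lemma packed_greedy:
  fixes C :: "'d \<Rightarrow> int set"
  assumes "finite S" "\<And>d. d \<in> S \<Longrightarrow> finite (C d) \<and> C d \<subseteq> {1..int n} \<and> card (C d) \<le> a" "(\<Sum>d\<in>S. card (C d)) \<le> b"
  shows "packed_into S C (n + a * b)"
  using assms
proof (induction S rule: finite_induct)
  case empty
  show ?case by (auto intro: packed_intoI)
next
  case (insert x S)
  have "packed_into S C (n + a * b)" using insert by (intro insert.IH) auto
  then obtain s where s: "\<And>d c. d \<in> S \<Longrightarrow> c \<in> C d \<Longrightarrow> 1 \<le> s d + c \<and> s d + c \<le> int (n + a * b)"
    "\<And>d e c c'. d \<in> S \<Longrightarrow> e \<in> S \<Longrightarrow> d \<noteq> e \<Longrightarrow> c \<in> C d \<Longrightarrow> c' \<in> C e \<Longrightarrow> s d + c \<noteq> s e + c'"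
    using packed_intoE by metis
  define U where "U = (\<Union>d\<in>S. (\<lambda>c. s d + c) ` C d)"
  have fU: "finite U" using insert unfolding U_def by auto
  have "card U \<le> (\<Sum>d\<in>S. card ((\<lambda>c. s d + c) ` C d))" unfolding U_def using insert by (intro card_UN_le) auto
  also have "\<dots> \<le> (\<Sum>d\<in>S. card (C d))" using insert by (intro sum_mono card_image_le) auto
  also have "\<dots> \<le> b" using insert by simp
  finally have cU: "card U \<le> b" .
  define B where "B = (\<lambda>(u, c). u - c) ` (U \<times> C x)"
  have "finite (C x)" using insert by auto
  hence "card B \<le> card (U \<times> C x)" unfolding B_def using fU by (intro card_image_le) auto
  also have "\<dots> = card U * card (C x)" by (simp add: card_cartesian_product)
  also have "\<dots> \<le> b * a" using cU insert by (intro mult_le_mono) auto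
  also have "\<dots> < card {0..int (a * b)}" by (simp add: mult.commute nat_add_distrib flip: of_nat_mult)
  finally have "\<not> {0..int (a * b)} \<subseteq> B" using fU \<open>finite (C x)\<close> unfolding B_def by (metis card_mono finite_SigmaI finite_imageI not_le)
  then obtain t where "t \<in> {0..int (a * b)}" "t \<notin> B" by blast
  hence t: "0 \<le> t" "t \<le> int (a * b)" "t \<notin> B" by auto
  have new: "t + c \<noteq> s d + c'" if "c \<in> C x" "d \<in> S" "c' \<in> C d" for c d c'
  proof
    assume "t + c = s d + c'"
    hence "t = (s d + c') - c" by simp
    moreover have "s d + c' \<in> U" using that unfolding U_def by auto
    ultimately show False using t(3) that unfolding B_def by force
  qed
  show ?case
  proof (rule packed_intoI[where \<sigma> = "s(x := t)"])
    show "1 \<le> (s(x := t)) d + c \<and> (s(x := t)) d + c \<le> int (n + a * b)" if "d \<in> insert x S" "c \<in> C d" for d c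
    proof (cases "d = x")
      case True
      hence "c \<in> {1..int n}" using that insert.prems(1)[of x] by auto
      thus ?thesis using True t by auto
    next
      case False
      thus ?thesis using s(1)[of d c] that by auto
    qed
    show "(s(x := t)) d + c \<noteq> (s(x := t)) e + c'" if "d \<in> insert x S" "e \<in> insert x S" "d \<noteq> e" "c \<in> C d" "c' \<in> C e" for d e c c'
      using that s(2)[of d e c c'] new[of c e c'] new[of c' d c] insert.hyps(2) by (auto simp: fun_upd_def)
  qed
qed

text \<open>Laying all sets one behind the other shows that the minimum is taken over a nonempty set.\<close>

lemma min_pack_properties:
  assumes "k \<ge> 1"
  shows "packed_into {1..k} (multiples n) (min_pack k n)"
    and "\<And>N. 1 \<le> N \<Longrightarrow> packed_into {1..k} (multiples n) N \<Longrightarrow> min_pack k n \<le> N"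
proof -
  have "packed_into (\<Union>d\<in>{1..k}. {d}) (multiples n) (\<Sum>d\<in>{1..k}. n)"
    by (intro packed_into_UN packed_single) auto
  hence "packed_into {1..k} (multiples n) (k * n)" by simp
  hence "packed_into {1..k} (multiples n) (k * n + 1)" by (rule packed_into_mono) auto
  hence ex: "1 \<le> k * n + 1 \<and> packed_into {1..k} (multiples n) (k * n + 1)" by simp
  from LeastI[of "\<lambda>N. 1 \<le> N \<and> packed_into {1..k} (multiples n) N", OF ex]
  show "packed_into {1..k} (multiples n) (min_pack k n)" by (auto simp: min_pack_def)
  show "\<And>N. 1 \<le> N \<Longrightarrow> packed_into {1..k} (multiples n) N \<Longrightarrow> min_pack k n \<le> N"
    unfolding min_pack_def by (rule Least_le) auto
qed

section \<open>The lower bound: primes up to the square root\<close>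

text \<open>If both progressions ran through an interval of length p q from the first element t + q of the second one, they would have a common
element there by the Chinese remainder theorem.  The second progression is long enough for this because p q \<le> n.\<close>

lemma overlap_bound:
  assumes p: "prime p" "prime q" "p \<noteq> q" "p * p \<le> n" "q * q \<le> n"
    and dis: "\<And>c c'. c \<in> multiples n p \<Longrightarrow> c' \<in> multiples n q \<Longrightarrow> s + c \<noteq> t + c'"
    and le: "s + int p \<le> t + int q"
  shows "t + int q \<ge> s + int n - int p - int p * int q"
proof (rule ccontr)
  assume neg: "\<not> ?thesis"
  have pq: "p * q \<le> n"
  proof (cases "p \<le> q")
    case True thus ?thesis using p(5) by (meson le_trans mult_le_mono1)
  next
    case False thus ?thesis using p(4) by (meson le_trans mult_le_mono2 nat_le_linear)
  qed
  have cop: "coprime (int q) (int p)" using p by (simp add: primes_coprime)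
  have p0: "p > 0" "q > 0" using p by (auto simp: prime_gt_0_nat)
  obtain u where u: "[int q * u = 1] (mod int p)" using cong_solve_coprime_int[OF cop] by blast
  \<comment> \<open>The index of the common element in the second progression, counted from its first element.\<close>
  define i where "i = ((s - t - int q) * u) mod int p"
  have i: "0 \<le> i" "i < int p" using p0 by (auto simp: i_def)
  have "[int q * i = (s - t - int q) * (int q * u)] (mod int p)"
    unfolding i_def by (metis cong_mod_left cong_refl cong_scalar_left mult.left_commute)
  also have "[(s - t - int q) * (int q * u) = (s - t - int q) * 1] (mod int p)" by (rule cong_scalar_left[OF u])
  finally have "int p dvd (int q * i - (s - t - int q))" by (simp add: cong_iff_dvd_diff)
  then obtain j where j: "int q * i - (s - t - int q) = int p * j" by (auto elim: dvdE)
  define x where "x = t + int q * (i + 1)"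
  have xs: "x = s + int p * j" using j by (simp add: x_def algebra_simps)
  have "int q * i \<le> int q * (int p - 1)" using i p0 by (intro mult_left_mono) auto
  hence x_up: "x \<le> t + int q + int q * int p - int q" by (simp add: x_def algebra_simps)
  have x_lo: "x \<ge> t + int q" using i p0 by (simp add: x_def algebra_simps)
  have "int p * j \<ge> int p" using x_lo le xs by linarith
  hence j1: "j \<ge> 1" using p0 by (simp add: zero_less_mult_iff)
  have "int p * j \<le> int n" using x_up xs neg by (simp add: algebra_simps)
  define J where "J = nat j"
  have jJ: "j = int J" "J \<ge> 1" using j1 by (auto simp: J_def)
  have "int (J * p) \<le> int n" using \<open>int p * j \<le> int n\<close> jJ by (simp add: mult.commute)
  hence "J * p \<le> n" by (simp only: of_nat_le_iff)
  hence c1: "int p * j \<in> multiples n p"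
    using multiplesI[of J p n] p0 jJ by (simp add: mult.commute)
  have i1: "nat (i + 1) * q \<le> n"
  proof -
    have "nat (i + 1) \<le> p" using i by linarith
    hence "nat (i + 1) * q \<le> p * q" by (rule mult_le_mono1)
    thus ?thesis using pq by (rule le_trans)
  qed
  have "int (nat (i + 1) * q) \<in> multiples n q" using i1 i p0 by (intro multiplesI) auto
  moreover have "int (nat (i + 1) * q) = int q * (i + 1)" using i by (simp add: mult.commute)
  ultimately have c2: "int q * (i + 1) \<in> multiples n q" by (simp only:)
  show False using dis[OF c1 c2] xs by (simp add: x_def)
qed

text \<open>Induction on the number of primes, removing the one whose first element is the last.  By the overlap bound and
p q \<le> (p^2 + q^2)/2, each step costs half a square for either neighbour.  The prime at the end of the order pays only once,
hence the term q^2/2 in the induction hypothesis.\<close>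

lemma packing_lower_bound_aux:
  assumes "finite S" "S \<noteq> {}" and p: "\<And>p. p \<in> S \<Longrightarrow> prime p \<and> p * p \<le> n"
    and dis: "\<And>p q c c'. p \<in> S \<Longrightarrow> q \<in> S \<Longrightarrow> p \<noteq> q \<Longrightarrow> c \<in> multiples n p \<Longrightarrow> c' \<in> multiples n q \<Longrightarrow> \<sigma> p + c \<noteq> \<sigma> q + c'"
    and pos: "\<And>p. p \<in> S \<Longrightarrow> \<sigma> p + int p \<ge> 0"
    and r: "\<And>p. p \<in> S \<Longrightarrow> p \<le> r"
  shows "\<exists>q\<in>S. (\<forall>p\<in>S. \<sigma> p + int p \<le> \<sigma> q + int q) \<and>
     real_of_int (\<sigma> q + int q) \<ge> (\<Sum>p\<in>S. real n - 2 * real r - (real p)\<^sup>2) - real n + (real q)\<^sup>2 / 2"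
  using assms
proof (induction "card S" arbitrary: S rule: less_induct)
  case less
  define f where "f = (\<lambda>p. \<sigma> p + int p)"
  have "\<exists>q\<in>S. \<forall>p\<in>S. f p \<le> f q"
  proof -
    have "Max (f ` S) \<in> f ` S" using less.prems by (intro Max_in) auto
    then obtain q where "q \<in> S" "Max (f ` S) = f q" by auto
    thus ?thesis using less.prems(1) by (metis Max_ge finite_imageI imageI)
  qed
  then obtain q where q: "q \<in> S" "\<And>p. p \<in> S \<Longrightarrow> f p \<le> f q" by blast
  have "real_of_int (f q) \<ge> (\<Sum>p\<in>S. real n - 2 * real r - (real p)\<^sup>2) - real n + (real q)\<^sup>2 / 2"
  proof (cases "S = {q}")
    case True
    have "f q \<ge> 0" using less.prems(5)[OF q(1)] by (simp add: f_def)
    hence "real_of_int (f q) \<ge> 0" by simp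
    moreover have "(real q)\<^sup>2 \<ge> 0" by simp
    moreover have "(\<Sum>p\<in>S. real n - 2 * real r - (real p)\<^sup>2) = real n - 2 * real r - (real q)\<^sup>2" unfolding True by simp
    ultimately show ?thesis by linarith
  next
    case False
    define S' where "S' = S - {q}"
    have S': "finite S'" "S' \<noteq> {}" "card S' < card S" "S' \<subseteq> S"
      using False q(1) less.prems(1) card_Diff1_less[OF less.prems(1) q(1)] by (auto simp: S'_def)
    have "\<exists>p'\<in>S'. (\<forall>p\<in>S'. \<sigma> p + int p \<le> \<sigma> p' + int p') \<and>
       real_of_int (\<sigma> p' + int p') \<ge> (\<Sum>p\<in>S'. real n - 2 * real r - (real p)\<^sup>2) - real n + (real p')\<^sup>2 / 2"
    proof (rule less.hyps[OF S'(3,1,2)])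
      show "\<sigma> p + c \<noteq> \<sigma> q + c'" if "p \<in> S'" "q \<in> S'" "p \<noteq> q" "c \<in> multiples n p" "c' \<in> multiples n q" for p q c c'
        using less.prems(4)[of p q c c'] S'(4) that by blast
    qed (use less.prems S'(4) in auto)
    then obtain p' where p': "p' \<in> S'" "real_of_int (f p') \<ge> (\<Sum>p\<in>S'. real n - 2 * real r - (real p)\<^sup>2) - real n + (real p')\<^sup>2 / 2"
      unfolding f_def by blast
    have p'S: "p' \<in> S" "p' \<noteq> q" using p'(1) by (auto simp: S'_def)
    have "\<sigma> q + int q \<ge> \<sigma> p' + int n - int p' - int p' * int q"
      using less.prems(3)[OF p'S(1)] less.prems(3)[OF q(1)] p'S less.prems(4)[OF p'S(1) q(1) p'S(2)] q(2)[OF p'S(1)]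
      by (intro overlap_bound) (auto simp: f_def)
    hence "f q \<ge> f p' + int n - 2 * int p' - int p' * int q" by (simp add: f_def)
    hence "real_of_int (f q) \<ge> real_of_int (f p' + int n - 2 * int p' - int p' * int q)" by (simp only: of_int_le_iff)
    hence 1: "real_of_int (f q) \<ge> real_of_int (f p') + real n - 2 * real p' - real p' * real q" by simp
    have "0 \<le> (real p' - real q)\<^sup>2" by simp
    hence 2: "real p' * real q \<le> (real p')\<^sup>2 / 2 + (real q)\<^sup>2 / 2" by (simp add: power2_eq_square algebra_simps)
    have 3: "real p' \<le> real r" using less.prems(6)[OF p'S(1)] by simp
    have 4: "(\<Sum>p\<in>S. real n - 2 * real r - (real p)\<^sup>2) = (real n - 2 * real r - (real q)\<^sup>2) + (\<Sum>p\<in>S'. real n - 2 * real r - (real p)\<^sup>2)"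
      unfolding S'_def using q(1) less.prems(1) by (rule sum.remove[rotated])
    show ?thesis using 1 2 3 4 p'(2) by linarith
  qed
  thus ?case using q unfolding f_def by blast
qed

lemma packing_lower_bound:
  assumes D: "packed_into D (multiples n) N" "\<And>p. prime p \<Longrightarrow> p \<le> r \<Longrightarrow> p \<in> D" and r: "r * r \<le> n" "r \<ge> 2"
  shows "real N \<ge> (\<Sum>p | prime p \<and> p \<le> r. real n - 2 * real r - (real p)\<^sup>2) - real n"
proof -
  let ?S = "{p. prime p \<and> p \<le> r}"
  obtain \<sigma> where s: "\<And>d c. d \<in> D \<Longrightarrow> c \<in> multiples n d \<Longrightarrow> 1 \<le> \<sigma> d + c \<and> \<sigma> d + c \<le> int N"
    "\<And>d e c c'. d \<in> D \<Longrightarrow> e \<in> D \<Longrightarrow> d \<noteq> e \<Longrightarrow> c \<in> multiples n d \<Longrightarrow> c' \<in> multiples n e \<Longrightarrow> \<sigma> d + c \<noteq> \<sigma> e + c'"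
    using packed_intoE[OF D(1)] by metis
  have pn: "p * p \<le> n" if "p \<le> r" for p using mult_le_mono[OF that that] r by simp
  have mem: "int p \<in> multiples n p" if "p \<in> ?S" for p
  proof -
    have "p \<ge> 1" using that by (simp add: prime_gt_0_nat Suc_le_eq)
    moreover from this have "p \<le> p * p" by simp
    hence "p \<le> n" by (rule le_trans) (use pn that in auto)
    ultimately show ?thesis using multiplesI[of 1 p n] by simp
  qed
  have bd: "1 \<le> \<sigma> p + int p \<and> \<sigma> p + int p \<le> int N" if "p \<in> ?S" for p
    using s(1)[of p "int p"] mem[OF that] D(2) that by auto
  have "\<exists>q\<in>?S. (\<forall>p\<in>?S. \<sigma> p + int p \<le> \<sigma> q + int q) \<and>
     real_of_int (\<sigma> q + int q) \<ge> (\<Sum>p\<in>?S. real n - 2 * real r - (real p)\<^sup>2) - real n + (real q)\<^sup>2 / 2"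
  proof (rule packing_lower_bound_aux)
    show "?S \<noteq> {}" using r two_is_prime_nat by blast
    show "\<sigma> p + int p \<ge> 0" if "p \<in> ?S" for p using bd[OF that] by simp
  qed (use s(2) D(2) pn in auto)
  then obtain q where q: "q \<in> ?S" "real_of_int (\<sigma> q + int q) \<ge> (\<Sum>p\<in>?S. real n - 2 * real r - (real p)\<^sup>2) - real n + (real q)\<^sup>2 / 2" by blast
  have "real_of_int (\<sigma> q + int q) \<le> real N" using bd[OF q(1)] by (metis of_int_le_iff of_int_of_nat_eq)
  moreover have "(real q)\<^sup>2 / 2 \<ge> 0" by simp
  ultimately show ?thesis using q(2) by linarith
qed

section \<open>Interleaving the multiples of nearby primes\<close>

text \<open>Nested intervals.  Once \<phi> z_i is right for all i < k on an interval of radius \<tau>/|z_(k-1)|, this interval is so long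
compared with 1/|z_k| that \<phi> z_k runs through all residues modulo one there.  Shrink it around a point where \<phi> z_k is exactly c_k modulo one.\<close>

lemma lacunary_phase:
  fixes z c :: "nat \<Rightarrow> real"
  assumes \<tau>: "0 < \<tau>" "\<tau> \<le> 1 / 2" and R: "R * \<tau> \<ge> 1"
    and z: "\<And>i. i < k \<Longrightarrow> z i \<noteq> 0" "\<And>i. Suc i < k \<Longrightarrow> \<bar>z (Suc i)\<bar> \<ge> R * \<bar>z i\<bar>"
  shows "\<exists>\<phi>0. \<forall>\<phi>. (k > 0 \<longrightarrow> \<bar>\<phi> - \<phi>0\<bar> \<le> \<tau> / \<bar>z (k - 1)\<bar>) \<longrightarrow> (\<forall>i<k. \<exists>m::int. \<bar>\<phi> * z i - c i - of_int m\<bar> \<le> \<tau>)"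
  using z
proof (induction k)
  case 0
  show ?case by simp
next
  case (Suc k)
  obtain \<phi>0 where \<phi>0: "\<And>\<phi> i. k > 0 \<longrightarrow> \<bar>\<phi> - \<phi>0\<bar> \<le> \<tau> / \<bar>z (k - 1)\<bar> \<Longrightarrow> i < k \<Longrightarrow> \<exists>m::int. \<bar>\<phi> * z i - c i - of_int m\<bar> \<le> \<tau>"
    using Suc by (metis less_SucI)
  have zk: "z k \<noteq> 0" using Suc.prems(1) by simp
  define m where "m = round (\<phi>0 * z k - c k)"
  define \<phi>1 where "\<phi>1 = (c k + of_int m) / z k"
  have "(\<phi>1 - \<phi>0) * z k = of_int m - (\<phi>0 * z k - c k)" using zk by (simp add: \<phi>1_def field_simps)
  hence "\<bar>\<phi>1 - \<phi>0\<bar> * \<bar>z k\<bar> \<le> 1 / 2" 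
    using of_int_round_abs_le[of "\<phi>0 * z k - c k"] by (simp add: m_def flip: abs_mult)
  hence d1: "\<bar>\<phi>1 - \<phi>0\<bar> \<le> 1 / 2 / \<bar>z k\<bar>" using zk by (simp add: field_simps)
  show ?case
  proof (intro exI[of _ \<phi>1] allI impI)
    fix \<phi> i assume \<phi>: "0 < Suc k \<longrightarrow> \<bar>\<phi> - \<phi>1\<bar> \<le> \<tau> / \<bar>z (Suc k - 1)\<bar>" and i: "i < Suc k"
    hence \<phi>': "\<bar>\<phi> - \<phi>1\<bar> \<le> \<tau> / \<bar>z k\<bar>" by simp
    show "\<exists>m::int. \<bar>\<phi> * z i - c i - of_int m\<bar> \<le> \<tau>"
    proof (cases "i = k")
      case True
      have "\<phi> * z k - c k - of_int m = (\<phi> - \<phi>1) * z k" using zk by (simp add: \<phi>1_def field_simps)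
      hence "\<bar>\<phi> * z k - c k - of_int m\<bar> = \<bar>\<phi> - \<phi>1\<bar> * \<bar>z k\<bar>" by (simp add: abs_mult)
      also have "\<dots> \<le> \<tau>" using \<phi>' zk by (simp add: field_simps)
      finally show ?thesis using True by blast
    next
      case False
      hence ik: "i < k" using i by simp
      have zk1: "\<bar>z (k - 1)\<bar> > 0" using Suc.prems(1)[of "k - 1"] ik by simp
      have "\<bar>z k\<bar> \<ge> R * \<bar>z (k - 1)\<bar>" using Suc.prems(2)[of "k - 1"] ik by simp
      hence "\<tau> * \<bar>z k\<bar> \<ge> \<tau> * (R * \<bar>z (k - 1)\<bar>)" using \<tau> by (intro mult_left_mono) auto
      also have "\<tau> * (R * \<bar>z (k - 1)\<bar>) = (R * \<tau>) * \<bar>z (k - 1)\<bar>" by simp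
      also have "\<dots> \<ge> 1 * \<bar>z (k - 1)\<bar>" using R by (intro mult_right_mono) auto
      finally have "1 / \<bar>z k\<bar> \<le> \<tau> / \<bar>z (k - 1)\<bar>" using zk zk1 by (simp add: field_simps)
      moreover have "\<bar>\<phi> - \<phi>0\<bar> \<le> 1 / 2 / \<bar>z k\<bar> + \<tau> / \<bar>z k\<bar>" using \<phi>' d1 by linarith
      moreover have "\<tau> / \<bar>z k\<bar> \<le> 1 / 2 / \<bar>z k\<bar>" using \<tau> by (intro divide_right_mono) auto
      moreover have "1 / 2 / \<bar>z k\<bar> + 1 / 2 / \<bar>z k\<bar> = 1 / \<bar>z k\<bar>" by (simp add: field_simps)
      ultimately have "\<bar>\<phi> - \<phi>0\<bar> \<le> \<tau> / \<bar>z (k - 1)\<bar>" by linarith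
      thus ?thesis using \<phi>0 ik by blast
    qed
  qed
qed

text \<open>Rounding the phase to a multiple of 1/p costs at most another \<tau>, since |z_i| \<le> \<tau> p.\<close>

lemma lacunary_phase_int:
  fixes z c :: "nat \<Rightarrow> real"
  assumes \<tau>: "0 < \<tau>" "\<tau> \<le> 1 / 2" and R: "R * \<tau> \<ge> 1"
    and z: "\<And>i. i < k \<Longrightarrow> z i \<noteq> 0" "\<And>i. Suc i < k \<Longrightarrow> \<bar>z (Suc i)\<bar> \<ge> R * \<bar>z i\<bar>"
    and p: "p > 0" "\<And>i. i < k \<Longrightarrow> \<bar>z i\<bar> \<le> \<tau> * p"
  shows "\<exists>w::int. \<forall>i<k. \<exists>m::int. \<bar>of_int w * z i / p - c i - of_int m\<bar> \<le> 2 * \<tau>"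
proof -
  obtain \<phi>0 where \<phi>0: "\<And>\<phi>. k > 0 \<longrightarrow> \<bar>\<phi> - \<phi>0\<bar> \<le> \<tau> / \<bar>z (k - 1)\<bar> \<Longrightarrow> \<forall>i<k. \<exists>m::int. \<bar>\<phi> * z i - c i - of_int m\<bar> \<le> \<tau>"
    using lacunary_phase[where \<tau> = \<tau> and R = R and k = k and z = z and c = c] \<tau> R z by blast
  have \<phi>: "\<exists>m::int. \<bar>\<phi>0 * z i - c i - of_int m\<bar> \<le> \<tau>" if "i < k" for i using \<phi>0[of \<phi>0] that \<tau> by simp
  define w where "w = round (\<phi>0 * p)"
  show ?thesis
  proof (rule exI[of _ w], intro allI impI)
    fix i assume i: "i < k"
    obtain m :: int where m: "\<bar>\<phi>0 * z i - c i - of_int m\<bar> \<le> \<tau>" using \<phi>[OF i] by blast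
    have "of_int w * z i / p - \<phi>0 * z i = (of_int w - \<phi>0 * p) * (z i / p)" using p by (simp add: field_simps)
    hence "\<bar>of_int w * z i / p - \<phi>0 * z i\<bar> = \<bar>of_int w - \<phi>0 * p\<bar> * \<bar>z i / p\<bar>" by (simp add: abs_mult)
    also have "\<dots> \<le> 1 * \<tau>" 
    proof (rule mult_mono)
      show "\<bar>of_int w - \<phi>0 * p\<bar> \<le> 1" using of_int_round_abs_le[of "\<phi>0 * p"] by (simp add: w_def)
      show "\<bar>z i / p\<bar> \<le> \<tau>" using p(2)[OF i] p(1) by (simp add: divide_le_eq)
    qed auto
    finally have "\<bar>of_int w * z i / p - \<phi>0 * z i\<bar> \<le> \<tau>" by simp
    moreover have "\<bar>u - v\<bar> \<le> \<tau> \<Longrightarrow> \<bar>v - c' - m'\<bar> \<le> \<tau> \<Longrightarrow> \<bar>u - c' - m'\<bar> \<le> 2 * \<tau>" for u v c' m' :: real by linarith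
    ultimately have "\<bar>of_int w * z i / p - c i - of_int m\<bar> \<le> 2 * \<tau>" using m by blast
    thus "\<exists>m::int. \<bar>of_int w * z i / p - c i - of_int m\<bar> \<le> 2 * \<tau>" by blast
  qed
qed

text \<open>The product of the differences of p_i to the other members without p_j.  Its product with p_j - p_i is the residue G_i, which does not depend on j.\<close>

definition cofactor :: "(nat \<Rightarrow> nat) \<Rightarrow> nat \<Rightarrow> nat \<Rightarrow> nat \<Rightarrow> int" where
  "cofactor p H i j = (\<Prod>l\<in>{..<H} - {i, j}. int (p l) - int (p i))"

lemma cofactor_mult:
  assumes "j < H" "i \<noteq> j"
  shows "(\<Prod>l\<in>{..<H} - {i}. int (p l) - int (p i)) = (int (p j) - int (p i)) * cofactor p H i j"
proof -
  have "{..<H} - {i} - {j} = {..<H} - {i, j}" by auto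
  thus ?thesis unfolding cofactor_def using assms by (subst prod.remove[of _ j]) auto
qed

lemma cofactor_nonzero: "inj_on p {..<H} \<Longrightarrow> i < H \<Longrightarrow> cofactor p H i j \<noteq> 0"
  by (auto simp: cofactor_def inj_on_def)

lemma cofactor_bound:
  assumes df: "\<And>l. l < H \<Longrightarrow> \<bar>int (p l) - int (p i)\<bar> \<le> int X" and X: "X \<ge> 1"
  shows "real_of_int \<bar>cofactor p H i j\<bar> \<le> real X ^ H"
proof -
  have "real_of_int \<bar>cofactor p H i j\<bar> = (\<Prod>l\<in>{..<H} - {i, j}. real_of_int \<bar>int (p l) - int (p i)\<bar>)"
    unfolding cofactor_def by (simp add: abs_prod)
  also have "\<dots> \<le> (\<Prod>l\<in>{..<H} - {i, j}. real X)"
  proof (rule prod_mono)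
    fix l assume "l \<in> {..<H} - {i, j}"
    hence "\<bar>int (p l) - int (p i)\<bar> \<le> int X" using df[of l] by auto
    hence "real_of_int \<bar>int (p l) - int (p i)\<bar> \<le> real_of_int (int X)" by (simp only: of_int_le_iff)
    thus "0 \<le> real_of_int \<bar>int (p l) - int (p i)\<bar> \<and> real_of_int \<bar>int (p l) - int (p i)\<bar> \<le> real X" by simp
  qed
  also have "\<dots> = real X ^ card ({..<H} - {i, j})" by simp
  also have "\<dots> \<le> real X ^ H" using X card_mono[of "{..<H}" "{..<H} - {i, j}"] by (intro power_increasing) auto
  finally show ?thesis .
qed

text \<open>The cofactors of j multiply with the distances to p_j to one and the same number up to sign, so they grow as the distances shrink.\<close>

lemma cofactor_lacunary:
  assumes ij: "Suc i < j" "j < H" and ne: "p (Suc i) \<noteq> p j"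
    and lac: "real_of_int \<bar>int (p i) - int (p j)\<bar> \<ge> R * real_of_int \<bar>int (p (Suc i)) - int (p j)\<bar>"
  shows "real_of_int \<bar>cofactor p H j (Suc i)\<bar> \<ge> R * real_of_int \<bar>cofactor p H j i\<bar>"
proof -
  define u where "u = real_of_int \<bar>int (p (Suc i)) - int (p j)\<bar>"
  define v where "v = real_of_int \<bar>int (p i) - int (p j)\<bar>"
  have u: "u > 0" using ne by (simp add: u_def)
  have uv: "v \<ge> R * u" using lac by (simp add: u_def v_def)
  have "(int (p (Suc i)) - int (p j)) * cofactor p H j (Suc i) = (int (p i) - int (p j)) * cofactor p H j i"
    using cofactor_mult[of "Suc i" H j p] cofactor_mult[of i H j p] ij by simp
  hence "real_of_int \<bar>(int (p (Suc i)) - int (p j)) * cofactor p H j (Suc i)\<bar> = real_of_int \<bar>(int (p i) - int (p j)) * cofactor p H j i\<bar>"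
    by (simp only:)
  hence "u * real_of_int \<bar>cofactor p H j (Suc i)\<bar> = v * real_of_int \<bar>cofactor p H j i\<bar>" by (simp add: abs_mult u_def v_def)
  also have "\<dots> \<ge> R * u * real_of_int \<bar>cofactor p H j i\<bar>" using uv by (intro mult_right_mono) auto
  finally have "u * (R * real_of_int \<bar>cofactor p H j i\<bar>) \<le> u * real_of_int \<bar>cofactor p H j (Suc i)\<bar>" by (simp add: algebra_simps)
  thus ?thesis using u by simp
qed

text \<open>The w_j are chosen one after the other: when all w_i with i < j are known, the conditions on w_j have lacunary coefficients.\<close>

lemma exists_phases:
  fixes p :: "nat \<Rightarrow> real" and Y B :: "nat \<Rightarrow> nat \<Rightarrow> real"
  assumes \<tau>: "0 < \<tau>" "\<tau> \<le> 1 / 2" "R * \<tau> \<ge> 1"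
    and p: "\<And>j. j < H \<Longrightarrow> p j > 0"
    and Y: "\<And>i j. i < j \<Longrightarrow> j < H \<Longrightarrow> Y j i \<noteq> 0 \<and> \<bar>Y j i\<bar> \<le> \<tau> * p j"
    and lac: "\<And>i j. Suc i < j \<Longrightarrow> j < H \<Longrightarrow> \<bar>Y j (Suc i)\<bar> \<ge> R * \<bar>Y j i\<bar>"
  shows "\<exists>w::nat \<Rightarrow> int. \<forall>j<H. \<forall>i<j. \<exists>m::int.
    \<bar>of_int (w j) * Y j i / p j - (B i j - of_int (w i) * Y i j / p i) - of_int m\<bar> \<le> 2 * \<tau>"
proof -
  define Good where "Good = (\<lambda>w i j. \<exists>m::int. \<bar>of_int (w j) * Y j i / p j - (B i j - of_int (w i) * Y i j / p i) - of_int m\<bar> \<le> 2 * \<tau>)"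
  have "\<exists>w::nat \<Rightarrow> int. \<forall>j<J. \<forall>i<j. Good w i j" if "J \<le> H" for J
    using that
  proof (induction J)
    case (Suc J)
    then obtain w :: "nat \<Rightarrow> int" where w: "\<And>i j. i < j \<Longrightarrow> j < J \<Longrightarrow> Good w i j" by auto
    have J: "J < H" using Suc by simp
    have "\<exists>wJ::int. \<forall>i<J. \<exists>m::int. \<bar>of_int wJ * Y J i / p J - (B i J - of_int (w i) * Y i J / p i) - of_int m\<bar> \<le> 2 * \<tau>"
      by (rule lacunary_phase_int[OF \<tau>]) (use Y lac p J in auto)
    then obtain wJ :: int where wJ: "\<And>i. i < J \<Longrightarrow> \<exists>m::int. \<bar>of_int wJ * Y J i / p J - (B i J - of_int (w i) * Y i J / p i) - of_int m\<bar> \<le> 2 * \<tau>"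
      by blast
    have "Good (w(J := wJ)) i j" if "i < j" "j < Suc J" for i j
    proof (cases "j = J")
      case True
      thus ?thesis using wJ[of i] that by (simp add: Good_def)
    next
      case False
      thus ?thesis using w[of i j] that by (simp add: Good_def)
    qed
    thus ?case by blast
  qed simp
  thus ?thesis unfolding Good_def by blast
qed

text \<open>As q - p is q modulo p, and p - q is p modulo q, both congruences are solved by a q Y + b p Z, and only by integers in its class modulo p q.\<close>

lemma meeting_point:
  fixes p q :: nat and a b x Y Z :: int
  assumes cop: "coprime (int p) (int q)" and pos: "p > 0" "q > 0"
    and xp: "int p dvd x - a * ((int q - int p) * Y)" and xq: "int q dvd x - b * ((int p - int q) * Z)"
  shows "\<exists>e::int. real_of_int x / (real p * real q) = of_int a * of_int Y / real p + of_int b * of_int Z / real q + of_int e"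
proof -
  define N where "N = a * (int q * Y) + b * (int p * Z)"
  have "int p dvd (x - a * ((int q - int p) * Y)) + int p * (- a * Y - b * Z)" using xp by (intro dvd_add) auto
  also have "(x - a * ((int q - int p) * Y)) + int p * (- a * Y - b * Z) = x - N" by (simp add: N_def algebra_simps)
  finally have d1: "int p dvd x - N" .
  have "int q dvd (x - b * ((int p - int q) * Z)) + int q * (- b * Z - a * Y)" using xq by (intro dvd_add) auto
  also have "(x - b * ((int p - int q) * Z)) + int q * (- b * Z - a * Y) = x - N" by (simp add: N_def algebra_simps)
  finally have d2: "int q dvd x - N" .
  have "int p * int q dvd x - N" using cop d1 d2 by (rule divides_mult[rotated 2])
  then obtain e where e: "x - N = int p * int q * e" by (auto elim: dvdE)
  define P where "P = real p * real q"
  have P0: "P > 0" using pos by (simp add: P_def)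
  have "x = N + int p * int q * e" using e by simp
  hence "real_of_int x = real_of_int N + P * of_int e" by (simp add: P_def)
  hence "real_of_int x / P = real_of_int N / P + of_int e" using P0 by (simp add: field_simps)
  also have "real_of_int N / P = of_int a * of_int Y / real p + of_int b * of_int Z / real q"
    using pos unfolding P_def N_def by (simp add: field_simps)
  finally show ?thesis unfolding P_def by blast
qed

text \<open>All sets for p_i m are placed in the window of p_i, in the class of (w_i + m) G_i modulo p_i.  By \<open>meeting_point\<close>, such a class for p_i and one for p_j
meet exactly at the x for which x/(p_i p_j) is (w_i + m) Y_ij/p_i + (w_j + m') Y_ji/p_j modulo one, where Y is the cofactor.  The contributions of m
and m' are tiny.  The phases are such that for i < j these points lie just before the start j \<Delta> of the window of p_j, modulo p_i p_j.  The
next such point comes only after the overlap of the two windows, which is at most (1 - 8\<tau>) p_i p_j long.\<close>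

lemma packed_prime_group:
  fixes p :: "nat \<Rightarrow> nat"
  assumes pr: "\<And>i. i < H \<Longrightarrow> prime (p i) \<and> Q \<le> p i \<and> p i \<le> Q + X"
    and inj: "inj_on p {..<H}"
    and lac: "\<And>i j. Suc i < j \<Longrightarrow> j < H \<Longrightarrow> real_of_int \<bar>int (p i) - int (p j)\<bar> \<ge> R * real_of_int \<bar>int (p (Suc i)) - int (p j)\<bar>"
    and \<tau>: "0 < \<tau>" "\<tau> \<le> 1 / 2" "R * \<tau> \<ge> 1"
    and sm: "2 * real X ^ H * real W \<le> \<tau> * real Q" "X \<ge> 1" "W \<ge> 1" "X < Q"
    and \<Delta>: "real n + real Q + real X \<le> real \<Delta> + (1 - 8 * \<tau>) * (real Q)\<^sup>2"
  shows "packed_into {p i * m | i m. i < H \<and> 1 \<le> m \<and> m < W} (multiples n) (H * \<Delta> + n + Q + X)"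
    (is "packed_into ?D _ _")
proof -
  have WQ: "W < Q"
  proof -
    have "1 \<le> real X ^ H" using sm by simp
    hence "2 * 1 * real W \<le> 2 * real X ^ H * real W" by (intro mult_right_mono mult_left_mono) auto
    also have "\<dots> \<le> \<tau> * real Q" by (rule sm)
    also have "\<dots> \<le> 1 / 2 * real Q" using \<tau> by (intro mult_right_mono) auto
    finally have "4 * real W \<le> real Q" by simp
    thus ?thesis using sm by linarith
  qed
  have p0: "p i > 0" if "i < H" for i using pr[OF that] by (simp add: prime_gt_0_nat)
  define Y where "Y = cofactor p H"
  define G where "G = (\<lambda>i. \<Prod>l\<in>{..<H} - {i}. int (p l) - int (p i))"
  have df: "\<bar>int (p l) - int (p i)\<bar> \<le> int X" if "l < H" "i < H" for l i
    using pr[OF that(1)] pr[OF that(2)] by auto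
  have ne: "p l \<noteq> p i" if "l < H" "i < H" "l \<noteq> i" for l i using inj that by (auto simp: inj_on_def)
  have GY: "G i = (int (p j) - int (p i)) * Y i j" if "j < H" "i \<noteq> j" for i j
    unfolding G_def Y_def by (rule cofactor_mult[OF that])
  have Yb: "real_of_int \<bar>Y i j\<bar> \<le> real X ^ H" if "i < H" for i j
    unfolding Y_def using df that sm(2) by (intro cofactor_bound)
  define A where "A = (\<lambda>i j. real (j * \<Delta>) / (real (p i) * real (p j)))"
  have "\<exists>w::nat \<Rightarrow> int. \<forall>j<H. \<forall>i<j. \<exists>m::int. \<bar>of_int (w j) * real_of_int (Y j i) / real (p j)
      - (A i j - 4 * \<tau> - of_int (w i) * real_of_int (Y i j) / real (p i)) - of_int m\<bar> \<le> 2 * \<tau>"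
    \<comment> \<open>The target is 4\<tau> before the start of the later window, in units of p_i p_j.  The tolerance 2\<tau> and the
      contribution of m and m', at most \<tau>, keep the meeting point strictly within the last 8\<tau> before it.\<close>
  proof (rule exists_phases[OF \<tau>])
    show "R * \<bar>real_of_int (Y j i)\<bar> \<le> \<bar>real_of_int (Y j (Suc i))\<bar>" if "Suc i < j" "j < H" for i j
      unfolding Y_def using cofactor_lacunary[OF that ne lac[OF that]] that by simp
    fix i j assume ij: "i < j" "j < H"
    have "real X ^ H * 1 \<le> real X ^ H * (2 * real W)" using sm by (intro mult_left_mono) auto
    also have "\<dots> \<le> \<tau> * real Q" using sm by (simp add: algebra_simps)
    also have "\<dots> \<le> \<tau> * real (p j)" using pr[OF ij(2)] \<tau> by simp
    finally show "real_of_int (Y j i) \<noteq> 0 \<and> \<bar>real_of_int (Y j i)\<bar> \<le> \<tau> * real (p j)"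
      using Yb[OF ij(2), of i] cofactor_nonzero[OF inj ij(2)] by (simp add: Y_def)
  qed (use p0 in auto)
  then obtain w :: "nat \<Rightarrow> int" where w: "\<And>i j. i < j \<Longrightarrow> j < H \<Longrightarrow> \<exists>m::int. \<bar>of_int (w j) * real_of_int (Y j i) / real (p j)
      - (A i j - 4 * \<tau> - of_int (w i) * real_of_int (Y i j) / real (p i)) - of_int m\<bar> \<le> 2 * \<tau>" by blast
  \<comment> \<open>The first shift from i \<Delta> on that lies in the prescribed residue class.\<close>
  define s where "s = (\<lambda>i m. int (i * \<Delta>) + ((w i + int m) * G i - int (i * \<Delta>)) mod int (p i))"
  define I where "I = {..<H} \<times> {1..<W}"
  define f where "f = (\<lambda>(i, m). p i * m)"
  have win: "int (i * \<Delta>) < s i m + c \<and> s i m + c \<le> int (i * \<Delta>) + int n + int (p i) \<and> int (p i) dvd (s i m + c - (w i + int m) * G i)"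
    if im: "i < H" "1 \<le> m" "c \<in> multiples n (p i * m)" for i m c
  proof -
    have pm: "p i * m \<ge> 1" using p0[OF im(1)] im(2) by (simp add: Suc_le_eq)
    obtain l where l: "c = int (l * (p i * m))" using multiplesE[OF im(3) pm] by metis
    have r: "1 \<le> c" "c \<le> int n" using multiples_range[OF im(3) pm] by auto
    define a where "a = (w i + int m) * G i - int (i * \<Delta>)"
    have a: "0 \<le> a mod int (p i)" "a mod int (p i) < int (p i)" using p0[OF im(1)] by auto
    have "int (p i) dvd a mod int (p i) - a" by (simp add: mod_eq_dvd_iff[symmetric])
    hence "int (p i) dvd (a mod int (p i) - a) + int (p i) * (int l * int m)" by (intro dvd_add) auto
    moreover have "(a mod int (p i) - a) + int (p i) * (int l * int m) = s i m + c - (w i + int m) * G i"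
      unfolding s_def a_def[symmetric] l by (simp add: a_def algebra_simps)
    ultimately have "int (p i) dvd s i m + c - (w i + int m) * G i" by (simp only:)
    moreover have "s i m = int (i * \<Delta>) + a mod int (p i)" by (simp only: s_def a_def)
    ultimately show ?thesis using a r by (intro conjI) linarith+
  qed
  have sep: "s i m + c \<noteq> s j m' + c'" if ij: "i < j" "j < H" and m: "1 \<le> m" "m < W" "1 \<le> m'" "m' < W"
    and c: "c \<in> multiples n (p i * m)" "c' \<in> multiples n (p j * m')" for i j m m' c c'
  proof
    assume eq: "s i m + c = s j m' + c'"
    define x where "x = s i m + c"
    have iH: "i < H" using ij by simp
    have x1: "x \<le> int (i * \<Delta>) + int n + int (p i)" "int (p i) dvd (x - (w i + int m) * G i)" using win[OF iH m(1) c(1)] by (auto simp: x_def)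
    have x2: "int (j * \<Delta>) < x" "int (p j) dvd (x - (w j + int m') * G j)" using win[OF ij(2) m(3) c(2)] eq by (auto simp: x_def)
    define P where "P = real (p i) * real (p j)"
    have P0: "P > 0" using p0[OF iH] p0[OF ij(2)] by (simp add: P_def)
    have "coprime (int (p i)) (int (p j))" using pr[OF iH] pr[OF ij(2)] ne[OF iH ij(2)] ij by (simp add: primes_coprime)
    from meeting_point[OF this p0[OF iH] p0[OF ij(2)] x1(2)[unfolded GY[OF ij(2) less_imp_neq[OF ij(1)]]]
      x2(2)[unfolded GY[OF iH less_imp_neq[OF ij(1), symmetric]]]]
    obtain e :: int where "real_of_int x / P = of_int (w i + int m) * of_int (Y i j) / real (p i) + of_int (w j + int m') * of_int (Y j i) / real (p j) + of_int e"
      unfolding P_def by blast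
    hence xP: "real_of_int x / P = real_of_int (w i) * real_of_int (Y i j) / real (p i) + real m * real_of_int (Y i j) / real (p i)
        + real_of_int (w j) * real_of_int (Y j i) / real (p j) + real m' * real_of_int (Y j i) / real (p j) + of_int e"
      by (simp add: algebra_simps add_divide_distrib)
    obtain k :: int where k: "\<bar>real_of_int (w j) * real_of_int (Y j i) / real (p j)
      - (A i j - 4 * \<tau> - real_of_int (w i) * real_of_int (Y i j) / real (p i)) - of_int k\<bar> \<le> 2 * \<tau>"
      using w[OF ij] by auto
    have small: "\<bar>real m * real_of_int (Y i j) / real (p i)\<bar> \<le> \<tau> / 2" if "i < H" "m < W" for i j m
    proof -
      have "\<bar>real m * real_of_int (Y i j) / real (p i)\<bar> = real m * real_of_int \<bar>Y i j\<bar> / real (p i)" by (simp add: abs_mult)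
      also have "\<dots> \<le> real W * real X ^ H / real Q"
        using pr[OF that(1)] that(2) Yb[OF that(1), of j] WQ by (intro frac_le mult_mono) auto
      also have "\<dots> \<le> \<tau> / 2" using sm(1) WQ by (simp add: field_simps)
      finally show ?thesis .
    qed
    have s1: "\<bar>real m * real_of_int (Y i j) / real (p i)\<bar> \<le> \<tau> / 2" by (rule small[OF iH m(2)])
    have s2: "\<bar>real m' * real_of_int (Y j i) / real (p j)\<bar> \<le> \<tau> / 2" by (rule small[OF ij(2) m(4)])
    have z: "\<bar>real_of_int x / P - (A i j - 4 * \<tau>) - of_int (e + k)\<bar> \<le> 3 * \<tau>"
    proof -
      have "\<bar>u - (A' - v) - k'\<bar> \<le> 2 * \<tau> \<Longrightarrow> \<bar>a\<bar> \<le> \<tau> / 2 \<Longrightarrow> \<bar>b\<bar> \<le> \<tau> / 2 \<Longrightarrow> \<bar>v + a + u + b + e' - A' - (e' + k')\<bar> \<le> 3 * \<tau>"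
        for u v a b A' e' k' :: real by linarith
      from this[OF k s1 s2] show ?thesis unfolding xP of_int_add .
    qed
    have lo: "A i j < real_of_int x / P"
    proof -
      have "real (j * \<Delta>) < real_of_int x" using x2(1) by linarith
      thus ?thesis unfolding A_def P_def[symmetric] using P0 by (intro divide_strict_right_mono) auto
    qed
    have hi: "real_of_int x / P \<le> A i j + (1 - 8 * \<tau>)"
    proof -
      have "i * \<Delta> + \<Delta> \<le> j * \<Delta>" using ij by (metis Suc_leI add.commute mult_Suc mult_le_mono1)
      hence "real (i * \<Delta>) + real \<Delta> \<le> real (j * \<Delta>)" by (simp only: of_nat_le_iff flip: of_nat_add)
      moreover have "real_of_int x \<le> real (i * \<Delta>) + real n + real (p i)" using x1(1) by linarith
      moreover have "real (p i) \<le> real Q + real X" using pr[OF iH] by linarith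
      ultimately have "real_of_int x \<le> real (j * \<Delta>) + (1 - 8 * \<tau>) * (real Q)\<^sup>2" using \<Delta> by linarith
      have "real_of_int x - real (j * \<Delta>) > 0" using x2(1) by linarith
      hence "(1 - 8 * \<tau>) * (real Q)\<^sup>2 > 0" using \<open>real_of_int x \<le> real (j * \<Delta>) + (1 - 8 * \<tau>) * (real Q)\<^sup>2\<close> by linarith
      hence "1 - 8 * \<tau> > 0" by (simp add: zero_less_mult_iff)
      have "(real Q)\<^sup>2 \<le> P" unfolding P_def power2_eq_square using pr[OF iH] pr[OF ij(2)] by (intro mult_mono) auto
      hence "(1 - 8 * \<tau>) * (real Q)\<^sup>2 \<le> (1 - 8 * \<tau>) * P" using \<open>1 - 8 * \<tau> > 0\<close> by (intro mult_left_mono) auto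
      hence "real_of_int x \<le> real (j * \<Delta>) + (1 - 8 * \<tau>) * P" using \<open>real_of_int x \<le> real (j * \<Delta>) + (1 - 8 * \<tau>) * (real Q)\<^sup>2\<close> by linarith
      hence "real_of_int x / P \<le> (real (j * \<Delta>) + (1 - 8 * \<tau>) * P) / P" using P0 by (intro divide_right_mono) auto
      also have "\<dots> = A i j + (1 - 8 * \<tau>)" unfolding A_def P_def[symmetric] using P0 by (simp add: add_divide_distrib)
      finally show ?thesis .
    qed
    show False
    proof (cases "e + k \<le> 0")
      case True
      hence "real_of_int (e + k) \<le> 0" by simp
      thus False using z lo \<tau>(1) by (simp only: abs_le_iff) linarith
    next
      case False
      hence "real_of_int (e + k) \<ge> 1" by linarith
      thus False using z hi \<tau>(1) by (simp only: abs_le_iff) linarith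
    qed
  qed
  have same: "s i m + c \<noteq> s i m' + c'" if i: "i < H" and m: "1 \<le> m" "m < W" "1 \<le> m'" "m' < W" "m \<noteq> m'"
    and c: "c \<in> multiples n (p i * m)" "c' \<in> multiples n (p i * m')" for i m m' c c'
  proof
    assume eq: "s i m + c = s i m' + c'"
    have 1: "int (p i) dvd (s i m + c - (w i + int m) * G i)" using win[OF i m(1) c(1)] by simp
    have 2: "int (p i) dvd (s i m + c - (w i + int m') * G i)" using win[OF i m(3) c(2)] eq by simp
    have "int (p i) dvd (int m - int m') * G i" using dvd_diff[OF 2 1] by (simp add: algebra_simps)
    moreover have prm: "prime (int (p i))" using pr[OF i] by simp
    ultimately have "int (p i) dvd (int m - int m') \<or> int (p i) dvd G i" by (simp add: prime_dvd_mult_iff)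
    moreover have "\<not> int (p i) dvd (int m - int m')"
    proof
      assume "int (p i) dvd (int m - int m')"
      hence "int (p i) \<le> \<bar>int m - int m'\<bar>" using dvd_imp_le_int[of "int m - int m'" "int (p i)"] m(5) by simp
      moreover have "\<bar>int m - int m'\<bar> < int W" using m by linarith
      ultimately show False using pr[OF i] WQ by linarith
    qed
    moreover have "\<not> int (p i) dvd G i"
    proof
      assume "int (p i) dvd G i"
      then obtain l where l: "l \<in> {..<H} - {i}" "int (p i) dvd (int (p l) - int (p i))"
        unfolding G_def using prm by (subst (asm) prime_dvd_prod_iff) auto
      hence "int (p i) \<le> \<bar>int (p l) - int (p i)\<bar>"
        using ne[of l i] i dvd_imp_le_int[of "int (p l) - int (p i)" "int (p i)"] by simp
      also have "\<dots> \<le> int X" using df[of l i] l i by simp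
      finally show False using pr[OF i] sm(4) by linarith
    qed
    ultimately show False by blast
  qed
  have finj: "i = j" if "i < H" "j < H" "1 \<le> m" "m < W" "1 \<le> m'" "m' < W" "p i * m = p j * m'" for i j m m'
  proof (rule ccontr)
    assume "i \<noteq> j"
    hence "p i \<noteq> p j" using inj that by (auto simp: inj_on_def)
    hence "coprime (p i) (p j)" using pr that by (simp add: primes_coprime)
    moreover have "p i dvd p j * m'" using that(7) by (metis dvd_triv_left)
    ultimately have "p i dvd m'" by (simp add: coprime_dvd_mult_right_iff)
    hence "p i \<le> m'" using that by (intro dvd_imp_le) auto
    thus False using pr[OF that(1)] that WQ by linarith
  qed
  define \<sigma> where "\<sigma> = (\<lambda>d. case inv_into I f d of (i, m) \<Rightarrow> s i m)"
  have rep: "\<exists>i m. i < H \<and> 1 \<le> m \<and> m < W \<and> d = p i * m \<and> \<sigma> d = s i m" if "d \<in> ?D" for d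
  proof -
    have "d \<in> f ` I" using that by (auto simp: f_def I_def)
    hence "inv_into I f d \<in> I" "f (inv_into I f d) = d" by (auto simp: inv_into_into f_inv_into_f)
    moreover obtain i m where im: "inv_into I f d = (i, m)" by (cases "inv_into I f d")
    ultimately show ?thesis by (auto simp: I_def f_def \<sigma>_def)
  qed
  show ?thesis
  proof (rule packed_intoI[where \<sigma> = \<sigma>])
    fix d c assume d: "d \<in> ?D" and c: "c \<in> multiples n d"
    obtain i m where im: "i < H" "1 \<le> m" "m < W" "d = p i * m" "\<sigma> d = s i m" using rep[OF d] by blast
    have *: "int (i * \<Delta>) < \<sigma> d + c" "\<sigma> d + c \<le> int (i * \<Delta>) + int n + int (p i)"
      using win[OF im(1,2)] c im(4,5) by auto
    have "i * \<Delta> \<le> H * \<Delta>" using im(1) by simp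
    hence "int (i * \<Delta>) \<le> int (H * \<Delta>)" by (simp only: of_nat_le_iff)
    moreover have "int (i * \<Delta>) \<ge> 0" by simp
    moreover have "int (p i) \<le> int Q + int X" using pr[OF im(1)] by linarith
    ultimately show "1 \<le> \<sigma> d + c \<and> \<sigma> d + c \<le> int (H * \<Delta> + n + Q + X)" using * by linarith
  next
    fix d e c c' assume d: "d \<in> ?D" and e: "e \<in> ?D"
      and ne: "d \<noteq> e" and c: "c \<in> multiples n d" "c' \<in> multiples n e"
    obtain i m where im: "i < H" "1 \<le> m" "m < W" "d = p i * m" "\<sigma> d = s i m" using rep[OF d] by blast
    obtain j m' where jm: "j < H" "1 \<le> m'" "m' < W" "e = p j * m'" "\<sigma> e = s j m'" using rep[OF e] by blast
    show "\<sigma> d + c \<noteq> \<sigma> e + c'"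
    proof (cases i j rule: linorder_cases)
      case less
      thus ?thesis using sep[OF less jm(1) im(2,3) jm(2,3)] c im jm by simp
    next
      case equal
      hence "m \<noteq> m'" using ne im jm by auto
      thus ?thesis using same[OF im(1,2,3) jm(2,3)] c im jm equal by simp
    next
      case greater
      thus ?thesis using sep[OF greater im(1) jm(2,3) im(2,3), of c' c] c im jm by simp
    qed
  qed
qed

text \<open>Seen from any later member, the distance to p_i exceeds the distance to p_(i+1) by a factor of at least R.\<close>

definition lacunary :: "nat \<Rightarrow> nat \<Rightarrow> (nat \<Rightarrow> nat) \<Rightarrow> bool" where
  "lacunary R H p \<longleftrightarrow> inj_on p {..<H} \<and>
     (\<forall>i j. Suc i < j \<longrightarrow> j < H \<longrightarrow> int R * \<bar>int (p (Suc i)) - int (p j)\<bar> \<le> \<bar>int (p i) - int (p j)\<bar>)"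

lemma lacunary_cons:
  assumes "lacunary R H p"
    and a: "\<And>i. i < H \<Longrightarrow> a \<noteq> p i"
    and "\<And>i j. i < H \<Longrightarrow> j < H \<Longrightarrow> int R * \<bar>int (p i) - int (p j)\<bar> \<le> \<bar>int a - int (p j)\<bar>"
  shows "lacunary R (Suc H) (\<lambda>i. case i of 0 \<Rightarrow> a | Suc i \<Rightarrow> p i)"
  unfolding lacunary_def
proof (intro conjI allI impI)
  show "inj_on (\<lambda>i. case i of 0 \<Rightarrow> a | Suc i \<Rightarrow> p i) {..<Suc H}"
    using assms(1) a unfolding lacunary_def inj_on_def by (auto split: nat.splits)
next
  fix i j assume ij: "Suc i < j" "j < Suc H"
  then obtain j' where j: "j = Suc j'" by (cases j) auto
  show "int R * \<bar>int (case Suc i of 0 \<Rightarrow> a | Suc i \<Rightarrow> p i) - int (case j of 0 \<Rightarrow> a | Suc i \<Rightarrow> p i)\<bar>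
     \<le> \<bar>int (case i of 0 \<Rightarrow> a | Suc i \<Rightarrow> p i) - int (case j of 0 \<Rightarrow> a | Suc i \<Rightarrow> p i)\<bar>"
  proof (cases i)
    case 0
    thus ?thesis using assms(3)[of 0 j'] ij j by simp
  next
    case (Suc i')
    thus ?thesis using assms(1) ij j by (auto simp: lacunary_def)
  qed
qed

text \<open>Cut the range of S into 4 R + 8 pieces of equal length.  One of them keeps enough elements to continue within it, and the endpoint of the range
that is farther from this piece serves as the first member.\<close>

lemma exists_lacunary:
  assumes "finite S" "card S \<ge> (4 * R + 8) ^ H"
  shows "\<exists>p. lacunary R H p \<and> p ` {..<H} \<subseteq> S"
  using assms
proof (induction H arbitrary: S)
  case 0
  show ?case by (auto simp: lacunary_def)
next
  case (Suc H)
  define B where "B = 4 * R + 8"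
  have B: "B \<ge> 8" by (simp add: B_def)
  have cS: "card S \<ge> B * B ^ H" using Suc.prems by (simp add: B_def)
  have "B * 1 \<le> B * B ^ H" using B by (intro mult_le_mono2) simp
  hence c2: "card S \<ge> 2" using cS B by linarith
  have ne: "S \<noteq> {}" using c2 by auto
  define lo where "lo = Min S"
  define hi where "hi = Max S"
  have lohi: "lo \<in> S" "hi \<in> S" "\<And>s. s \<in> S \<Longrightarrow> lo \<le> s \<and> s \<le> hi"
    using Suc.prems(1) ne by (auto simp: lo_def hi_def)
  define D where "D = hi - lo"
  have D1: "D \<ge> 1"
  proof (rule ccontr)
    assume "\<not> D \<ge> 1"
    hence "S \<subseteq> {lo}" using lohi(3) lohi(3)[OF lohi(1)] by (fastforce simp: D_def)
    hence "card S \<le> card {lo}" by (intro card_mono) auto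
    thus False using c2 by simp
  qed
  define g where "g = (\<lambda>s. (s - lo) * B div (D + 1))"
  have gr: "g ` S \<subseteq> {..<B}"
  proof
    fix k assume "k \<in> g ` S"
    then obtain s where s: "s \<in> S" "k = g s" by auto
    have "s - lo < D + 1" using lohi(3)[OF s(1)] unfolding D_def by linarith
    hence "B * (s - lo) < B * (D + 1)" using B by (simp only: mult_less_cancel1) simp
    hence "(s - lo) * B < B * (D + 1)" by (simp only: mult.commute)
    thus "k \<in> {..<B}" unfolding s(2) g_def by (simp add: div_less_iff_less_mult)
  qed
  have "\<exists>k\<in>{..<B}. card {s\<in>S. g s = k} \<ge> B ^ H"
  proof (rule ccontr)
    assume "\<not> ?thesis"
    hence lt: "\<And>k. k \<in> {..<B} \<Longrightarrow> card {s\<in>S. g s = k} < B ^ H" by force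
    have "card S = (\<Sum>k\<in>{..<B}. card {s\<in>S. g s = k})"
      using sum.group[OF Suc.prems(1) _ gr, of "\<lambda>_. 1::nat"] by simp
    also have "\<dots> < (\<Sum>k\<in>{..<B}. B ^ H)"
    proof (rule sum_strict_mono)
      show "{..<B} \<noteq> {}" using B by (auto simp: lessThan_empty_iff)
    qed (use lt in auto)
    finally show False using cS by simp
  qed
  then obtain k where k: "card {s\<in>S. g s = k} \<ge> B ^ H" by blast
  define T where "T = {s\<in>S. g s = k}"
  have close: "int B * \<bar>int s - int t\<bar> < int D + 1" if "s \<in> T" "t \<in> T" for s t
  proof -
    have *: "B * (t - s) < D + 1" if "s \<in> T" "t \<in> T" "s \<le> t" for s t
    proof -
      have eq: "(s - lo) * B div (D + 1) = (t - lo) * B div (D + 1)" using that by (auto simp: T_def g_def)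
      have ls: "lo \<le> s" using that lohi by (auto simp: T_def)
      have "(t - lo) * B < ((t - lo) * B div (D + 1)) * (D + 1) + (D + 1)" using dividend_less_div_times[of "D + 1" "(t - lo) * B"] by simp
      also have "\<dots> \<le> (s - lo) * B + (D + 1)" unfolding eq[symmetric] by (simp add: div_times_less_eq_dividend del: mult_Suc_right)
      finally have "(t - lo) * B < (s - lo) * B + (D + 1)" .
      moreover have "t - lo = (t - s) + (s - lo)" using ls that by simp
      ultimately show ?thesis by (simp add: algebra_simps)
    qed
    show ?thesis
    proof (cases "s \<le> t")
      case True
      hence "int (B * (t - s)) < int (D + 1)" using *[OF that True] by (simp only: of_nat_less_iff)
      thus ?thesis using True by (simp add: of_nat_diff abs_minus_commute)
    next
      case False
      hence "int (B * (s - t)) < int (D + 1)" using *[OF that(2,1)] by (simp only: of_nat_less_iff nat_le_linear)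
      thus ?thesis using False by (simp add: of_nat_diff)
    qed
  qed
  obtain p where p: "lacunary R H p" "p ` {..<H} \<subseteq> T"
    using Suc.IH[of T] k Suc.prems(1) unfolding T_def B_def by auto
  have "T \<noteq> {}" using k B by (auto simp: T_def[symmetric])
  then obtain s0 where s0: "s0 \<in> T" by blast
  \<comment> \<open>The endpoint farther from the chosen piece, at distance at least D/2 from one of its points.\<close>
  define a where "a = (if 2 * (s0 - lo) \<ge> D then lo else hi)"
  have aS: "a \<in> S" using lohi by (simp add: a_def)
  have s0b: "lo \<le> s0" "s0 \<le> hi" using s0 lohi by (auto simp: T_def)
  have far0: "2 * \<bar>int a - int s0\<bar> \<ge> int D"
    using s0b unfolding a_def D_def by (auto simp: of_nat_diff)
  have key: "int R * \<bar>int s - int t\<bar> < \<bar>int a - int t\<bar>" if "s \<in> T" "t \<in> T" for s t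
  proof -
    have 1: "int B * \<bar>int s - int t\<bar> < int D + 1" by (rule close[OF that])
    have 2: "int B * \<bar>int s0 - int t\<bar> < int D + 1" by (rule close[OF s0 that(2)])
    have BR: "int B = 4 * int R + 8" by (simp add: B_def)
    define u where "u = \<bar>int s - int t\<bar>"
    define v where "v = \<bar>int s0 - int t\<bar>"
    have "4 * (int R * u) + 8 * u \<le> int D" using 1 unfolding BR u_def[symmetric] by (simp add: algebra_simps)
    moreover have "8 * v \<le> int D"
    proof -
      have "8 * v \<le> int B * v" unfolding BR v_def by (intro mult_right_mono) auto
      thus ?thesis using 2 unfolding v_def by linarith
    qed
    moreover have "u \<ge> 0" "v \<ge> 0" by (auto simp: u_def v_def)
    moreover have "\<bar>int a - int s0\<bar> \<le> \<bar>int a - int t\<bar> + v" unfolding v_def by linarith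
    moreover have "int D \<ge> 1" using D1 by simp
    moreover have "z < x" if "4 * z + 8 * u \<le> D'" "8 * v \<le> D'" "0 \<le> u" "0 \<le> v" "y \<le> x + v" "1 \<le> D'" "D' \<le> 2 * y" for x y z D' :: int
      using that by linarith
    ultimately have "int R * u < \<bar>int a - int t\<bar>" using far0 by blast
    thus ?thesis by (simp add: u_def)
  qed
  have "lacunary R (Suc H) (\<lambda>i. case i of 0 \<Rightarrow> a | Suc i \<Rightarrow> p i)"
  proof (rule lacunary_cons[OF p(1)])
    show "a \<noteq> p i" if "i < H" for i using key[of "p i" "p i"] p(2) that by auto
    show "int R * \<bar>int (p i) - int (p j)\<bar> \<le> \<bar>int a - int (p j)\<bar>" if "i < H" "j < H" for i j
      using key[of "p i" "p j"] p(2) that by fastforce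
  qed
  moreover have "(\<lambda>i. case i of 0 \<Rightarrow> a | Suc i \<Rightarrow> p i) ` {..<Suc H} \<subseteq> S"
    using aS p(2) by (auto simp: T_def image_subset_iff split: nat.splits)
  ultimately show ?case by blast
qed

text \<open>A single prime has more residue classes than there are multipliers m < W.\<close>

lemma packed_prime_multiples:
  assumes p: "prime p" "W \<le> p"
  shows "packed_into {p * m | m. 1 \<le> m \<and> m < W} (multiples n) (n + p)"
proof (rule packed_residue_block)
  have e: "{p * m | m. 1 \<le> m \<and> m < W} = (\<lambda>m. p * m) ` {1..<W}" by auto
  show "finite {p * m | m. 1 \<le> m \<and> m < W}" unfolding e by simp
  have "card {p * m | m. 1 \<le> m \<and> m < W} \<le> card {1..<W}" unfolding e by (rule card_image_le) simp
  thus "card {p * m | m. 1 \<le> m \<and> m < W} \<le> p" using p by simp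
  show "p \<ge> 1" using p by (simp add: prime_gt_0_nat Suc_le_eq)
  thus "d \<ge> 1 \<and> p dvd d" if "d \<in> {p * m | m. 1 \<le> m \<and> m < W}" for d using that by auto
qed

abbreviation prime_multiples :: "nat set \<Rightarrow> nat \<Rightarrow> nat set" where
  "prime_multiples P W \<equiv> {p * m | p m. p \<in> P \<and> 1 \<le> m \<and> m < W}"

text \<open>Lacunary groups of H primes are split off as long as possible.  The last window of a group overlaps nothing, which accounts for the 2 n per
group; the boundedly many primes left over are placed one by one.\<close>

lemma packed_prime_block:
  assumes \<tau>: "0 < \<tau>" "\<tau> \<le> 1 / 2" "real R * \<tau> \<ge> 1" and H: "H \<ge> 1"
    and sm: "2 * real X ^ H * real W \<le> \<tau> * real Q" "X \<ge> 1" "W \<ge> 1" "X < Q"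
    and \<Delta>: "real n + real Q + real X \<le> real \<Delta> + (1 - 8 * \<tau>) * (real Q)\<^sup>2"
    and WQ: "W \<le> Q" and QX: "Q + X \<le> n"
  shows "finite S \<Longrightarrow> (\<And>p. p \<in> S \<Longrightarrow> prime p \<and> Q \<le> p \<and> p \<le> Q + X) \<Longrightarrow>
    packed_into (prime_multiples S W) (multiples n) (card S * \<Delta> + (card S div H) * (2 * n) + (4 * R + 8) ^ H * (2 * n))"
proof (induction "card S" arbitrary: S rule: less_induct)
  case less
  define T where "T = (4 * R + 8) ^ H"
  show ?case
  proof (cases "card S \<ge> T")
    case False
    have "packed_into (\<Union>p\<in>S. {p * m | m. 1 \<le> m \<and> m < W}) (multiples n) (\<Sum>p\<in>S. 2 * n)"
    proof (rule packed_into_UN)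
      show "packed_into {p * m | m. 1 \<le> m \<and> m < W} (multiples n) (2 * n)" if "p \<in> S" for p
      proof (rule packed_into_mono)
        show "packed_into {p * m | m. 1 \<le> m \<and> m < W} (multiples n) (n + p)"
          using less.prems(2)[OF that] WQ by (intro packed_prime_multiples) auto
        show "n + p \<le> 2 * n" using less.prems(2)[OF that] QX by simp
      qed simp
    qed (use less.prems in simp)
    thus ?thesis
    proof (rule packed_into_mono)
      have "card S * (2 * n) \<le> T * (2 * n)" using False by (intro mult_le_mono1) simp
      moreover have "(\<Sum>p\<in>S. 2 * n) = card S * (2 * n)" by simp
      ultimately show "(\<Sum>p\<in>S. 2 * n) \<le> card S * \<Delta> + (card S div H) * (2 * n) + (4 * R + 8) ^ H * (2 * n)"
        unfolding T_def by linarith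
    qed auto
  next
    case True
    obtain p where p: "lacunary R H p" "p ` {..<H} \<subseteq> S"
      using exists_lacunary[of S R H] less.prems True by (auto simp: T_def)
    define P where "P = p ` {..<H}"
    have inj: "inj_on p {..<H}" using p(1) by (simp add: lacunary_def)
    have cP: "card P = H" unfolding P_def by (simp add: card_image[OF inj])
    have PS: "P \<subseteq> S" "finite P" using p(2) by (auto simp: P_def)
    have cd: "card S = card (S - P) + H" using card_Diff_subset[OF PS(2,1)] card_mono[OF less.prems(1) PS(1)] cP by simp
    have 1: "packed_into {p i * m | i m. i < H \<and> 1 \<le> m \<and> m < W} (multiples n) (H * \<Delta> + n + Q + X)"
    proof (rule packed_prime_group[where R = "real R" and \<tau> = \<tau>])
      show "prime (p i) \<and> Q \<le> p i \<and> p i \<le> Q + X" if "i < H" for i using less.prems(2) p(2) that by auto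
      show "real R * real_of_int \<bar>int (p (Suc i)) - int (p j)\<bar> \<le> real_of_int \<bar>int (p i) - int (p j)\<bar>" if "Suc i < j" "j < H" for i j
      proof -
        have "int R * \<bar>int (p (Suc i)) - int (p j)\<bar> \<le> \<bar>int (p i) - int (p j)\<bar>" using p(1) that by (auto simp: lacunary_def)
        hence "real_of_int (int R * \<bar>int (p (Suc i)) - int (p j)\<bar>) \<le> real_of_int \<bar>int (p i) - int (p j)\<bar>" by (simp only: of_int_le_iff)
        thus ?thesis by simp
      qed
    qed (use inj \<tau> sm \<Delta> in auto)
    have 2: "packed_into (prime_multiples (S - P) W) (multiples n) (card (S - P) * \<Delta> + (card (S - P) div H) * (2 * n) + (4 * R + 8) ^ H * (2 * n))"
      using less.prems cd H by (intro less.hyps) auto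
    from packed_into_Un[OF 1 2] show ?thesis
    proof (rule packed_into_mono)
      show "prime_multiples S W \<subseteq> {p i * m |i m. i < H \<and> 1 \<le> m \<and> m < W} \<union> prime_multiples (S - P) W"
        unfolding P_def by blast
      have "card S div H = card (S - P) div H + 1" using cd H by simp
      thus "H * \<Delta> + n + Q + X + (card (S - P) * \<Delta> + card (S - P) div H * (2 * n) + (4 * R + 8) ^ H * (2 * n))
          \<le> card S * \<Delta> + card S div H * (2 * n) + (4 * R + 8) ^ H * (2 * n)"
        using cd QX by (simp add: algebra_simps)
    qed
  qed
qed

section \<open>The upper bound: covering all differences\<close>

text \<open>Look at the least divisor g \<ge> W of d.  If g > V, then dividing g by a prime factor q leads below W; as W^2 \<le> V, this
is only possible if q itself exceeds V.\<close>

lemma divisor_trichotomy: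
  fixes d :: nat
  assumes d: "W \<le> d" "d \<le> V * V" and W: "W \<ge> 2" "W * W \<le> V"
  shows "(\<exists>g. W \<le> g \<and> g \<le> V \<and> g dvd d) \<or> (\<exists>q m. prime q \<and> V < q \<and> 1 \<le> m \<and> m < W \<and> d = q * m)"
proof (cases "\<exists>g. W \<le> g \<and> g \<le> V \<and> g dvd d")
  case False
  define g where "g = (LEAST g. W \<le> g \<and> g dvd d)"
  have g: "W \<le> g" "g dvd d" using LeastI[of "\<lambda>g. W \<le> g \<and> g dvd d" d] d by (auto simp: g_def)
  have gl: "g' < W" if "g' < g" "g' dvd d" for g'
    using not_less_Least[of g' "\<lambda>g. W \<le> g \<and> g dvd d"] that by (auto simp: g_def)
  have gV: "g > V" using False g by (metis not_le)
  obtain q where q: "prime q" "q dvd g" using prime_factor_nat[of g] g W by auto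
  obtain h where h: "g = q * h" using q by (auto elim: dvdE)
  have h0: "h > 0" using h g W by (auto intro: Nat.gr0I)
  have "h < g" using h h0 prime_gt_1_nat[OF q(1)] by simp
  hence "h < W" using gl[of h] h g(2) by (auto intro: dvd_trans[of h g d])
  have qd: "q dvd d" using q g by (auto intro: dvd_trans)
  have "q \<ge> W"
  proof (rule ccontr)
    assume "\<not> q \<ge> W"
    hence "q * h \<le> W * W" using \<open>h < W\<close> by (intro mult_le_mono) auto
    thus False using gV h W by simp
  qed
  hence qV: "q > V" using False qd by (metis not_le)
  obtain m where m: "d = q * m" using qd by (auto elim: dvdE)
  have m0: "m \<ge> 1" using m d W by (cases m) auto
  have "m < W"
  proof (rule ccontr)
    assume "\<not> m < W"
    hence "m > V" using False m by (metis dvd_triv_right not_le)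
    hence "V * V < q * m" using qV by (intro mult_strict_mono) auto
    thus False using d m by simp
  qed
  thus ?thesis using q(1) qV m m0 by blast
qed auto

lemma sum_inverse_squares_le:
  assumes "W \<ge> 2"
  shows "(\<Sum>g=W..V. 1 / (real g)\<^sup>2) \<le> 1 / (real W - 1)"
proof (cases "V \<ge> W")
  case True
  hence "(\<Sum>g=W..V. 1 / (real g)\<^sup>2) \<le> 1 / (real W - 1) - 1 / real V"
  proof (induction V rule: dec_induct)
    case base
    have "real W > 1" using assms by simp
    thus ?case by (simp add: field_simps power2_eq_square)
  next
    case (step V)
    have V: "real V > 0" using step assms by simp
    have "1 / (real (Suc V))\<^sup>2 \<le> 1 / (real V * real (Suc V))"
      using V unfolding power2_eq_square by (intro divide_left_mono mult_right_mono) auto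
    also have "\<dots> = 1 / real V - 1 / real (Suc V)" using V by (simp add: field_simps)
    finally show ?case using step by simp
  qed
  also have "\<dots> \<le> 1 / (real W - 1)" by simp
  finally show ?thesis .
next
  case False
  thus ?thesis using assms by simp
qed

text \<open>The primes are sorted into the intervals from q X to q X + X.  Replacing (q X)^2 by p^2 costs at most 2 r X for each prime.\<close>

lemma packed_primes_in_range:
  assumes \<tau>: "0 < \<tau>" "\<tau> \<le> 1 / 2" "real R * \<tau> \<ge> 1" and H: "H \<ge> 1"
    and sm: "2 * real X ^ H * real W \<le> \<tau> * (real V - real X)" "X \<ge> 1" "W \<ge> 1" "2 * X < V" "W + X \<le> V"
    and r: "r * r \<le> n" "r + X \<le> n"
  shows "\<exists>N. packed_into (prime_multiples {p. prime p \<and> V < p \<and> p \<le> r} W) (multiples n) N \<and>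
     real N \<le> (\<Sum>p | prime p \<and> p \<le> r. real n - (real p)\<^sup>2)
       + real (card {p. prime p \<and> p \<le> r}) * (real r + real X + 1 + 2 * real r * real X + (8 * \<tau> + 2 / real H) * real n)
       + (real r / real X + 1) * (2 * (4 * real R + 8) ^ H * real n)"
proof -
  let ?P = "{p. prime p \<and> V < p \<and> p \<le> r}"
  define S where "S = (\<lambda>q. {p\<in>?P. p div X = q})"
  define \<Delta> where "\<Delta> = (\<lambda>q. nat \<lceil>real n + real (q * X) + real X - (1 - 8 * \<tau>) * (real (q * X))\<^sup>2\<rceil>)"
  define T where "T = (4 * R + 8) ^ H"
  define N where "N = (\<lambda>q. card (S q) * \<Delta> q + (card (S q) div H) * (2 * n) + T * (2 * n))"
  define I where "I = {V div X..r div X}"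
  have finS: "finite (S q)" for q by (simp add: S_def)
  have Sq: "q * X \<le> p \<and> p \<le> q * X + X" if "p \<in> S q" for p q
  proof -
    have "p mod X < X" using sm by simp
    moreover have q: "q = p div X" using that by (simp add: S_def)
    ultimately show ?thesis unfolding q using div_mult_mod_eq[of p X] by (intro conjI) linarith+
  qed
  have blk: "packed_into (prime_multiples (S q) W) (multiples n) (N q)" if q: "q \<in> I" for q
  proof -
    have "V = V div X * X + V mod X" by simp
    moreover have "V mod X < X" using sm by simp
    moreover have "V div X * X \<le> q * X" using q by (simp add: I_def)
    ultimately have QV: "V < q * X + X" by linarith
    have "q * X \<le> r div X * X" using q by (simp add: I_def)
    also have "\<dots> \<le> r" by simp
    finally have Qr: "q * X \<le> r" .
    show ?thesis unfolding N_def T_def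
    proof (rule packed_prime_block[OF \<tau> H])
      have "2 * real X ^ H * real W \<le> \<tau> * (real V - real X)" by (rule sm)
      also have "\<dots> \<le> \<tau> * real (q * X)" using QV \<tau> by (intro mult_left_mono) linarith+
      finally show "2 * real X ^ H * real W \<le> \<tau> * real (q * X)" .
      show "X < q * X" "W \<le> q * X" using QV sm by linarith+
      show "q * X + X \<le> n" using Qr r by linarith
      have "real n + real (q * X) + real X - (1 - 8 * \<tau>) * (real (q * X))\<^sup>2 \<le> real (\<Delta> q)"
        unfolding \<Delta>_def by (rule real_nat_ceiling_ge)
      thus "real n + real (q * X) + real X \<le> real (\<Delta> q) + (1 - 8 * \<tau>) * (real (q * X))\<^sup>2" by linarith
      show "finite (S q)" by (rule finS)
      show "prime p \<and> q * X \<le> p \<and> p \<le> q * X + X" if "p \<in> S q" for p using Sq[OF that] that by (simp add: S_def)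
    qed (use sm in auto)
  qed
  have "packed_into (\<Union>q\<in>I. prime_multiples (S q) W) (multiples n) (\<Sum>q\<in>I. N q)"
    using blk by (intro packed_into_UN) (auto simp: I_def)
  hence pk: "packed_into (prime_multiples {p. prime p \<and> V < p \<and> p \<le> r} W) (multiples n) (\<Sum>q\<in>I. N q)"
  proof (rule packed_into_mono)
    show "prime_multiples {p. prime p \<and> V < p \<and> p \<le> r} W \<subseteq> (\<Union>q\<in>I. prime_multiples (S q) W)"
    proof
      fix d assume "d \<in> prime_multiples {p. prime p \<and> V < p \<and> p \<le> r} W"
      then obtain p m where pm: "d = p * m" "prime p" "V < p" "p \<le> r" "1 \<le> m" "m < W" by blast
      have "p div X \<in> I" using pm by (auto simp: I_def intro: div_le_mono)
      moreover have "p \<in> S (p div X)" using pm by (simp add: S_def)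
      ultimately show "d \<in> (\<Union>q\<in>I. prime_multiples (S q) W)" using pm by blast
    qed
  qed simp
  define K where "K = real r + real X + 1 + 2 * real r * real X + (8 * \<tau> + 2 / real H) * real n"
  have K0: "K \<ge> 0" using \<tau> by (simp add: K_def)
  have summand: "real (\<Delta> q) + 2 * real n / real H \<le> (real n - (real p)\<^sup>2) + K" if p: "p \<in> S q" for p q
  proof -
    define Q where "Q = q * X"
    have pQ: "Q \<le> p" "p \<le> Q + X" using Sq[OF p] by (auto simp: Q_def)
    have pr: "p \<le> r" "V < p" using p by (auto simp: S_def)
    have QQ: "Q * Q \<le> n" using pQ pr r by (meson le_trans mult_le_mono)
    have QQ': "(real Q)\<^sup>2 \<le> real n" using QQ unfolding power2_eq_square by (metis of_nat_le_iff of_nat_mult)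
    have "real n + real Q + real X - (1 - 8 * \<tau>) * (real Q)\<^sup>2 = (real n - (real Q)\<^sup>2) + real Q + real X + 8 * \<tau> * (real Q)\<^sup>2"
      by (simp add: algebra_simps)
    also have "\<dots> \<ge> 0" using QQ' \<tau> by (intro add_nonneg_nonneg) auto
    finally have nn: "real n + real Q + real X - (1 - 8 * \<tau>) * (real Q)\<^sup>2 \<ge> 0" .
    have "real (\<Delta> q) = of_int \<lceil>real n + real Q + real X - (1 - 8 * \<tau>) * (real Q)\<^sup>2\<rceil>"
      using nn unfolding \<Delta>_def Q_def[symmetric] by simp
    also have "\<dots> \<le> real n + real Q + real X - (1 - 8 * \<tau>) * (real Q)\<^sup>2 + 1" by linarith
    also have "\<dots> = real n + real Q + real X + 8 * \<tau> * (real Q)\<^sup>2 - (real Q)\<^sup>2 + 1" by (simp add: algebra_simps)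
    finally have 1: "real (\<Delta> q) \<le> real n + real Q + real X + 8 * \<tau> * (real Q)\<^sup>2 - (real Q)\<^sup>2 + 1" .
    have 2: "8 * \<tau> * (real Q)\<^sup>2 \<le> 8 * \<tau> * real n" using QQ' \<tau> by (intro mult_left_mono) auto
    have 3: "(real p)\<^sup>2 - 2 * real r * real X \<le> (real Q)\<^sup>2"
    proof -
      have "real p - real X \<ge> 0" using pr sm by linarith
      hence "(real p - real X)\<^sup>2 \<le> (real Q)\<^sup>2" using pQ by (intro power_mono) linarith+
      moreover have "(real p - real X)\<^sup>2 = (real p)\<^sup>2 - 2 * real p * real X + (real X)\<^sup>2" by (simp add: power2_eq_square algebra_simps)
      moreover have "real p * real X \<le> real r * real X" using pr by (intro mult_right_mono) auto
      moreover have "(real X)\<^sup>2 \<ge> 0" by simp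
      ultimately show ?thesis by linarith
    qed
    have 4: "real Q \<le> real r" using pQ pr by linarith
    have "K = real r + real X + 1 + 2 * real r * real X + 8 * \<tau> * real n + 2 * real n / real H"
      unfolding K_def by (simp add: algebra_simps)
    thus ?thesis using 1 2 3 4 by linarith
  qed
  have "real (\<Sum>q\<in>I. N q) \<le> (\<Sum>q\<in>I. (\<Sum>p\<in>S q. (real n - (real p)\<^sup>2) + K) + real T * (2 * real n))"
    unfolding of_nat_sum
  proof (rule sum_mono)
    fix q assume "q \<in> I"
    have "real (card (S q) div H) \<le> real (card (S q)) / real H" by (rule of_nat_div_le_of_nat)
    hence "real (card (S q) div H) * (2 * real n) \<le> real (card (S q)) / real H * (2 * real n)" by (intro mult_right_mono) auto
    hence "real (N q) \<le> real (card (S q)) * (real (\<Delta> q) + 2 * real n / real H) + real T * (2 * real n)"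
      unfolding N_def by (simp add: algebra_simps)
    also have "real (card (S q)) * (real (\<Delta> q) + 2 * real n / real H) = (\<Sum>p\<in>S q. real (\<Delta> q) + 2 * real n / real H)" by simp
    also have "\<dots> \<le> (\<Sum>p\<in>S q. (real n - (real p)\<^sup>2) + K)" using summand by (intro sum_mono) auto
    finally show "real (N q) \<le> (\<Sum>p\<in>S q. (real n - (real p)\<^sup>2) + K) + real T * (2 * real n)" by simp
  qed
  also have "\<dots> = (\<Sum>q\<in>I. \<Sum>p\<in>S q. (real n - (real p)\<^sup>2) + K) + real (card I) * (real T * (2 * real n))"
    by (simp add: sum.distrib)
  also have "(\<Sum>q\<in>I. \<Sum>p\<in>S q. (real n - (real p)\<^sup>2) + K) = (\<Sum>p\<in>?P. (real n - (real p)\<^sup>2) + K)"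
    unfolding S_def
  proof (rule sum.group)
    show "(\<lambda>p. p div X) ` ?P \<subseteq> I" by (rule image_subsetI) (simp add: I_def div_le_mono less_imp_le_nat)
  qed (auto simp: I_def)
  also have "\<dots> \<le> (\<Sum>p | prime p \<and> p \<le> r. (real n - (real p)\<^sup>2) + K)"
  proof (rule sum_mono2)
    fix p assume "p \<in> {p. prime p \<and> p \<le> r} - ?P"
    hence "p * p \<le> n" using r by (auto intro: le_trans[OF mult_le_mono])
    hence "(real p)\<^sup>2 \<le> real n" unfolding power2_eq_square by (metis of_nat_le_iff of_nat_mult)
    thus "0 \<le> (real n - (real p)\<^sup>2) + K" using K0 by linarith
  qed auto
  also have "\<dots> = (\<Sum>p | prime p \<and> p \<le> r. real n - (real p)\<^sup>2) + real (card {p. prime p \<and> p \<le> r}) * K"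
    by (simp add: sum.distrib)
  also have "real (card I) * (real T * (2 * real n)) \<le> (real r / real X + 1) * (real T * (2 * real n))"
  proof (rule mult_right_mono)
    have "real (card I) \<le> real (r div X) + 1" by (simp add: I_def)
    also have "real (r div X) \<le> real r / real X" by (rule of_nat_div_le_of_nat)
    finally show "real (card I) \<le> real r / real X + 1" by simp
  qed simp
  finally have "real (\<Sum>q\<in>I. N q) \<le> (\<Sum>p | prime p \<and> p \<le> r. real n - (real p)\<^sup>2) + real (card {p. prime p \<and> p \<le> r}) * K
     + (real r / real X + 1) * (2 * (4 * real R + 8) ^ H * real n)" by (simp add: T_def mult.assoc mult.left_commute)
  with pk show ?thesis unfolding K_def by blast
qed

text \<open>The five families of the covering are: d < W, one by one; d \<le> D with a divisor between W and V; d = q m with a prime q > r;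
d = p m with a prime p between V and r; and d > D, greedily.  Only the fourth one contributes to the main term.\<close>

lemma packing_upper_bound:
  assumes \<tau>: "0 < \<tau>" "\<tau> \<le> 1 / 2" "real R * \<tau> \<ge> 1" and H: "H \<ge> 1"
    and sm: "2 * real X ^ H * real W \<le> \<tau> * (real V - real X)" "X \<ge> 1" "W \<ge> 2" "2 * X < V" "W + X \<le> V" "W * W \<le> V"
    and r: "r * r \<le> n" "n < Suc r * Suc r" "r + X \<le> n"
    and D: "D \<le> V * V" "D \<ge> 1" and Vn: "V \<le> n"
  shows "\<exists>N. packed_into {1..n} (multiples n) N \<and>
     real N \<le> (\<Sum>p | prime p \<and> p \<le> r. real n - (real p)\<^sup>2)
       + real (card {p. prime p \<and> p \<le> r}) * (real r + real X + 1 + 2 * real r * real X + (8 * \<tau> + 2 / real H) * real n)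
       + (real r / real X + 1) * (2 * (4 * real R + 8) ^ H * real n)
       + 2 * real W * real n + 2 * real n * (real D / (real W - 1) + real V) + real n + real n / real D * (real n * (\<Sum>d=1..n. 1 / real d))"
proof -
  obtain N3 where N3: "packed_into (prime_multiples {p. prime p \<and> V < p \<and> p \<le> r} W) (multiples n) N3"
     "real N3 \<le> (\<Sum>p | prime p \<and> p \<le> r. real n - (real p)\<^sup>2)
       + real (card {p. prime p \<and> p \<le> r}) * (real r + real X + 1 + 2 * real r * real X + (8 * \<tau> + 2 / real H) * real n)
       + (real r / real X + 1) * (2 * (4 * real R + 8) ^ H * real n)"
    using packed_primes_in_range[OF \<tau> H sm(1,2) _ sm(4,5) r(1,3)] sm(3) by auto
  have N0: "packed_into (\<Union>d\<in>{1..<W}. {d}) (multiples n) (\<Sum>d\<in>{1..<W}. n)"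
    by (intro packed_into_UN packed_single) auto
  have N1: "packed_into (\<Union>g\<in>{W..V}. {d\<in>{1..D}. g dvd d}) (multiples n) (\<Sum>g\<in>{W..V}. (n + g) * ((D div g) div g + 1))"
  proof (rule packed_into_UN)
    fix g assume g: "g \<in> {W..V}"
    have g1: "g \<ge> 1" using g sm by auto
    have "{d\<in>{1..D}. g dvd d} \<subseteq> (\<lambda>j. g * j) ` {1..D div g}"
      using g1 by (auto elim!: dvdE simp: less_eq_div_iff_mult_less_eq mult.commute Suc_le_eq intro: Nat.gr0I)
    from card_mono[OF _ this] have "card {d\<in>{1..D}. g dvd d} \<le> D div g"
      using card_image_le[of "{1..D div g}" "\<lambda>j. g * j"] by fastforce
    hence c: "card {d\<in>{1..D}. g dvd d} div g \<le> (D div g) div g" by (rule div_le_mono)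
    have "packed_into {d\<in>{1..D}. g dvd d} (multiples n) ((n + g) * (card {d\<in>{1..D}. g dvd d} div g + 1))"
      using g1 by (intro packed_divisible) auto
    thus "packed_into {d\<in>{1..D}. g dvd d} (multiples n) ((n + g) * ((D div g) div g + 1))"
      by (rule packed_into_mono) (use c in auto)
  qed simp
  have N2: "packed_into (\<Union>m\<in>{1..<W}. {q * m | q. prime q \<and> r < q}) (multiples n) (\<Sum>m\<in>{1..<W}. n)"
  proof (rule packed_into_UN)
    fix m assume m: "m \<in> {1..<W}"
    show "packed_into {q * m | q. prime q \<and> r < q} (multiples n) n"
    proof (rule packed_large_primes)
      show "m \<ge> 1" using m by simp
      fix d assume "d \<in> {q * m | q. prime q \<and> r < q}"
      then obtain q where q: "d = q * m" "prime q" "r < q" by blast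
      have "Suc r * Suc r \<le> q * q" using q by (intro mult_le_mono) auto
      thus "\<exists>p. prime p \<and> n < p * p \<and> d = p * m" using q r by (intro exI[of _ q]) auto
    qed
  qed simp
  define b where "b = (\<Sum>d\<in>{D<..n}. n div d)"
  have N4: "packed_into {D<..n} (multiples n) (n + (n div D) * b)"
  proof (rule packed_greedy)
    fix d assume d: "d \<in> {D<..n}"
    have "multiples n d \<subseteq> {1..int n}" using multiples_range[of _ n d] d D by auto
    moreover have "card (multiples n d) \<le> n div D"
      using card_multiples[of n d] div_le_mono2[of D d n] d D by simp
    ultimately show "finite (multiples n d) \<and> multiples n d \<subseteq> {1..int n} \<and> card (multiples n d) \<le> n div D" by simp
  qed (auto simp: b_def intro!: sum_mono card_multiples)
  define N where "N = (\<Sum>d\<in>{1..<W}. n) + ((\<Sum>g\<in>{W..V}. (n + g) * ((D div g) div g + 1)) + ((\<Sum>m\<in>{1..<W}. n) + (N3 + (n + (n div D) * b))))"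
  have "packed_into ((\<Union>d\<in>{1..<W}. {d}) \<union> ((\<Union>g\<in>{W..V}. {d\<in>{1..D}. g dvd d}) \<union> ((\<Union>m\<in>{1..<W}. {q * m | q. prime q \<and> r < q})
      \<union> (prime_multiples {p. prime p \<and> V < p \<and> p \<le> r} W \<union> {D<..n})))) (multiples n) N"
    unfolding N_def by (intro packed_into_Un N0 N1 N2 N3 N4)
  hence "packed_into {1..n} (multiples n) N"
  proof (rule packed_into_mono)
    show "{1..n} \<subseteq> (\<Union>d\<in>{1..<W}. {d}) \<union> ((\<Union>g\<in>{W..V}. {d\<in>{1..D}. g dvd d}) \<union> ((\<Union>m\<in>{1..<W}. {q * m | q. prime q \<and> r < q})
      \<union> (prime_multiples {p. prime p \<and> V < p \<and> p \<le> r} W \<union> {D<..n})))" (is "_ \<subseteq> ?U")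
    proof
      fix d assume d: "d \<in> {1..n}"
      show "d \<in> ?U"
      proof (cases "d < W \<or> d > D")
        case True
        thus ?thesis using d by auto
      next
        case False
        hence "W \<le> d" "d \<le> V * V" using D by auto
        from divisor_trichotomy[OF this sm(3,6)] show ?thesis
        proof
          assume "\<exists>g. W \<le> g \<and> g \<le> V \<and> g dvd d"
          thus ?thesis using d False by auto
        next
          assume "\<exists>q m. prime q \<and> V < q \<and> 1 \<le> m \<and> m < W \<and> d = q * m"
          then obtain q m where qm: "prime q" "V < q" "1 \<le> m" "m < W" "d = q * m" by blast
          show ?thesis
          proof (cases "q \<le> r")
            case True
            thus ?thesis using qm by blast
          next
            case False
            hence "d \<in> (\<Union>m\<in>{1..<W}. {q * m | q. prime q \<and> r < q})" using qm by (intro UN_I[of m]) auto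
            thus ?thesis by blast
          qed
        qed
      qed
    qed
  qed simp
  moreover have "real N \<le> real W * real n + (2 * real n * (real D / (real W - 1) + real V)) + real W * real n + real N3 + (real n + real n / real D * (real n * (\<Sum>d=1..n. 1 / real d)))"
  proof -
    have a: "real (\<Sum>d\<in>{1..<W}. n) \<le> real W * real n"
    proof -
      have "(\<Sum>d\<in>{1..<W}. n) = (W - 1) * n" by simp
      also have "real \<dots> \<le> real W * real n" unfolding of_nat_mult by (intro mult_right_mono) auto
      finally show ?thesis .
    qed
    have "real (\<Sum>g\<in>{W..V}. (n + g) * ((D div g) div g + 1)) \<le> (\<Sum>g\<in>{W..V}. 2 * real n * (real D * (1 / (real g)\<^sup>2) + 1))"
      unfolding of_nat_sum
    proof (rule sum_mono)
      fix g assume g: "g \<in> {W..V}"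
      have "real (n + g) \<le> 2 * real n" using g Vn by simp
      moreover have "real ((D div g) div g + 1) \<le> real D * (1 / (real g)\<^sup>2) + 1"
      proof -
        have "real ((D div g) div g) = real (D div (g * g))" by (simp add: div_mult2_eq)
        also have "\<dots> \<le> real D / real (g * g)" by (rule of_nat_div_le_of_nat)
        finally show ?thesis by (simp add: power2_eq_square)
      qed
      ultimately have "real (n + g) * real ((D div g) div g + 1) \<le> 2 * real n * (real D * (1 / (real g)\<^sup>2) + 1)"
        by (intro mult_mono) auto
      thus "real ((n + g) * ((D div g) div g + 1)) \<le> 2 * real n * (real D * (1 / (real g)\<^sup>2) + 1)" by (simp only: of_nat_mult)
    qed
    also have "\<dots> = 2 * real n * (real D * (\<Sum>g\<in>{W..V}. 1 / (real g)\<^sup>2) + real (card {W..V}))"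
      by (simp add: sum.distrib sum_distrib_left algebra_simps)
    also have "\<dots> \<le> 2 * real n * (real D * (1 / (real W - 1)) + real V)"
    proof (intro mult_left_mono add_mono sum_inverse_squares_le sm)
      show "real (card {W..V}) \<le> real V" using sm by simp
    qed auto
    finally have b1: "real (\<Sum>g\<in>{W..V}. (n + g) * ((D div g) div g + 1)) \<le> 2 * real n * (real D / (real W - 1) + real V)" by simp
    have "real b \<le> (\<Sum>d\<in>{D<..n}. real n * (1 / real d))"
      unfolding b_def of_nat_sum using of_nat_div_le_of_nat[where ?'a = real] by (intro sum_mono) simp
    also have "\<dots> \<le> (\<Sum>d\<in>{1..n}. real n * (1 / real d))" using D by (intro sum_mono2) auto
    finally have b2: "real b \<le> real n * (\<Sum>d=1..n. 1 / real d)" by (simp add: sum_distrib_left)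
    have "real (n div D) * real b \<le> real n / real D * (real n * (\<Sum>d=1..n. 1 / real d))"
      using of_nat_div_le_of_nat[of n D, where ?'a = real] b2 by (intro mult_mono) auto
    hence c: "real (n + (n div D) * b) \<le> real n + real n / real D * (real n * (\<Sum>d=1..n. 1 / real d))" by simp
    show ?thesis unfolding N_def of_nat_add using a b1 c by linarith
  qed
  ultimately show ?thesis using N3(2) by (intro exI[of _ N] conjI) linarith+
qed

section \<open>The zeta function near the line of real part one\<close>

lemma norm_nat_powr: "cmod (of_nat n powr s) = real n powr Re s"
  using norm_powr_real_powr[of "of_nat n" s] by simp

text \<open>The Weierstrass test, applied to bounded parts of smaller half-planes.\<close>

lemma series_halfplane:
  fixes f f' :: "nat \<Rightarrow> complex \<Rightarrow> complex"
  assumes der: "\<And>n s. Re s > a \<Longrightarrow> (f n has_field_derivative f' n s) (at s)"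
    and bound: "\<And>\<delta> B. \<delta> > a \<Longrightarrow> \<exists>K e. e > 1 \<and>
      (\<forall>n\<ge>1. \<forall>s. Re s \<ge> \<delta> \<longrightarrow> cmod s \<le> B \<longrightarrow> cmod (f n s) \<le> K * real n powr (-e))"
  defines "F \<equiv> \<lambda>s. \<Sum>n. f n s"
  shows "F holomorphic_on {s. Re s > a}"
    and "\<And>s. Re s > a \<Longrightarrow> (\<lambda>n. f n s) sums F s"
    and "\<And>s. Re s > a \<Longrightarrow> (\<lambda>n. f' n s) sums deriv F s"
proof -
  let ?S = "{s. Re s > a}"
  have op: "open ?S" by (rule open_halfspace_Re_gt)
  have "\<exists>g g'. \<forall>x \<in> ?S. ((\<lambda>n. f n x) sums g x) \<and> ((\<lambda>n. f' n x) sums g' x) \<and> (g has_field_derivative g' x) (at x)"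
  proof (rule series_and_derivative_comparison_complex[OF op])
    show "(f n has_field_derivative f' n x) (at x)" if "x \<in> ?S" for n x using der that by auto
    fix x assume x: "x \<in> ?S"
    define d where "d = (Re x - a) / 2"
    have d: "d > 0" using x by (simp add: d_def)
    obtain K e where K: "e > 1" "\<And>n s. n \<ge> 1 \<Longrightarrow> Re s \<ge> a + d \<Longrightarrow> cmod s \<le> cmod x + d \<Longrightarrow> cmod (f n s) \<le> K * real n powr (-e)"
      using bound[of "a + d" "cmod x + d"] d by auto
    define h where "h = (\<lambda>n. complex_of_real (\<bar>K\<bar> * real n powr (-e)))"
    have "summable h" unfolding h_def using K(1) summable_real_powr_iff[of "-e"]
      by (intro summable_of_real summable_mult) auto
    moreover have "range h \<subseteq> \<real>\<^sub>\<ge>\<^sub>0" by (auto simp: h_def nonneg_Reals_of_real_iff simp del: of_real_mult)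
    moreover have "\<forall>\<^sub>F n in sequentially. \<forall>y\<in>ball x d \<inter> ?S. cmod (f n y) \<le> cmod (h n)"
    proof (rule eventually_sequentiallyI[of 1], intro ballI)
      fix n y assume n: "(1::nat) \<le> n" and y: "y \<in> ball x d \<inter> ?S"
      have 1: "cmod (y - x) < d" using y by (simp add: dist_norm norm_minus_commute)
      have "Re x - Re y \<le> cmod (y - x)" using abs_Re_le_cmod[of "y - x"] by simp
      hence 2: "Re y \<ge> a + d" using 1 by (simp add: d_def field_simps)
      have 3: "cmod y \<le> cmod x + d" using norm_triangle_ineq[of x "y - x"] 1 by simp
      have "cmod (f n y) \<le> K * real n powr (-e)" using K(2)[OF n 2 3] .
      also have "\<dots> \<le> \<bar>K\<bar> * real n powr (-e)" by (intro mult_right_mono) auto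
      also have "\<dots> = cmod (h n)" unfolding h_def norm_of_real by simp
      finally show "cmod (f n y) \<le> cmod (h n)" .
    qed
    ultimately show "\<exists>d h. 0 < d \<and> summable h \<and> range h \<subseteq> \<real>\<^sub>\<ge>\<^sub>0 \<and>
        (\<forall>\<^sub>F n in sequentially. \<forall>y\<in>ball x d \<inter> ?S. cmod (f n y) \<le> cmod (h n))"
      using d by blast
  qed
  then obtain g g' where g: "\<And>x. Re x > a \<Longrightarrow> (\<lambda>n. f n x) sums g x" "\<And>x. Re x > a \<Longrightarrow> (\<lambda>n. f' n x) sums g' x"
    "\<And>x. Re x > a \<Longrightarrow> (g has_field_derivative g' x) (at x)" by blast
  have Fg: "F x = g x" if "Re x > a" for x using g(1)[OF that] by (simp add: F_def sums_iff)
  have dF: "(F has_field_derivative g' x) (at x)" if "Re x > a" for x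
  proof (rule has_field_derivative_transform_within_open[OF g(3)[OF that] op])
    show "x \<in> ?S" using that by simp
    show "g y = F y" if "y \<in> ?S" for y using Fg that by simp
  qed
  show "F holomorphic_on ?S" using dF op by (auto simp: holomorphic_on_open)
  show "\<And>s. Re s > a \<Longrightarrow> (\<lambda>n. f n s) sums F s" using g(1) Fg by simp
  show "\<And>s. Re s > a \<Longrightarrow> (\<lambda>n. f' n s) sums deriv F s" using g(2) dF DERIV_imp_deriv by metis
qed

text \<open>This is s - 1 times the difference of n^(-s) and the integral of x^(-s) from n to n + 1.  As powers of 0 are 0, the term for n = 0 is
the constant 1, so that the sum of all terms is (s - 1) \<zeta>(s).\<close>

definition zeta_term :: "nat \<Rightarrow> complex \<Rightarrow> complex" where
  "zeta_term n s = (s - 1) * of_nat n powr (- s) + of_nat (Suc n) powr (1 - s) - of_nat n powr (1 - s)"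

lemma zeta_term_0 [simp]: "zeta_term 0 s = 1" by (simp add: zeta_term_def)

text \<open>Taylor's theorem of first order for x^(1-s) at n.\<close>

lemma zeta_term_bound:
  assumes n: "n \<ge> 1" and s: "Re s \<ge> 0"
  shows "cmod (zeta_term n s) \<le> cmod (s - 1) * cmod s * real n powr (- Re s - 1)"
proof -
  define f where "f = (\<lambda>(i::nat) z::complex. if i = 0 then z powr (1 - s) else if i = 1 then (1 - s) * z powr (- s)
        else (1 - s) * (- s) * z powr (- s - 1))"
  let ?S = "closed_segment (of_nat n :: complex) (of_nat (Suc n))"
  have S: "\<exists>t. z = complex_of_real t \<and> t \<ge> n" if z: "z \<in> ?S" for z
  proof -
    obtain u where u: "0 \<le> u" "z = (1 - u) *\<^sub>R of_nat n + u *\<^sub>R of_nat (Suc n)"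
      using z by (auto simp: in_segment)
    have "z = complex_of_real (real n + u)" using u(2) by (simp add: scaleR_conv_of_real algebra_simps)
    thus ?thesis using u(1) by (intro exI[of _ "real n + u"]) simp
  qed
  have "cmod (f 0 (of_nat (Suc n)) - (\<Sum>i\<le>1. f i (of_nat n) * (of_nat (Suc n) - of_nat n) ^ i / (fact i)))
      \<le> (cmod (s - 1) * cmod s * real n powr (- Re s - 1)) * cmod (of_nat (Suc n) - of_nat n)^(Suc 1) / fact 1"
  proof (rule complex_Taylor[of ?S])
    fix i x assume x: "x \<in> ?S" and i: "i \<le> (1::nat)"
    obtain t where t: "x = complex_of_real t" "t \<ge> n" using S[OF x] by blast
    have x0: "x \<notin> \<real>\<^sub>\<le>\<^sub>0" using t n by (simp add: complex_nonpos_Reals_iff)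
    have "i = 0 \<or> i = 1" using i by auto
    thus "(f i has_field_derivative f (Suc i) x) (at x within ?S)"
    proof
      assume "i = 0"
      thus ?thesis unfolding f_def using has_field_derivative_powr[OF x0, of "1 - s"]
        by (auto intro: has_field_derivative_at_within)
    next
      assume "i = 1"
      thus ?thesis unfolding f_def using DERIV_cmult[OF has_field_derivative_powr[OF x0, of "- s"], of "1 - s"]
        by (auto intro: has_field_derivative_at_within simp: mult.assoc)
    qed
  next
    fix x assume x: "x \<in> ?S"
    obtain t where t: "x = complex_of_real t" "t \<ge> n" using S[OF x] by blast
    have "cmod (x powr (- s - 1)) = t powr (- Re s - 1)" using t n by (simp add: norm_powr_real_powr)
    also have "\<dots> \<le> real n powr (- Re s - 1)" using t n s by (intro powr_mono2') auto
    finally have "cmod (x powr (- s - 1)) \<le> real n powr (- Re s - 1)" .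
    hence "cmod (1 - s) * cmod s * cmod (x powr (- s - 1)) \<le> cmod (1 - s) * cmod s * real n powr (- Re s - 1)"
      by (intro mult_left_mono) auto
    thus "cmod (f (Suc 1) x) \<le> cmod (s - 1) * cmod s * real n powr (- Re s - 1)"
      by (simp add: f_def norm_mult norm_minus_commute)
  qed auto
  also have "f 0 (of_nat (Suc n)) - (\<Sum>i\<le>1. f i (of_nat n) * (of_nat (Suc n) - of_nat n) ^ i / (fact i)) = zeta_term n s"
    by (simp add: f_def zeta_term_def algebra_simps)
  finally show ?thesis by simp
qed

lemma zeta_term_deriv: "\<exists>d. (zeta_term n has_field_derivative d) (at s)"
proof (cases "n = 0")
  case True
  have "zeta_term n = (\<lambda>_. 1)" using True by auto
  thus ?thesis by (auto intro!: exI[of _ 0])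
next
  case False
  hence "of_nat n \<noteq> (0::complex)" "of_nat (Suc n) \<noteq> (0::complex)" by (auto simp del: of_nat_Suc)
  thus ?thesis unfolding zeta_term_def powr_def by (auto intro!: derivative_eq_intros exI simp del: of_nat_Suc)
qed

text \<open>The continuation of (s - 1) \<zeta>(s) to the half-plane of positive real part.\<close>

definition reg_zeta :: "complex \<Rightarrow> complex" where "reg_zeta s = (\<Sum>n. zeta_term n s)"

text \<open>For j = 0 this gives the continuation of (s - 1) \<zeta>(s); the shift by j makes up for coefficients that grow like n^j.\<close>

lemma zeta_term_series:
  assumes \<alpha>: "\<And>n. n \<ge> 1 \<Longrightarrow> cmod (\<alpha> n) \<le> C * real n powr real j"
  shows "(\<lambda>s. \<Sum>n. \<alpha> n * zeta_term n (s + of_nat j)) holomorphic_on {s. Re s > 0}"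
    and "Re s > 0 \<Longrightarrow> (\<lambda>n. \<alpha> n * zeta_term n (s + of_nat j)) sums (\<Sum>n. \<alpha> n * zeta_term n (s + of_nat j))"
proof -
  obtain z' where z': "\<And>n s. (zeta_term n has_field_derivative z' n s) (at s)" using zeta_term_deriv by metis
  have 1: "((\<lambda>s. \<alpha> n * zeta_term n (s + of_nat j)) has_field_derivative \<alpha> n * (z' n (s + of_nat j) * 1)) (at s)" for n s
    by (intro DERIV_cmult DERIV_chain2[OF z']) (auto intro!: derivative_eq_intros)
  have C: "C \<ge> 0" using order_trans[OF norm_ge_zero \<alpha>[of 1]] by simp
  have 2: "\<exists>K e. e > 1 \<and> (\<forall>n\<ge>1. \<forall>s. Re s \<ge> \<delta> \<longrightarrow> cmod s \<le> B \<longrightarrow>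
     cmod (\<alpha> n * zeta_term n (s + of_nat j)) \<le> K * real n powr (-e))" if \<delta>: "\<delta> > 0" for \<delta> B
  proof (intro exI conjI allI impI)
    show "1 + \<delta> > 1" using \<delta> by simp
    fix n :: nat and s assume n: "1 \<le> n" and s: "\<delta> \<le> Re s" "cmod s \<le> B"
    have B: "B \<ge> 0" using s(2) order_trans[OF norm_ge_zero] by blast
    have "cmod (zeta_term n (s + of_nat j)) \<le> cmod (s + of_nat j - 1) * cmod (s + of_nat j) * real n powr (- Re (s + of_nat j) - 1)"
      using s \<delta> by (intro zeta_term_bound n) auto
    also have "\<dots> \<le> ((B + j + 1) * (B + j)) * real n powr (- real j - 1 - \<delta>)"
    proof (intro mult_mono powr_mono)
      show "cmod (s + of_nat j) \<le> B + j" using norm_triangle_ineq[of s "of_nat j"] s(2) by simp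
      thus "cmod (s + of_nat j - 1) \<le> B + j + 1" using norm_triangle_ineq4[of "s + of_nat j" 1] by simp
    qed (use s n B in auto)
    finally have "cmod (\<alpha> n * zeta_term n (s + of_nat j)) \<le> (C * real n powr real j) * (((B + j + 1) * (B + j)) * real n powr (- real j - 1 - \<delta>))"
      unfolding norm_mult using \<alpha>[OF n] C by (intro mult_mono) auto
    also have "\<dots> = C * ((B + j + 1) * (B + j)) * (real n powr real j * real n powr (- real j - 1 - \<delta>))" by simp
    also have "real n powr real j * real n powr (- real j - 1 - \<delta>) = real n powr (-(1 + \<delta>))"
      by (subst powr_add[symmetric]) simp
    finally show "cmod (\<alpha> n * zeta_term n (s + of_nat j)) \<le> C * ((B + j + 1) * (B + j)) * real n powr (-(1 + \<delta>))" .
  qed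
  show "(\<lambda>s. \<Sum>n. \<alpha> n * zeta_term n (s + of_nat j)) holomorphic_on {s. Re s > 0}"
    by (rule series_halfplane(1)[OF 1 2])
  show "Re s > 0 \<Longrightarrow> (\<lambda>n. \<alpha> n * zeta_term n (s + of_nat j)) sums (\<Sum>n. \<alpha> n * zeta_term n (s + of_nat j))"
    by (rule series_halfplane(2)[OF 1 2])
qed

lemma reg_zeta_holo: "reg_zeta holomorphic_on {s. Re s > 0}"
  using zeta_term_series(1)[of "\<lambda>_. 1" 1 0] unfolding reg_zeta_def by simp

lemma reg_zeta_sums: "Re s > 0 \<Longrightarrow> (\<lambda>n. zeta_term n s) sums reg_zeta s"
  using zeta_term_series(2)[of "\<lambda>_. 1" 1 0 s] unfolding reg_zeta_def by simp

lemma dirichlet_series: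
  fixes \<alpha> :: "nat \<Rightarrow> complex"
  assumes \<alpha>: "\<And>n. n \<ge> 1 \<Longrightarrow> cmod (\<alpha> n) \<le> C * (1 + ln (real n))"
  defines "F \<equiv> \<lambda>s. \<Sum>n. \<alpha> n * of_nat n powr (- s)"
  shows "F holomorphic_on {s. Re s > 1}"
    and "\<And>s. Re s > 1 \<Longrightarrow> (\<lambda>n. \<alpha> n * of_nat n powr (- s)) sums F s"
    and "\<And>s. Re s > 1 \<Longrightarrow> (\<lambda>n. - \<alpha> n * of_real (ln (real n)) * of_nat n powr (- s)) sums deriv F s"
    and "\<And>s. Re s > 1 \<Longrightarrow> summable (\<lambda>n. cmod (\<alpha> n * of_nat n powr (- s)))"
proof -
  let ?f = "\<lambda>n s. \<alpha> n * of_nat n powr (- s)"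
  let ?f' = "\<lambda>n s. - \<alpha> n * of_real (ln (real n)) * of_nat n powr (- s)"
  have C: "C \<ge> 0" using order_trans[OF norm_ge_zero \<alpha>[of 1]] by simp
  have der: "(?f n has_field_derivative ?f' n s) (at s)" for n s
  proof (cases "n = 0")
    case False
    hence *: "Ln (of_nat n) = of_real (ln (real n))" using Ln_of_nat[of n] by simp
    have "((\<lambda>s. of_nat n powr (- s)) has_field_derivative (- of_real (ln (real n)) * of_nat n powr (- s))) (at s)"
      using False unfolding powr_def * by (auto intro!: derivative_eq_intros)
    from DERIV_cmult[OF this, of "\<alpha> n"] show ?thesis by (simp add: algebra_simps)
  qed auto
  have bd: "\<exists>K e. e > 1 \<and> (\<forall>n\<ge>1. \<forall>s. Re s \<ge> \<delta> \<longrightarrow> cmod s \<le> B \<longrightarrow> cmod (?f n s) \<le> K * real n powr (-e))"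
    if \<delta>: "\<delta> > 1" for \<delta> B
  proof (intro exI conjI allI impI)
    define c where "c = (\<delta> - 1) / 2"
    have c: "c > 0" using \<delta> by (simp add: c_def)
    show "1 + c > 1" using c by simp
    fix n :: nat and s assume n: "1 \<le> n" and s: "\<delta> \<le> Re s" "cmod s \<le> B"
    have "1 + ln (real n) \<le> real n powr c + real n powr c / c"
      using n c ge_one_powr_ge_zero[of n c] ln_powr_bound[of n c] by simp
    hence 1: "1 + ln (real n) \<le> (1 + 1 / c) * real n powr c" by (simp add: algebra_simps)
    have "cmod (?f n s) \<le> (C * ((1 + 1 / c) * real n powr c)) * real n powr (- \<delta>)"
      unfolding norm_mult norm_nat_powr using s n C c
      by (intro mult_mono order_trans[OF \<alpha>] mult_left_mono 1 powr_mono) auto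
    also have "\<dots> = C * (1 + 1 / c) * (real n powr c * real n powr (- \<delta>))" by simp
    also have "real n powr c * real n powr (- \<delta>) = real n powr (-(1 + c))"
    proof -
      have "c + - \<delta> = - (1 + c)" by (simp add: c_def field_simps)
      thus ?thesis by (simp only: powr_add[symmetric])
    qed
    finally show "cmod (?f n s) \<le> C * (1 + 1 / c) * real n powr (-(1 + c))" .
  qed
  show "F holomorphic_on {s. Re s > 1}" unfolding F_def by (rule series_halfplane(1)[OF der bd])
  show "\<And>s. Re s > 1 \<Longrightarrow> (\<lambda>n. ?f n s) sums F s"
    unfolding F_def by (rule series_halfplane(2)[OF der bd])
  show "\<And>s. Re s > 1 \<Longrightarrow> (\<lambda>n. ?f' n s) sums deriv F s"
    unfolding F_def by (rule series_halfplane(3)[OF der bd])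
  show "summable (\<lambda>n. cmod (?f n s))" if s: "Re s > 1" for s
  proof -
    obtain K e where K: "e > 1" "\<And>n. n \<ge> 1 \<Longrightarrow> cmod (?f n s) \<le> K * real n powr (-e)"
      using bd[OF s, of "cmod s"] by auto
    have "summable (\<lambda>n. K * real n powr (-e))" using K(1) summable_real_powr_iff[of "-e"] by (intro summable_mult) auto
    thus ?thesis by (rule summable_comparison_test'[where N=1]) (use K(2) in auto)
  qed
qed

text \<open>The double series converges absolutely and may be summed along the products n = d m.\<close>

lemma sums_dirichlet_convolution:
  fixes f g :: "nat \<Rightarrow> complex"
  assumes f: "summable (\<lambda>n. cmod (f n))" "f sums a" "f 0 = 0"
    and g: "summable (\<lambda>n. cmod (g n))" "g sums b" "g 0 = 0"
  shows "(\<lambda>n. \<Sum>d | d dvd n. f d * g (n div d)) sums (a * b)"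
proof -
  let ?h = "\<lambda>(d, m). f d * g m"
  have hf: "(f has_sum a) UNIV" and hg: "(g has_sum b) UNIV"
    using norm_summable_imp_has_sum f g by auto
  have "(\<lambda>x. cmod (?h x)) summable_on UNIV \<times> UNIV"
  proof (rule Infinite_Sum.abs_summable_on_Sigma_iff[THEN iffD2], intro conjI ballI)
    have sg: "(\<lambda>y. cmod (g y)) summable_on UNIV" using norm_summable_imp_summable_on[of "\<lambda>y. cmod (g y)"] g(1) by simp
    have sf: "(\<lambda>y. cmod (f y)) summable_on UNIV" using norm_summable_imp_summable_on[of "\<lambda>y. cmod (f y)"] f(1) by simp
    show "(\<lambda>y. cmod (case (x, y) of (d, m) \<Rightarrow> f d * g m)) summable_on UNIV" for x
      using summable_on_cmult_right[OF sg, of "cmod (f x)"] by (simp add: norm_mult)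
    have "(\<lambda>x. cmod (f x) * (\<Sum>\<^sub>\<infinity>y. cmod (g y))) summable_on UNIV" by (rule summable_on_cmult_left[OF sf])
    hence "(\<lambda>x. norm (cmod (f x) * (\<Sum>\<^sub>\<infinity>y. cmod (g y)))) summable_on UNIV"
      by (simp add: infsum_nonneg abs_mult)
    thus "(\<lambda>x. norm (\<Sum>\<^sub>\<infinity>y. cmod (case (x, y) of (d, m) \<Rightarrow> f d * g m))) summable_on UNIV"
      by (simp add: norm_mult infsum_cmult_right')
  qed
  hence sm: "?h summable_on UNIV \<times> UNIV" by (rule Infinite_Sum.abs_summable_summable)
  have hs: "(?h has_sum (a * b)) (UNIV \<times> UNIV)"
  proof (rule has_sum_SigmaI[OF _ _ sm])
    show "((\<lambda>y. case (x, y) of (d, m) \<Rightarrow> f d * g m) has_sum f x * b) UNIV" for x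
      using has_sum_cmult_right[OF hg] by simp
    show "((\<lambda>x. f x * b) has_sum a * b) UNIV" by (rule has_sum_cmult_left[OF hf])
  qed
  have "(?h has_sum (a * b)) ({1..} \<times> {1..})"
  proof (subst has_sum_cong_neutral[where g = ?h and T = "UNIV \<times> UNIV"])
    show "(?h has_sum (a * b)) (UNIV \<times> UNIV)" by (rule hs)
    show "?h x = 0" if "x \<in> UNIV \<times> UNIV - {1..} \<times> {1..}" for x
    proof -
      obtain d m where x: "x = (d, m)" by (cases x)
      hence "d = 0 \<or> m = 0" using that by auto
      thus ?thesis using f(3) g(3) x by auto
    qed
  qed auto
  also have "(?h has_sum (a * b)) ({1..} \<times> {1..}) \<longleftrightarrow> ((\<lambda>(n, d). f d * g (n div d)) has_sum (a * b)) (SIGMA n:{1..}. {d. d dvd n})"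
    by (rule has_sum_reindex_bij_witness[where i = "\<lambda>(n, d). (d, n div d)" and j = "\<lambda>(d, m). (d * m, d)"])
       (auto simp: Suc_le_eq intro!: Nat.gr0I elim!: dvdE)
  finally have "((\<lambda>n. \<Sum>d | d dvd n. f d * g (n div d)) has_sum (a * b)) {1..}"
    by (rule has_sum_SigmaD) (auto intro!: has_sum_finiteI)
  hence "((\<lambda>n. \<Sum>d | d dvd n. f d * g (n div d)) has_sum (a * b)) UNIV"
    by (subst (asm) has_sum_cong_neutral[where g = "\<lambda>n. \<Sum>d | d dvd n. f d * g (n div d)" and T = UNIV]) (auto simp: not_le)
  thus ?thesis by (rule has_sum_imp_sums)
qed

definition dirichlet_zeta :: "complex \<Rightarrow> complex" where "dirichlet_zeta s = (\<Sum>n. of_nat n powr (- s))"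

definition mangoldt_series :: "complex \<Rightarrow> complex" where "mangoldt_series s = (\<Sum>n. mangoldt n * of_nat n powr (- s))"

lemma dirichlet_zeta_series:
  shows "dirichlet_zeta holomorphic_on {s. Re s > 1}"
    and "Re s > 1 \<Longrightarrow> (\<lambda>n. of_nat n powr (- s)) sums dirichlet_zeta s"
    and "Re s > 1 \<Longrightarrow> (\<lambda>n. - of_real (ln (real n)) * of_nat n powr (- s)) sums deriv dirichlet_zeta s"
    and "Re s > 1 \<Longrightarrow> summable (\<lambda>n. cmod (of_nat n powr (- s)))"
proof -
  have 1: "cmod 1 \<le> 1 * (1 + ln (real n))" if "n \<ge> 1" for n using that by simp
  note * = dirichlet_series[of "\<lambda>_. 1", OF 1]
  show "dirichlet_zeta holomorphic_on {s. Re s > 1}" using *(1) by (simp add: dirichlet_zeta_def[abs_def])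
  show "Re s > 1 \<Longrightarrow> (\<lambda>n. of_nat n powr (- s)) sums dirichlet_zeta s" using *(2)[of s] by (simp add: dirichlet_zeta_def)
  have "dirichlet_zeta = (\<lambda>s. \<Sum>n. of_nat n powr (- s))" by (simp add: dirichlet_zeta_def fun_eq_iff)
  thus "Re s > 1 \<Longrightarrow> (\<lambda>n. - of_real (ln (real n)) * of_nat n powr (- s)) sums deriv dirichlet_zeta s" using *(3)[of s] by simp
  show "Re s > 1 \<Longrightarrow> summable (\<lambda>n. cmod (of_nat n powr (- s)))" using *(4)[of s] by simp
qed

lemma mangoldt_series_series:
  shows "mangoldt_series holomorphic_on {s. Re s > 1}"
    and "Re s > 1 \<Longrightarrow> (\<lambda>n. mangoldt n * of_nat n powr (- s)) sums mangoldt_series s"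
    and "Re s > 1 \<Longrightarrow> summable (\<lambda>n. cmod (mangoldt n * of_nat n powr (- s)))"
proof -
  have 1: "cmod (mangoldt n) \<le> 1 * (1 + ln (real n))" if "n \<ge> 1" for n
    using mangoldt_le[of n] that by simp
  note * = dirichlet_series[of mangoldt, OF 1]
  show "mangoldt_series holomorphic_on {s. Re s > 1}" using *(1) by (simp add: mangoldt_series_def[abs_def])
  show "Re s > 1 \<Longrightarrow> (\<lambda>n. mangoldt n * of_nat n powr (- s)) sums mangoldt_series s" using *(2)[of s] by (simp add: mangoldt_series_def)
  show "Re s > 1 \<Longrightarrow> summable (\<lambda>n. cmod (mangoldt n * of_nat n powr (- s)))" using *(4)[of s] by simp
qed

text \<open>The convolution of the Mangoldt function with 1 is the logarithm.\<close>

lemma mangoldt_series_dirichlet_zeta: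
  assumes s: "Re s > 1"
  shows "mangoldt_series s * dirichlet_zeta s = - deriv dirichlet_zeta s"
proof -
  have 1: "(\<lambda>n. \<Sum>d | d dvd n. (mangoldt d * of_nat d powr (- s)) * of_nat (n div d) powr (- s)) sums (mangoldt_series s * dirichlet_zeta s)"
    using sums_dirichlet_convolution[of "\<lambda>n. mangoldt n * of_nat n powr (- s)" "mangoldt_series s" "\<lambda>n. of_nat n powr (- s)" "dirichlet_zeta s"]
      mangoldt_series_series(2,3)[OF s] dirichlet_zeta_series(2,4)[OF s] by simp
  have "(\<Sum>d | d dvd n. (mangoldt d * of_nat d powr (- s)) * of_nat (n div d) powr (- s)) = of_real (ln (real n)) * of_nat n powr (- s)" for n
  proof (cases "n = 0")
    case False
    have "(mangoldt d * of_nat d powr (- s)) * of_nat (n div d) powr (- s) = mangoldt d * of_nat n powr (- s)" if "d dvd n" for d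
    proof -
      have "of_nat n = of_nat d * (of_nat (n div d) :: complex)" using that by (simp flip: of_nat_mult)
      thus ?thesis by (simp add: powr_times_real)
    qed
    hence "(\<Sum>d | d dvd n. (mangoldt d * of_nat d powr (- s)) * of_nat (n div d) powr (- s)) = (\<Sum>d | d dvd n. mangoldt d) * of_nat n powr (- s)"
      unfolding sum_distrib_right by (intro sum.cong) auto
    thus ?thesis using mangoldt_sum[OF False, where ?'a = complex] by simp
  qed auto
  with 1 have "(\<lambda>n. of_real (ln (real n)) * of_nat n powr (- s)) sums (mangoldt_series s * dirichlet_zeta s)" by simp
  moreover have "(\<lambda>n. - (- of_real (ln (real n)) * of_nat n powr (- s))) sums (- deriv dirichlet_zeta s)"
    using dirichlet_zeta_series(3)[OF s] by (rule sums_minus)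
  ultimately show ?thesis by (simp add: sums_iff)
qed

text \<open>The integrals in the terms telescope.\<close>

lemma reg_zeta_dirichlet_zeta:
  assumes s: "Re s > 1"
  shows "reg_zeta s = (s - 1) * dirichlet_zeta s"
proof -
  have "(\<lambda>n. of_nat n powr (1 - s)) \<longlonglongrightarrow> 0"
  proof (rule tendsto_norm_zero_cancel)
    have "(\<lambda>n. real n powr (1 - Re s)) \<longlonglongrightarrow> 0" using s by real_asymp
    thus "(\<lambda>n. cmod (of_nat n powr (1 - s))) \<longlonglongrightarrow> 0" by (simp add: norm_nat_powr)
  qed
  from telescope_sums[OF this]
  have "(\<lambda>n. (s - 1) * of_nat n powr (- s) + (of_nat (Suc n) powr (1 - s) - of_nat n powr (1 - s))) sums ((s - 1) * dirichlet_zeta s + (0 - of_nat 0 powr (1 - s)))"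
    by (intro sums_add sums_mult dirichlet_zeta_series(2) s)
  hence "(\<lambda>n. zeta_term n s) sums ((s - 1) * dirichlet_zeta s)" by (simp add: zeta_term_def algebra_simps)
  moreover have "(\<lambda>n. zeta_term n s) sums reg_zeta s" using s by (intro reg_zeta_sums) auto
  ultimately show ?thesis by (simp add: sums_iff)
qed

lemma reg_zeta_1: "reg_zeta 1 = 1"
proof -
  have "(\<lambda>n. zeta_term n 1) sums reg_zeta 1" by (rule reg_zeta_sums) simp
  moreover have "zeta_term n 1 = (if n = 0 then 1 else 0)" for n by (auto simp: zeta_term_def simp del: of_nat_Suc)
  ultimately have "(\<lambda>n. if n = 0 then 1 else 0::complex) sums reg_zeta 1" by simp
  thus ?thesis using sums_single[of 0 "\<lambda>_. 1::complex"] by (simp add: sums_iff)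
qed

lemma reg_zeta_deriv:
  assumes s: "Re s > 1"
  shows "deriv reg_zeta s = reg_zeta s * (1 / (s - 1) - mangoldt_series s)"
proof -
  have op: "open {s. Re s > 1}" by (rule open_halfspace_Re_gt)
  have "(dirichlet_zeta has_field_derivative deriv dirichlet_zeta s) (at s)"
    using dirichlet_zeta_series(1) op s by (auto intro: holomorphic_derivI)
  hence "((\<lambda>s. (s - 1) * dirichlet_zeta s) has_field_derivative (dirichlet_zeta s + (s - 1) * deriv dirichlet_zeta s)) (at s)"
    by (auto intro!: derivative_eq_intros)
  hence "(reg_zeta has_field_derivative (dirichlet_zeta s + (s - 1) * deriv dirichlet_zeta s)) (at s)"
    by (rule has_field_derivative_transform_within_open[OF _ op]) (use s reg_zeta_dirichlet_zeta in auto)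
  hence "deriv reg_zeta s = dirichlet_zeta s + (s - 1) * deriv dirichlet_zeta s" by (rule DERIV_imp_deriv)
  also have "deriv dirichlet_zeta s = - (mangoldt_series s * dirichlet_zeta s)" using mangoldt_series_dirichlet_zeta[OF s] by simp
  finally have "deriv reg_zeta s = dirichlet_zeta s + (s - 1) * - (mangoldt_series s * dirichlet_zeta s)" .
  moreover have "s - 1 \<noteq> 0" using s by auto
  ultimately show ?thesis unfolding reg_zeta_dirichlet_zeta[OF s]
    by (simp add: right_diff_distrib)
qed

text \<open>Near a we have f(z) = g(z) (z - a)^m with g(a) \<noteq> 0, so m is the order of vanishing at a.\<close>

lemma log_deriv_limit:
  assumes f: "f holomorphic_on S" "open S" "connected S" "a \<in> S" "w \<in> S" "f w \<noteq> 0"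
  shows "\<exists>m::nat. ((\<lambda>z. (z - a) * deriv f z / f z) \<longlongrightarrow> of_nat m) (at a) \<and> (f a = 0 \<longleftrightarrow> m > 0) \<and> eventually (\<lambda>z. f z \<noteq> 0) (at a)"
proof -
  define m where "m = nat (zorder f a)"
  obtain r where ord: "if f a = 0 then zorder f a > 0 else zorder f a = 0" and r: "r > 0" "cball a r \<subseteq> S" "zor_poly f a holomorphic_on cball a r"
    "\<And>w. w \<in> cball a r \<Longrightarrow> f w = zor_poly f a w * (w - a) ^ m \<and> zor_poly f a w \<noteq> 0"
    using zorder_exist_zero[OF f(1-4)] f(5,6) unfolding m_def by metis
  define g where "g = zor_poly f a"
  have g: "g holomorphic_on ball a r" using r(3) unfolding g_def by (rule holomorphic_on_subset) auto
  have fg: "f w = g w * (w - a) ^ m" "g w \<noteq> 0" if "w \<in> ball a r" for w using r(4)[of w] that by (auto simp: g_def)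
  have ev: "eventually (\<lambda>z. z \<in> ball a r - {a}) (at a)" using r(1) unfolding eventually_at by (auto simp: dist_commute)
  have ic: "isCont (deriv g) a" "isCont g a"
    using g r(1) by (auto intro!: holomorphic_on_imp_continuous_on[THEN continuous_on_interior] holomorphic_deriv simp: interior_open)
  have "g a \<noteq> 0" using fg(2)[of a] r(1) by simp
  hence "(\<lambda>z. (z - a) * deriv g z / g z + of_nat m) \<midarrow>a\<rightarrow> (a - a) * deriv g a / g a + of_nat m"
    by (intro tendsto_intros ic[unfolded isCont_def])
  hence "(\<lambda>z. (z - a) * deriv g z / g z + of_nat m) \<midarrow>a\<rightarrow> of_nat m" by simp
  moreover have "eventually (\<lambda>z. (z - a) * deriv g z / g z + of_nat m = (z - a) * deriv f z / f z) (at a)"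
    using ev
  proof eventually_elim
    case (elim z)
    hence z: "z \<in> ball a r" "z \<noteq> a" by auto
    have "(g has_field_derivative deriv g z) (at z)" using g z(1) by (auto intro: holomorphic_derivI)
    hence "((\<lambda>w. g w * (w - a) ^ m) has_field_derivative (deriv g z * (z - a) ^ m + g z * (of_nat m * (z - a) ^ (m - 1)))) (at z)"
      by (auto intro!: derivative_eq_intros)
    hence "(f has_field_derivative (deriv g z * (z - a) ^ m + g z * (of_nat m * (z - a) ^ (m - 1)))) (at z)"
      by (rule has_field_derivative_transform_within_open[of _ _ _ "ball a r"]) (use fg z in auto)
    hence "deriv f z = deriv g z * (z - a) ^ m + g z * (of_nat m * (z - a) ^ (m - 1))" by (rule DERIV_imp_deriv)
    hence dfz: "deriv f z = deriv g z * (z - a) ^ m + g z * (of_nat m * (z - a) ^ (m - 1))" .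
    have "(z - a) * deriv f z = (z - a) * deriv g z * (z - a) ^ m + of_nat m * g z * (z - a) ^ m"
      unfolding dfz by (cases m) (simp_all add: algebra_simps)
    moreover have "(z - a) ^ m \<noteq> 0" using z by simp
    ultimately show ?case using fg(2)[OF z(1)] unfolding fg(1)[OF z(1)] by (simp add: add_divide_distrib)
  qed
  ultimately have "((\<lambda>z. (z - a) * deriv f z / f z) \<longlongrightarrow> of_nat m) (at a)" by (rule Lim_transform_eventually)
  moreover have "f a = 0 \<longleftrightarrow> m > 0" using ord by (auto simp: m_def split: if_splits)
  moreover have "eventually (\<lambda>z. f z \<noteq> 0) (at a)" using ev by eventually_elim (use fg in auto)
  ultimately show ?thesis by blast
qed

lemma right_halfplane: "open {s. Re s > a}" "connected {s. Re s > a}" 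
  by (auto intro: open_halfspace_Re_gt convex_connected convex_halfspace_Re_gt)

text \<open>The behaviour of the Mangoldt series when the line of real part one is approached from the right: the pole of \<zeta> contributes 1,
a zero of order m contributes - m.\<close>

lemma mangoldt_series_limit:
  assumes c: "Re c = 1"
  shows "\<exists>m::nat. ((\<lambda>x. of_real x * mangoldt_series (c + of_real x)) \<longlongrightarrow> (if c = 1 then 1 else 0) - of_nat m) (at_right 0) \<and> (reg_zeta c = 0 \<longleftrightarrow> m > 0)"
proof -
  obtain m :: nat where m: "((\<lambda>z. (z - c) * deriv reg_zeta z / reg_zeta z) \<longlongrightarrow> of_nat m) (at c)" "reg_zeta c = 0 \<longleftrightarrow> m > 0" "eventually (\<lambda>z. reg_zeta z \<noteq> 0) (at c)"
    using log_deriv_limit[OF reg_zeta_holo right_halfplane, of c 1] c reg_zeta_1 by auto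
  have fl: "filterlim (\<lambda>x. c + of_real x) (at c) (at_right 0)"
  proof (rule filterlim_atI)
    show "((\<lambda>x. c + of_real x) \<longlongrightarrow> c) (at_right 0)" by (auto intro!: tendsto_eq_intros)
    show "\<forall>\<^sub>F x in at_right 0. c + of_real x \<noteq> c" by (auto simp: eventually_at_filter)
  qed
  have 1: "((\<lambda>x. of_real x * deriv reg_zeta (c + of_real x) / reg_zeta (c + of_real x)) \<longlongrightarrow> of_nat m) (at_right 0)"
    using filterlim_compose[OF m(1) fl] by simp
  have 2: "((\<lambda>x. of_real x / (c + of_real x - 1)) \<longlongrightarrow> (if c = 1 then 1 else 0)) (at_right 0)"
  proof (cases "c = 1")
    case True
    have "\<forall>\<^sub>F x in at_right 0. 1 = complex_of_real x / (c + of_real x - 1)"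
      using True by (auto simp: eventually_at_filter)
    thus ?thesis using True by (auto intro: Lim_transform_eventually[OF tendsto_const])
  next
    case False
    have "((\<lambda>x. of_real x / (c + of_real x - 1)) \<longlongrightarrow> of_real 0 / (c + of_real 0 - 1)) (at_right 0)"
      using False by (intro tendsto_intros) auto
    thus ?thesis using False by simp
  qed
  have ev: "\<forall>\<^sub>F x in at_right (0::real). x > 0 \<and> reg_zeta (c + of_real x) \<noteq> 0"
    using m(3) fl by (intro eventually_conj eventually_at_right_less) (auto simp: filterlim_iff)
  have "\<forall>\<^sub>F x in at_right 0. of_real x / (c + of_real x - 1) - of_real x * deriv reg_zeta (c + of_real x) / reg_zeta (c + of_real x) = of_real x * mangoldt_series (c + of_real x)"
    using ev
  proof eventually_elim
    case (elim x)
    hence "deriv reg_zeta (c + of_real x) = reg_zeta (c + of_real x) * (1 / (c + of_real x - 1) - mangoldt_series (c + of_real x))"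
      using c by (intro reg_zeta_deriv) auto
    hence "of_real x * deriv reg_zeta (c + of_real x) / reg_zeta (c + of_real x) = of_real x * (1 / (c + of_real x - 1) - mangoldt_series (c + of_real x))"
      using elim by simp
    thus ?case by (simp add: right_diff_distrib)
  qed
  from Lim_transform_eventually[OF tendsto_diff[OF 2 1] this] m(2) show ?thesis by blast
qed

lemma Re_nat_powr: "n \<ge> 1 \<Longrightarrow> Re (of_nat n powr (- (of_real x + \<i> * of_real t))) = real n powr (- x) * cos (t * ln (real n))"
  using Ln_of_nat[of n] by (simp add: powr_def Re_exp algebra_simps)

text \<open>The classical inequality 3 + 4 cos \<theta> + cos 2\<theta> = 2 (1 + cos \<theta>)^2 \<ge> 0, summed with nonnegative weights.\<close>

lemma mangoldt_series_341:
  assumes x: "x > 0"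
  shows "0 \<le> 3 * Re (mangoldt_series (1 + of_real x)) + 4 * Re (mangoldt_series (1 + \<i> * of_real t + of_real x)) + Re (mangoldt_series (1 + \<i> * of_real (2 * t) + of_real x))"
proof -
  have s: "(\<lambda>n. mangoldt n * real n powr (- (1 + x)) * cos (u * ln (real n))) sums Re (mangoldt_series (1 + \<i> * of_real u + of_real x))" for u
  proof -
    have "(\<lambda>n. mangoldt n * of_nat n powr (- (1 + \<i> * of_real u + of_real x))) sums mangoldt_series (1 + \<i> * of_real u + of_real x)"
      using x by (intro mangoldt_series_series(2)) auto
    hence "(\<lambda>n. Re (mangoldt n * of_nat n powr (- (1 + \<i> * of_real u + of_real x)))) sums Re (mangoldt_series (1 + \<i> * of_real u + of_real x))"
      by (rule sums_Re)
    moreover have "Re (mangoldt n * of_nat n powr (- (1 + \<i> * of_real u + of_real x))) = mangoldt n * real n powr (- (1 + x)) * cos (u * ln (real n))" for n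
    proof (cases "n = 0")
      case False
      have e: "1 + \<i> * of_real u + of_real x = of_real (1 + x) + \<i> * of_real u" by simp
      have "Re (mangoldt n * w) = mangoldt n * Re w" for w by (metis of_real_mangoldt Re_complex_of_real times_complex.sel(1) Im_complex_of_real mult_zero_left diff_zero)
      thus ?thesis unfolding e using False Re_nat_powr[of n "1 + x" u] by simp
    qed auto
    ultimately show ?thesis by (simp only:)
  qed
  have "(\<lambda>n. 3 * (mangoldt n * real n powr (- (1 + x)) * cos (0 * ln (real n))) + 4 * (mangoldt n * real n powr (- (1 + x)) * cos (t * ln (real n)))
      + mangoldt n * real n powr (- (1 + x)) * cos (2 * t * ln (real n))) sums
      (3 * Re (mangoldt_series (1 + \<i> * of_real 0 + of_real x)) + 4 * Re (mangoldt_series (1 + \<i> * of_real t + of_real x)) + Re (mangoldt_series (1 + \<i> * of_real (2 * t) + of_real x)))"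
    by (intro sums_add sums_mult s)
  moreover have "0 \<le> 3 * (mangoldt n * real n powr (- (1 + x)) * cos (0 * ln (real n))) + 4 * (mangoldt n * real n powr (- (1 + x)) * cos (t * ln (real n)))
      + mangoldt n * real n powr (- (1 + x)) * cos (2 * t * ln (real n))" for n
  proof -
    define y where "y = cos (t * ln (real n))"
    have "cos (2 * t * ln (real n)) = 2 * y\<^sup>2 - 1" using cos_double_cos[of "t * ln (real n)"] by (simp add: y_def mult.assoc)
    moreover define w where "w = mangoldt n * real n powr (- (1 + x))"
    moreover have "3 * (w * 1) + 4 * (w * y) + w * (2 * y\<^sup>2 - 1) = w * (2 * (1 + y)\<^sup>2)"
      by (simp add: algebra_simps power2_eq_square)
    ultimately have "3 * (mangoldt n * real n powr (- (1 + x)) * cos (0 * ln (real n))) + 4 * (mangoldt n * real n powr (- (1 + x)) * cos (t * ln (real n)))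
      + mangoldt n * real n powr (- (1 + x)) * cos (2 * t * ln (real n)) = w * (2 * (1 + y)\<^sup>2)"
      unfolding y_def by simp
    moreover have "0 \<le> w" using mangoldt_nonneg[of n] by (simp add: w_def)
    ultimately show ?thesis by simp
  qed
  ultimately have "0 \<le> 3 * Re (mangoldt_series (1 + \<i> * of_real 0 + of_real x)) + 4 * Re (mangoldt_series (1 + \<i> * of_real t + of_real x)) + Re (mangoldt_series (1 + \<i> * of_real (2 * t) + of_real x))"
    by (rule sums_le[OF _ sums_zero, rotated])
  thus ?thesis by simp
qed

text \<open>To the right of the line, a zero would contradict the convergence of the Mangoldt series.  On the line, a zero of order m at 1 + i t
and the order m2 \<ge> 0 at 1 + 2 i t would give 3 - 4 m - m2 \<ge> 0 by the inequality above.\<close>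

lemma reg_zeta_nonzero:
  assumes a: "Re a \<ge> 1"
  shows "reg_zeta a \<noteq> 0"
proof (cases "Re a = 1")
  case False
  hence a1: "Re a > 1" using a by simp
  obtain m :: nat where m: "((\<lambda>z. (z - a) * deriv reg_zeta z / reg_zeta z) \<longlongrightarrow> of_nat m) (at a)" "reg_zeta a = 0 \<longleftrightarrow> m > 0" "eventually (\<lambda>z. reg_zeta z \<noteq> 0) (at a)"
    using log_deriv_limit[OF reg_zeta_holo right_halfplane, of a 1] a1 reg_zeta_1 by auto
  have "isCont mangoldt_series a" using mangoldt_series_series(1) right_halfplane(1)[of 1] a1
    by (auto intro!: holomorphic_on_imp_continuous_on[THEN continuous_on_interior] simp: interior_open)
  hence "((\<lambda>z. (z - a) * (1 / (z - 1) - mangoldt_series z)) \<longlongrightarrow> (a - a) * (1 / (a - 1) - mangoldt_series a)) (at a)"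
    using a1 by (intro tendsto_intros) (auto simp: isCont_def)
  moreover have "eventually (\<lambda>z. z \<in> {s. Re s > 1}) (at a)" using a1 by (intro eventually_at_in_open') (auto simp: right_halfplane)
  hence "eventually (\<lambda>z. (z - a) * (1 / (z - 1) - mangoldt_series z) = (z - a) * deriv reg_zeta z / reg_zeta z) (at a)"
    using m(3) by eventually_elim (simp add: reg_zeta_deriv)
  ultimately have "((\<lambda>z. (z - a) * deriv reg_zeta z / reg_zeta z) \<longlongrightarrow> 0) (at a)" by (auto dest: Lim_transform_eventually)
  hence "of_nat m = (0::complex)" using m(1) tendsto_unique trivial_limit_at by blast
  thus ?thesis using m(2) by simp
next
  case True
  define t where "t = Im a"
  have at: "a = 1 + \<i> * of_real t" using True by (simp add: complex_eq_iff t_def)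
  show ?thesis
  proof
    assume 0: "reg_zeta a = 0"
    hence t: "t \<noteq> 0" using reg_zeta_1 at by auto
    have ne: "1 + \<i> * complex_of_real t \<noteq> 1" "1 + \<i> * complex_of_real (2 * t) \<noteq> 1" using t by (auto simp: complex_eq_iff)
    obtain m where m: "((\<lambda>x. of_real x * mangoldt_series (1 + \<i> * of_real t + of_real x)) \<longlongrightarrow> - of_nat m) (at_right 0)" "m > (0::nat)"
      using mangoldt_series_limit[of a] 0 True ne unfolding at by auto
    obtain m2 :: nat where m2: "((\<lambda>x. of_real x * mangoldt_series (1 + \<i> * of_real (2 * t) + of_real x)) \<longlongrightarrow> - of_nat m2) (at_right 0)"
      using mangoldt_series_limit[of "1 + \<i> * of_real (2 * t)"] ne by auto
    have m0: "((\<lambda>x. of_real x * mangoldt_series (1 + of_real x)) \<longlongrightarrow> 1) (at_right 0)"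
      using mangoldt_series_limit[of 1] reg_zeta_1 by auto
    have "((\<lambda>x. 3 * Re (of_real x * mangoldt_series (1 + of_real x)) + 4 * Re (of_real x * mangoldt_series (1 + \<i> * of_real t + of_real x)) + Re (of_real x * mangoldt_series (1 + \<i> * of_real (2 * t) + of_real x)))
        \<longlongrightarrow> 3 * Re 1 + 4 * Re (- of_nat m) + Re (- of_nat m2)) (at_right 0)"
      by (intro tendsto_intros m m0 m2)
    moreover have "\<forall>\<^sub>F x in at_right 0. 0 \<le> 3 * Re (of_real x * mangoldt_series (1 + of_real x)) + 4 * Re (of_real x * mangoldt_series (1 + \<i> * of_real t + of_real x)) + Re (of_real x * mangoldt_series (1 + \<i> * of_real (2 * t) + of_real x))"
      using eventually_at_right_less
    proof eventually_elim
      case (elim x)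
      have "0 \<le> x * (3 * Re (mangoldt_series (1 + of_real x)) + 4 * Re (mangoldt_series (1 + \<i> * of_real t + of_real x)) + Re (mangoldt_series (1 + \<i> * of_real (2 * t) + of_real x)))"
        using mangoldt_series_341[OF elim, of t] elim by (intro mult_nonneg_nonneg) auto
      thus ?case by (simp add: algebra_simps)
    qed
    ultimately have "0 \<le> 3 * Re 1 + 4 * Re (- of_nat m) + Re (- of_nat m2)"
      by (rule tendsto_lowerbound) simp
    thus False using m(2) by simp
  qed
qed

definition psi :: "nat \<Rightarrow> real" where "psi n = (\<Sum>k=1..n. mangoldt k)"

lemma psi_mono: "m \<le> n \<Longrightarrow> psi m \<le> psi n"
  unfolding psi_def by (intro sum_mono2) (auto simp: mangoldt_nonneg)

lemma psi_Suc: "psi (Suc n) = psi n + mangoldt (Suc n)"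
  by (simp add: psi_def)

lemma ln_fact_mangoldt: "ln (fact N) = (\<Sum>d=1..N. mangoldt d * real (N div d))"
proof -
  have "ln (fact N :: real) = (\<Sum>k=1..N. ln (real k))"
    unfolding fact_prod of_nat_prod by (subst ln_prod) auto
  also have "\<dots> = (\<Sum>k=1..N. \<Sum>d | d dvd k. mangoldt d)"
    using mangoldt_sum[where ?'a = real] by (intro sum.cong) auto
  also have "\<dots> = (\<Sum>k=1..N. \<Sum>d\<in>{1..N}. if d dvd k then mangoldt d else 0)"
  proof (rule sum.cong[OF refl])
    fix k assume k: "k \<in> {1..N}"
    have "{d. d dvd k} = {d \<in> {1..N}. d dvd k}" using k by (auto dest: dvd_imp_le intro: Nat.gr0I simp: Suc_le_eq)
    thus "(\<Sum>d | d dvd k. mangoldt d) = (\<Sum>d\<in>{1..N}. if d dvd k then mangoldt d else 0 :: real)"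
      by (simp only: sum.inter_filter finite_atLeastAtMost)
  qed
  also have "\<dots> = (\<Sum>d=1..N. \<Sum>k=1..N. if d dvd k then mangoldt d else 0)" by (rule sum.swap)
  also have "\<dots> = (\<Sum>d=1..N. mangoldt d * real (N div d))"
  proof (intro sum.cong refl)
    fix d assume d: "d \<in> {1..N}"
    have "(\<Sum>k=1..N. if d dvd k then mangoldt d else 0 :: real) = mangoldt d * real (card {k\<in>{1..N}. d dvd k})"
      by (simp add: sum.inter_filter[symmetric])
    also have "{k\<in>{1..N}. d dvd k} = (\<lambda>j. d * j) ` {1..N div d}"
      using d by (auto simp: less_eq_div_iff_mult_less_eq mult.commute Suc_le_eq elim!: dvdE intro: Nat.gr0I)
    also have "card \<dots> = N div d" using d by (subst card_image) (auto simp: inj_on_def)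
    finally show "(\<Sum>k=1..N. if d dvd k then mangoldt d else 0 :: real) = mangoldt d * real (N div d)" .
  qed
  finally show ?thesis .
qed

text \<open>Chebyshev's argument: in the logarithm of the binomial coefficient of 2 N over N, the terms of N < d \<le> 2 N occur with factor one, and all other factors are
nonnegative.\<close>

lemma psi_double: "psi (2 * N) \<le> psi N + 2 * real N"
proof -
  have sp: "{1..2 * N} = {1..N} \<union> {N<..2 * N}" by auto
  have "psi (2 * N) - psi N = (\<Sum>d\<in>{N<..2*N}. mangoldt d)"
    unfolding psi_def sp by (subst sum.union_disjoint) auto
  also have "\<dots> \<le> (\<Sum>d\<in>{N<..2*N}. mangoldt d * real ((2 * N) div d))"
  proof (intro sum_mono)
    fix d assume d: "d \<in> {N<..2*N}"
    have "1 \<le> (2 * N) div d" using d by (simp add: less_eq_div_iff_mult_less_eq)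
    thus "mangoldt d \<le> mangoldt d * real ((2 * N) div d)" using mangoldt_nonneg[of d] by (intro mult_le_cancel_left1[THEN iffD2]) auto
  qed
  also have "\<dots> = (\<Sum>d=1..2*N. mangoldt d * real ((2 * N) div d)) - (\<Sum>d=1..N. mangoldt d * real ((2 * N) div d))"
    unfolding sp by (subst sum.union_disjoint) auto
  also have "\<dots> \<le> (\<Sum>d=1..2*N. mangoldt d * real ((2 * N) div d)) - (\<Sum>d=1..N. mangoldt d * (2 * real (N div d)))"
  proof (intro diff_left_mono sum_mono mult_left_mono)
    fix d assume d: "d \<in> {1..N}"
    have "2 * (N div d) \<le> (2 * N) div d" using d by (simp add: less_eq_div_iff_mult_less_eq mult.assoc)
    thus "2 * real (N div d) \<le> real ((2 * N) div d)" by (metis of_nat_le_iff of_nat_mult of_nat_numeral)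
  qed (simp add: mangoldt_nonneg)
  also have "\<dots> = ln (fact (2 * N)) - 2 * ln (fact N)"
    unfolding ln_fact_mangoldt sum_distrib_left by (simp add: algebra_simps)
  also have "\<dots> = ln (real ((2 * N) choose N))"
    by (simp add: binomial_fact ln_div ln_mult mult_2[of N, symmetric])
  also have "\<dots> \<le> ln (2 ^ (2 * N))"
  proof (subst ln_le_cancel_iff)
    show "real ((2 * N) choose N) \<le> 2 ^ (2 * N)" using binomial_le_pow2[of "2 * N" N] by (metis of_nat_le_iff of_nat_power of_nat_numeral)
  qed (auto simp: zero_less_binomial_iff)
  also have "\<dots> = 2 * real N * ln 2" by (simp add: ln_realpow)
  also have "\<dots> \<le> 2 * real N * 1" using ln_2_less_1 by (intro mult_left_mono) auto
  finally show ?thesis by simp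
qed

lemma psi_le: "psi n \<le> 4 * real n"
proof (induction n rule: less_induct)
  case (less n)
  show ?case
  proof (cases "n \<le> 1")
    case True
    hence "n = 0 \<or> n = 1" by auto
    thus ?thesis by (auto simp: psi_def)
  next
    case False
    define N where "N = n div 2"
    have IH: "psi N \<le> 4 * real N" using less[of N] False by (simp add: N_def)
    show ?thesis
    proof (cases "even n")
      case True
      hence "n = 2 * N" by (simp add: N_def)
      thus ?thesis using psi_double[of N] IH by simp
    next
      case odd: False
      hence n: "n = Suc (2 * N)" by (simp add: N_def)
      have "mangoldt n \<le> ln (real n)" using False by (intro mangoldt_le) auto
      also have "\<dots> \<le> real n - 1" using False by (intro ln_le_minus_one) auto
      finally have "psi n \<le> psi (2 * N) + 2 * real N" using n by (simp add: psi_Suc)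
      thus ?thesis using psi_double[of N] IH n by simp
    qed
  qed
qed

text \<open>The partial sums of the coefficients of - \<zeta>'/\<zeta> - \<zeta>.\<close>

definition psi_error :: "nat \<Rightarrow> real" where "psi_error n = psi n - real n"

lemma psi_error_bound: "\<bar>psi_error n\<bar> \<le> 4 * real n"
proof -
  have "0 \<le> psi n" by (auto simp: psi_def mangoldt_nonneg intro!: sum_nonneg)
  thus ?thesis using psi_le[of n] by (simp add: psi_error_def abs_le_iff)
qed

text \<open>Let E(n) = \<psi>(n) - n.  By partial summation, the series of - \<zeta>'/\<zeta> - \<zeta> is the sum of E(n) (n^(-s) - (n+1)^(-s)).  The difference in
brackets is s n^(-s-1) up to a term of the zeta series at s + 1, whose sum against E(n) converges for positive real part.  Dividing by s gives the
series with the bounded coefficients E(n)/n.\<close>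

lemma psi_error_extension:
  "\<exists>\<Omega> D. open \<Omega> \<and> {s. Re s \<ge> 1} \<subseteq> \<Omega> \<and> D holomorphic_on \<Omega> \<and>
     (\<forall>s. Re s > 1 \<longrightarrow> (\<lambda>n. of_real (psi_error n / real n) * of_nat n powr (- s)) sums D s)"
proof -
  define \<Omega> where "\<Omega> = {s. Re s > 0} \<inter> reg_zeta -` (- {0})"
  have op: "open \<Omega>" unfolding \<Omega>_def
    by (intro continuous_open_preimage holomorphic_on_imp_continuous_on reg_zeta_holo right_halfplane) auto
  have sub: "{s. Re s \<ge> 1} \<subseteq> \<Omega>" using reg_zeta_nonzero by (auto simp: \<Omega>_def)
  define E where "E = (\<lambda>s. \<Sum>n. of_real (psi_error n) * zeta_term n (s + of_nat 1))"
  define F where "F = (\<lambda>s. - (deriv reg_zeta s / reg_zeta s) - (if s = 1 then deriv reg_zeta 1 else (reg_zeta s - reg_zeta 1) / (s - 1)))"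
  have zh: "reg_zeta holomorphic_on \<Omega>" by (rule holomorphic_on_subset[OF reg_zeta_holo]) (auto simp: \<Omega>_def)
  have bd: "cmod (of_real (psi_error n)) \<le> 4 * real n powr real 1" for n using psi_error_bound[of n] by (cases n) auto
  note Es = zeta_term_series[of "\<lambda>n. of_real (psi_error n)" 4 1, OF bd, folded E_def]
  have Fh: "F holomorphic_on \<Omega>" unfolding F_def
    by (intro holomorphic_intros holomorphic_deriv zh op pole_lemma_open) (auto simp: \<Omega>_def)
  have Eh: "E holomorphic_on \<Omega>" by (rule holomorphic_on_subset[OF Es(1)]) (auto simp: \<Omega>_def)
  have Dh: "(\<lambda>s. (F s + E s) / s) holomorphic_on \<Omega>"
    by (intro holomorphic_intros Fh Eh) (auto simp: \<Omega>_def)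
  have "(\<lambda>n. of_real (psi_error n / real n) * of_nat n powr (- s)) sums ((F s + E s) / s)" if s: "Re s > 1" for s
  proof -
    have s1: "s \<noteq> 1" "s \<noteq> 0" using s by auto
    have z: "reg_zeta s \<noteq> 0" using reg_zeta_nonzero s by simp
    have "reg_zeta s * (1 / (s - 1) - mangoldt_series s) / reg_zeta s = 1 / (s - 1) - mangoldt_series s" using z by simp
    moreover have "(reg_zeta s - 1) / (s - 1) = dirichlet_zeta s - 1 / (s - 1)" 
      using s1 unfolding reg_zeta_dirichlet_zeta[OF s] by (simp add: diff_divide_distrib)
    ultimately have "F s = mangoldt_series s - dirichlet_zeta s"
      unfolding F_def reg_zeta_deriv[OF s] reg_zeta_1 using s1 by simp
    hence "(\<lambda>n. mangoldt n * of_nat n powr (- s) - of_nat n powr (- s)) sums F s"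
      using sums_diff[OF mangoldt_series_series(2)[OF s] dirichlet_zeta_series(2)[OF s]] by simp
    hence "(\<lambda>n. mangoldt (Suc n) * of_nat (Suc n) powr (- s) - of_nat (Suc n) powr (- s)) sums F s"
      by (subst sums_Suc_iff) simp
    hence 1: "(\<lambda>n. of_real (psi_error (Suc n) - psi_error n) * of_nat (Suc n) powr (- s)) sums F s"
      by (simp add: psi_error_def psi_Suc algebra_simps del: of_nat_Suc) (simp add: algebra_simps)
    let ?u = "\<lambda>n. of_nat n powr (- s)"
    have "(\<lambda>n. of_real (psi_error n) * ?u n) \<longlonglongrightarrow> 0"
    proof (rule Lim_null_comparison)
      show "\<forall>\<^sub>F n in sequentially. cmod (of_real (psi_error n) * ?u n) \<le> 4 * real n * real n powr (- Re s)"
        unfolding norm_mult norm_nat_powr using psi_error_bound by (intro always_eventually allI mult_mono) auto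
      show "(\<lambda>n. 4 * real n * real n powr (- Re s)) \<longlonglongrightarrow> 0" using s by real_asymp
    qed
    from telescope_sums[OF this]
    have 2: "(\<lambda>n. of_real (psi_error (Suc n)) * ?u (Suc n) - of_real (psi_error n) * ?u n) sums 0" by simp
    have "(\<lambda>n. of_real (psi_error n) * (?u n - ?u (Suc n))) sums F s"
      using sums_diff[OF 1 2] by (simp add: algebra_simps del: of_nat_Suc)
    from sums_add[OF this Es(2)[of s]] s
    have "(\<lambda>n. of_real (psi_error n) * (?u n - ?u (Suc n)) + of_real (psi_error n) * zeta_term n (s + of_nat 1)) sums (F s + E s)" by (simp add: E_def)
    from sums_divide[OF this, of s]
    have "(\<lambda>n. (of_real (psi_error n) * (?u n - ?u (Suc n)) + of_real (psi_error n) * zeta_term n (s + of_nat 1)) / s) sums ((F s + E s) / s)" .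
    moreover have "(of_real (psi_error n) * (?u n - ?u (Suc n)) + of_real (psi_error n) * zeta_term n (s + of_nat 1)) / s = of_real (psi_error n / real n) * of_nat n powr (- s)" for n
    proof (cases "n = 0")
      case False
      have "of_nat n powr (- s) = of_nat n * of_nat n powr (- 1 - s)" using False powr_add[of "of_nat n" 1 "- 1 - s"] by simp
      thus ?thesis unfolding of_nat_1 using False s1 by (simp add: zeta_term_def field_simps del: of_nat_Suc)
    qed (simp add: psi_error_def psi_def)
    ultimately show ?thesis by simp
  qed
  with op sub Dh show ?thesis by blast
qed

section \<open>A Tauberian theorem for bounded Dirichlet coefficients\<close>

text \<open>By this, sums of powers are compared with telescoping sums.\<close>

lemma powr_mvt:
  fixes a b p :: real
  assumes "0 < a" "a < b"
  obtains \<xi> where "a < \<xi>" "\<xi> < b" "b powr p - a powr p = (b - a) * (p * \<xi> powr (p - 1))"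
  using MVT2[of a b "\<lambda>x. x powr p" "\<lambda>x. p * x powr (p - 1)"] assms has_real_derivative_powr by force

lemma sum_powr_le:
  assumes y: "y > 0"
  shows "(\<Sum>n=1..N. real n powr (y - 1)) \<le> real (Suc N) powr y / y"
proof (cases "y \<ge> 1")
  case True
  show ?thesis
  proof (induction N)
    case (Suc N)
    obtain \<xi> where x: "real (Suc N) < \<xi>" "\<xi> < real (Suc (Suc N))"
      "real (Suc (Suc N)) powr y - real (Suc N) powr y = (real (Suc (Suc N)) - real (Suc N)) * (y * \<xi> powr (y - 1))"
      by (rule powr_mvt[of "real (Suc N)" "real (Suc (Suc N))" y]) auto
    have "real (Suc N) powr (y - 1) \<le> \<xi> powr (y - 1)" using x True by (intro powr_mono2) auto
    hence "y * real (Suc N) powr (y - 1) \<le> real (Suc (Suc N)) powr y - real (Suc N) powr y"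
      using x(3) y by simp
    hence "real (Suc N) powr (y - 1) \<le> real (Suc (Suc N)) powr y / y - real (Suc N) powr y / y"
      using y by (simp add: field_simps)
    thus ?case using Suc by simp
  qed (use y in auto)
next
  case False
  have "(\<Sum>n=1..N. real n powr (y - 1)) \<le> real N powr y / y"
  proof (induction N)
    case (Suc N)
    show ?case
    proof (cases "N = 0")
      case True
      thus ?thesis using y False by simp
    next
      case N: False
      obtain \<xi> where x: "real N < \<xi>" "\<xi> < real (Suc N)"
        "real (Suc N) powr y - real N powr y = (real (Suc N) - real N) * (y * \<xi> powr (y - 1))"
        by (rule powr_mvt[of "real N" "real (Suc N)" y]) (use N in auto)
      have "real (Suc N) powr (y - 1) \<le> \<xi> powr (y - 1)" using x False N by (intro powr_mono2') auto
      hence "y * real (Suc N) powr (y - 1) \<le> real (Suc N) powr y - real N powr y"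
        using x(3) y by simp
      hence "real (Suc N) powr (y - 1) \<le> real (Suc N) powr y / y - real N powr y / y"
        using y by (simp add: field_simps)
      thus ?thesis using Suc by simp
    qed
  qed auto
  also have "\<dots> \<le> real (Suc N) powr y / y" using y by (intro divide_right_mono powr_mono2) auto
  finally show ?thesis .
qed

lemma tail_bound:
  fixes c :: "nat \<Rightarrow> complex"
  assumes C: "\<And>n. cmod (c n) \<le> C" and x: "Re z > 0" and N: "N \<ge> 1"
    and sm: "(\<lambda>n. c n * of_nat n powr (- (z + 1))) sums S"
  shows "cmod (S - (\<Sum>n<Suc N. c n * of_nat n powr (- (z + 1)))) \<le> C / Re z * real N powr (- Re z)"
proof -
  define x where "x = Re z"
  have x0: "x > 0" using x by (simp add: x_def)
  have C0: "C \<ge> 0" using order_trans[OF norm_ge_zero C] .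
  define f where "f = (\<lambda>n. c (n + Suc N) * of_nat (n + Suc N) powr (- (z + 1)))"
  have f: "f sums (S - (\<Sum>n<Suc N. c n * of_nat n powr (- (z + 1))))"
    using sums_split_initial_segment[OF sm, of "Suc N"] by (simp add: f_def)
  define v where "v = (\<lambda>n. real (n + N) powr (- x))"
  have "v \<longlonglongrightarrow> 0" unfolding v_def using x0 by real_asymp
  from sums_mult[OF telescope_sums'[OF this], of "C / x"]
  have v: "(\<lambda>n. C / x * (v n - v (Suc n))) sums (C / x * real N powr (- x))" by (simp add: v_def)
  have le: "cmod (f n) \<le> C / x * (v n - v (Suc n))" for n
  proof -
    obtain \<xi> where xi: "real (n + N) < \<xi>" "\<xi> < real (n + Suc N)"
        "real (n + Suc N) powr (- x) - real (n + N) powr (- x) = (real (n + Suc N) - real (n + N)) * (- x * \<xi> powr (- x - 1))"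
      by (rule powr_mvt[of "real (n + N)" "real (n + Suc N)" "- x"]) (use N in auto)
    have "real (n + Suc N) powr (- x - 1) \<le> \<xi> powr (- x - 1)" using xi x0 N by (intro powr_mono2') auto
    hence "x * real (n + Suc N) powr (- x - 1) \<le> x * \<xi> powr (- x - 1)" using x0 by (intro mult_left_mono) auto
    also have "x * \<xi> powr (- x - 1) = v n - v (Suc n)" using xi(3) by (simp add: v_def add.assoc)
    finally have "x * real (n + Suc N) powr (- x - 1) \<le> v n - v (Suc n)" .
    hence 1: "real (n + Suc N) powr (- x - 1) \<le> (v n - v (Suc n)) / x" using x0 by (simp add: field_simps)
    have "cmod (f n) = cmod (c (n + Suc N)) * real (n + Suc N) powr (- x - 1)"
      unfolding f_def norm_mult norm_nat_powr by (simp add: x_def)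
    also have "\<dots> \<le> C * ((v n - v (Suc n)) / x)" using 1 C C0 by (intro mult_mono) auto
    finally show ?thesis by simp
  qed
  have "cmod (suminf f) \<le> (\<Sum>n. C / x * (v n - v (Suc n)))"
    by (rule norm_suminf_le[OF le sums_summable[OF v]])
  thus ?thesis using f v by (simp add: sums_iff x_def)
qed

lemma head_bound:
  fixes c :: "nat \<Rightarrow> complex"
  assumes C: "\<And>n. cmod (c n) \<le> C" and y: "Re z < 0"
  shows "cmod (\<Sum>n<Suc N. c n * of_nat n powr (- (z + 1))) \<le> C * (real (Suc N) powr (- Re z) / (- Re z))"
proof -
  have C0: "C \<ge> 0" using order_trans[OF norm_ge_zero C] .
  have e: "{..<Suc N} = insert 0 {1..N}" by auto
  have "cmod (\<Sum>n<Suc N. c n * of_nat n powr (- (z + 1))) = cmod (\<Sum>n=1..N. c n * of_nat n powr (- (z + 1)))"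
    unfolding e by simp
  also have "\<dots> \<le> (\<Sum>n=1..N. cmod (c n * of_nat n powr (- (z + 1))))" by (rule norm_sum)
  also have "\<dots> \<le> (\<Sum>n=1..N. C * real n powr (- Re z - 1))"
    unfolding norm_mult norm_nat_powr using C by (intro sum_mono mult_mono) (auto intro: C0)
  also have "\<dots> = C * (\<Sum>n=1..N. real n powr (- Re z - 1))" by (simp add: sum_distrib_left)
  also have "\<dots> \<le> C * (real (Suc N) powr (- Re z) / (- Re z))"
    using sum_powr_le[of "- Re z" N] y C0 by (intro mult_left_mono) auto
  finally show ?thesis .
qed

text \<open>Newman's kernel: on the circle |z| = R the factor 1 + z^2/R^2 turns 1/z into 2 Re z/R^2, which compensates for the factor
1/|Re z| in the bounds for the tails and for the partial sums.\<close>

lemma circle_kernel: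
  assumes "cmod z = R" "R > 0"
  shows "cmod ((1 + z\<^sup>2 / of_real (R\<^sup>2)) / z) = 2 * \<bar>Re z\<bar> / R\<^sup>2"
proof -
  have z: "z \<noteq> 0" using assms by auto
  have "z * cnj z = of_real (R\<^sup>2)" using complex_norm_square[of z] assms by simp
  hence "(1 + z\<^sup>2 / of_real (R\<^sup>2)) / z = (z * cnj z + z\<^sup>2) / of_real (R\<^sup>2) / z"
    using assms by (simp add: add_divide_distrib)
  also have "z * cnj z + z\<^sup>2 = z * (cnj z + z)" by (simp add: power2_eq_square algebra_simps)
  also have "z * (cnj z + z) / of_real (R\<^sup>2) / z = (cnj z + z) / of_real (R\<^sup>2)" using z by simp
  also have "cnj z + z = of_real (2 * Re z)" by (simp add: complex_eq_iff)
  finally show ?thesis by (simp add: norm_divide abs_mult norm_power)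
qed

definition right_arc :: "real \<Rightarrow> real \<Rightarrow> complex" where "right_arc R = part_circlepath 0 R (- (pi / 2)) (pi / 2)"

definition left_arc :: "real \<Rightarrow> real \<Rightarrow> complex" where "left_arc R = part_circlepath 0 R (pi / 2) (pi + pi / 2)"

lemma valid_arcs [simp]: "valid_path (right_arc R)" "valid_path (left_arc R)"
  by (simp_all add: right_arc_def left_arc_def)

lemma arc_ends:
  "pathstart (right_arc R) = - \<i> * R" "pathfinish (right_arc R) = \<i> * R"
  "pathstart (left_arc R) = \<i> * R" "pathfinish (left_arc R) = - \<i> * R"
proof -
  have "cis (pi / 2) = \<i>" "cis (- (pi / 2)) = - \<i>" by (simp_all add: complex_eq_iff)
  moreover have "cis (pi + pi / 2) = - \<i>" using cis_mult[of pi "pi / 2"] calculation by simp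
  ultimately show "pathstart (right_arc R) = - \<i> * R" "pathfinish (right_arc R) = \<i> * R"
    "pathstart (left_arc R) = \<i> * R" "pathfinish (left_arc R) = - \<i> * R"
    unfolding right_arc_def left_arc_def pathstart_part_circlepath pathfinish_part_circlepath cis_conv_exp[symmetric]
    by (simp_all only: add_0_left mult.commute)
qed

lemma right_arc_image:
  assumes "R > 0" "z \<in> path_image (right_arc R)" 
  shows "cmod z = R \<and> Re z \<ge> 0"
proof -
  obtain t where t: "- (pi / 2) \<le> t" "t \<le> pi / 2" "z = R * cis t"
    using assms path_image_part_circlepath[of "- (pi / 2)" "pi / 2" 0 R] by (auto simp: right_arc_def cis_conv_exp)
  have "cos t \<ge> 0" using t by (intro cos_ge_zero) auto
  thus ?thesis using t(3) assms(1) by (auto simp: norm_mult)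
qed

lemma left_arc_image: 
  assumes "R > 0" "z \<in> path_image (left_arc R)" 
  shows "cmod z = R \<and> Re z \<le> 0"
proof -
  obtain t where t: "pi / 2 \<le> t" "t \<le> pi + pi / 2" "z = R * cis t"
    using assms path_image_part_circlepath[of "pi / 2" "pi + pi / 2" 0 R] by (auto simp: left_arc_def cis_conv_exp)
  have "cos (t - pi) \<ge> 0" using t by (intro cos_ge_zero) auto
  hence "cos t \<le> 0" by (simp add: cos_diff)
  thus ?thesis using t(3) assms(1) by (auto simp: norm_mult mult_nonneg_nonpos)
qed

text \<open>Cauchy's formula for the right half of the circle, closed by any path on the left that avoids the nonnegative real axis.  It will be used with the left
half of the circle for the partial sums and with a path close to the imaginary axis for the limit function.\<close>

lemma cauchy_two_paths:
  assumes R: "R > 0" and U: "convex U" "open U" "0 \<in> U" and f: "f holomorphic_on U"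
    and r: "path_image (right_arc R) \<subseteq> U"
    and g: "valid_path g" "pathstart g = \<i> * R" "pathfinish g = - \<i> * R" "path_image g \<subseteq> U"
       "\<And>z. z \<in> path_image g \<Longrightarrow> - z \<notin> \<real>\<^sub>\<le>\<^sub>0"
  shows "contour_integral (right_arc R) (\<lambda>z. f z / z) + contour_integral g (\<lambda>z. f z / z) = 2 * pi * \<i> * f 0"
    and "(\<lambda>z. f z / z) contour_integrable_on (right_arc R)" "(\<lambda>z. f z / z) contour_integrable_on g"
proof -
  let ?h = "right_arc R +++ g"
  have vr: "valid_path (right_arc R)" by simp
  have vh: "valid_path ?h" using g by (intro valid_path_join) (auto simp: arc_ends)
  have z0: "0 \<notin> path_image g" using g(5)[of 0] by auto
  have z1: "0 \<notin> path_image (right_arc R)" using right_arc_image[OF R, of 0] R by auto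
  have op: "open (U - {0})" using U by auto
  have intg: "(\<lambda>z. F z / z) contour_integrable_on p" if "F holomorphic_on U" "valid_path p" "path_image p \<subseteq> U - {0}" for F p
    using that op by (intro contour_integrable_holomorphic_simple[OF _ op]) (auto intro!: holomorphic_intros elim: holomorphic_on_subset)
  have pr: "path_image (right_arc R) \<subseteq> U - {0}" using r z1 by auto
  have pg: "path_image g \<subseteq> U - {0}" using g z0 by auto
  show i1: "(\<lambda>z. f z / z) contour_integrable_on (right_arc R)" by (rule intg[OF f vr pr])
  show i2: "(\<lambda>z. f z / z) contour_integrable_on g" by (rule intg[OF f g(1) pg])
  have ph: "path_image ?h \<subseteq> U - {0}" using pr pg by (auto simp: path_image_join arc_ends g)
  have cl: "pathfinish ?h = pathstart ?h" using g by (simp add: arc_ends)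
  have LnR: "Ln (\<i> * R) - Ln (- \<i> * R) = \<i> * pi"
  proof -
    have e: "Ln (\<i> * R) = of_real (ln R) + \<i> * pi / 2" "Ln (- \<i> * R) = of_real (ln R) - \<i> * pi / 2"
      using R Ln_times_of_real[of R \<i>] Ln_times_of_real[of R "- \<i>"] by (simp_all add: Ln_of_real mult.commute)
    show ?thesis unfolding e by (simp add: field_simps)
  qed
  have a: "((\<lambda>z. 1 / z) has_contour_integral (\<i> * pi)) (right_arc R)"
  proof -
    have "((\<lambda>z. 1 / z) has_contour_integral (Ln (pathfinish (right_arc R)) - Ln (pathstart (right_arc R)))) (right_arc R)"
    proof (rule contour_integral_primitive[where S = "- \<real>\<^sub>\<le>\<^sub>0"])
      show "path_image (right_arc R) \<subseteq> - \<real>\<^sub>\<le>\<^sub>0"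
      proof
        fix z assume z: "z \<in> path_image (right_arc R)"
        show "z \<in> - \<real>\<^sub>\<le>\<^sub>0" using right_arc_image[OF R z] R by (auto simp: complex_nonpos_Reals_iff cmod_eq_Re)
      qed
      show "(Ln has_field_derivative 1 / x) (at x within - \<real>\<^sub>\<le>\<^sub>0)" if "x \<in> - \<real>\<^sub>\<le>\<^sub>0" for x
        using that by (auto intro!: derivative_eq_intros simp: inverse_eq_divide)
    qed (rule vr)
    thus ?thesis using LnR by (simp add: arc_ends)
  qed
  have b: "((\<lambda>z. 1 / z) has_contour_integral (\<i> * pi)) g"
  proof -
    have "((\<lambda>z. 1 / z) has_contour_integral (Ln (- pathfinish g) - Ln (- pathstart g))) g"
    proof (rule contour_integral_primitive[where S = "{z. - z \<notin> \<real>\<^sub>\<le>\<^sub>0}"])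
      show "path_image g \<subseteq> {z. - z \<notin> \<real>\<^sub>\<le>\<^sub>0}" using g(5) by auto
      show "((\<lambda>z. Ln (- z)) has_field_derivative 1 / x) (at x within {z. - z \<notin> \<real>\<^sub>\<le>\<^sub>0})" if "x \<in> {z. - z \<notin> \<real>\<^sub>\<le>\<^sub>0}" for x
        using that by (auto intro!: derivative_eq_intros simp: field_simps)
    qed (rule g(1))
    thus ?thesis using LnR g by simp
  qed
  have "winding_number ?h 0 = 1 / (2 * pi * \<i>) * contour_integral ?h (\<lambda>w. 1 / (w - 0))"
    using vh ph by (intro winding_number_valid_path) auto
  also have "contour_integral ?h (\<lambda>w. 1 / (w - 0)) = \<i> * pi + \<i> * pi"
    using has_contour_integral_join[OF a b vr g(1)] by (simp add: contour_integral_unique)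
  finally have wn: "winding_number ?h 0 = 1" by simp
  have "((\<lambda>w. f w / (w - 0)) has_contour_integral (2 * pi * \<i> * winding_number ?h 0 * f 0)) ?h"
    using U ph vh cl by (intro Cauchy_integral_formula_convex_simple[OF U(1) f]) (auto simp: interior_open)
  hence "contour_integral ?h (\<lambda>z. f z / z) = 2 * pi * \<i> * f 0" unfolding wn by (simp add: contour_integral_unique)
  thus "contour_integral (right_arc R) (\<lambda>z. f z / z) + contour_integral g (\<lambda>z. f z / z) = 2 * pi * \<i> * f 0"
    using contour_integral_join[OF i1 i2 vr g(1)] by simp
qed

text \<open>Dominated convergence: the modulus of N^z tends to zero wherever the real part of z is negative.\<close>

lemma linepath_integral_limit:
  assumes h: "continuous_on (closed_segment a b) h"
    and re: "\<And>z. z \<in> closed_segment a b \<Longrightarrow> Re z \<le> 0 \<and> (Re z < 0 \<or> h z = 0)"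
  shows "(\<lambda>N. contour_integral (linepath a b) (\<lambda>z. h z * of_nat N powr z)) \<longlonglongrightarrow> 0"
proof -
  obtain M where M: "\<And>z. z \<in> closed_segment a b \<Longrightarrow> cmod (h z) \<le> M"
    using compact_imp_bounded[OF compact_continuous_image[OF h compact_segment]] by (auto simp: bounded_iff)
  define F where "F = (\<lambda>N x. h (linepath a b x) * of_nat N powr (linepath a b x) * (b - a))"
  have seg: "linepath a b x \<in> closed_segment a b" if "x \<in> {0..1}" for x
    using that by (auto simp: linepath_in_path)
  have ci: "(\<lambda>z. h z * of_nat N powr z) contour_integrable_on linepath a b" for N
  proof (cases "N = 0")
    case False
    thus ?thesis using h by (intro contour_integrable_continuous_linepath continuous_intros) auto
  qed (auto simp: contour_integrable_on_def intro: has_contour_integral_0)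
  have hi: "(F N has_integral contour_integral (linepath a b) (\<lambda>z. h z * of_nat N powr z)) {0..1}" for N
    using has_contour_integral_integral[OF ci[of N]] unfolding has_contour_integral_linepath F_def .
  have "(\<lambda>N. integral {0..1} (F N)) \<longlonglongrightarrow> integral {0..1::real} (\<lambda>x. 0::complex)"
  proof (rule dominated_convergence(2)[where h = "\<lambda>_. M * cmod (b - a)"])
    show "F N integrable_on {0..1}" for N using hi by blast
    show "cmod (F N x) \<le> M * cmod (b - a)" if "x \<in> {0..1}" for N x
    proof -
      have "real N powr Re (linepath a b x) \<le> 1"
        using re[OF seg[OF that]] powr_mono[of "Re (linepath a b x)" 0 "real N"] by (cases "N = 0") auto
      hence "cmod (h (linepath a b x)) * real N powr Re (linepath a b x) \<le> M * 1"
        using M[OF seg[OF that]] order_trans[OF norm_ge_zero M[OF seg[OF that]]] by (intro mult_mono) auto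
      thus ?thesis unfolding F_def norm_mult norm_nat_powr by (intro mult_right_mono) auto
    qed
    show "(\<lambda>N. F N x) \<longlonglongrightarrow> 0" if "x \<in> {0..1}" for x
    proof (cases "h (linepath a b x) = 0")
      case False
      hence r: "Re (linepath a b x) < 0" using re[OF seg[OF that]] by auto
      have "(\<lambda>N. of_nat N powr (linepath a b x)) \<longlonglongrightarrow> 0"
      proof (rule tendsto_norm_zero_cancel)
        show "(\<lambda>N. cmod (of_nat N powr (linepath a b x))) \<longlonglongrightarrow> 0" unfolding norm_nat_powr using r by real_asymp
      qed
      hence "(\<lambda>N. F N x) \<longlonglongrightarrow> h (linepath a b x) * 0 * (b - a)" unfolding F_def by (intro tendsto_intros)
      thus ?thesis by simp
    qed (simp add: F_def)
  qed auto
  thus ?thesis using hi[THEN integral_unique] by simp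
qed
text \<open>Write G(z) for the extended sum at z + 1 and S_N(z) for its partial sums, which are entire.  Cauchy's formula for G and for S_N, each with the
kernel N^z (1 + z^2/R^2)/z, expresses G(0) - S_N(0) by three integrals: of G - S_N over the right half of the circle |z| = R and of S_N over its
left half, both O(1/R), and of G over a fixed path in the left half-plane, which tends to zero as N grows.\<close>

theorem newman_dirichlet:
  fixes c :: "nat \<Rightarrow> complex"
  assumes C: "\<And>n. cmod (c n) \<le> C"
    and \<Omega>: "open \<Omega>" "{s. Re s \<ge> 1} \<subseteq> \<Omega>" "D holomorphic_on \<Omega>"
    and D: "\<And>s. Re s > 1 \<Longrightarrow> (\<lambda>n. c n * of_nat n powr (- s)) sums D s"
  shows "(\<lambda>n. c n / of_nat n) sums D 1"
proof -
  have C0: "C \<ge> 0" using order_trans[OF norm_ge_zero C] .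
  define G where "G = (\<lambda>z. D (z + 1))"
  define S where "S = (\<lambda>N z. \<Sum>n<Suc N. c n * of_nat n powr (- (z + 1)))"
  define \<Omega>' where "\<Omega>' = (\<lambda>z. z + 1) -` \<Omega>"
  have op': "open \<Omega>'" unfolding \<Omega>'_def using \<Omega>(1) by (intro open_vimage continuous_intros)
  have Gh: "G holomorphic_on \<Omega>'"
    unfolding G_def
    by (rule holomorphic_on_compose_gen[OF _ \<Omega>(3), of "\<lambda>z. z + 1", unfolded o_def]) (auto intro!: holomorphic_intros simp: \<Omega>'_def)
  have Sh: "S N holomorphic_on UNIV" for N
  proof -
    have "(\<lambda>z. c n * of_nat n powr (- (z + 1))) holomorphic_on UNIV" for n
      by (cases "n = 0") (auto intro!: holomorphic_intros)
    thus ?thesis unfolding S_def by (intro holomorphic_on_sum)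
  qed
  have main: "\<forall>\<^sub>F N in sequentially. cmod (G 0 - S N 0) < \<epsilon>" if \<epsilon>: "\<epsilon> > 0" for \<epsilon>
  proof -
    \<comment> \<open>The two half circles contribute about 2 C/R, which has to be below the given bound.\<close>
    define R where "R = 2 * C / \<epsilon> + 1"
    have R: "R > 0" using C0 \<epsilon> by (auto simp: R_def intro: add_nonneg_pos)
    define q where "q = (\<lambda>z::complex. 1 + z\<^sup>2 / of_real (R\<^sup>2))"
    obtain e where e: "e > 0" "(\<Union>x\<in>(\<lambda>y. \<i> * of_real y) ` {- (R + 1)..R + 1}. cball x e) \<subseteq> \<Omega>'"
    proof (rule compact_subset_open_imp_cball_epsilon_subset)
      show "compact ((\<lambda>y. \<i> * complex_of_real y) ` {- (R + 1)..R + 1})"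
        by (intro compact_continuous_image continuous_intros) auto
      show "open \<Omega>'" by (rule op')
      show "(\<lambda>y. \<i> * complex_of_real y) ` {- (R + 1)..R + 1} \<subseteq> \<Omega>'" by (auto simp: \<Omega>'_def intro!: subsetD[OF \<Omega>(2)])
    qed
    \<comment> \<open>A convex neighbourhood of the right half disc on which G is holomorphic.\<close>
    define U where "U = {z. Re z > - e} \<inter> {z. Im z < R + 1} \<inter> {z. Im z > - (R + 1)}"
    have U: "convex U" "open U" "0 \<in> U"
      using e(1) R by (auto simp: U_def intro!: convex_Int open_Int convex_halfspace_Re_gt convex_halfspace_Im_gt convex_halfspace_Im_lt
         open_halfspace_Re_gt open_halfspace_Im_gt open_halfspace_Im_lt)
    have Usub: "U \<subseteq> \<Omega>'"
    proof
      fix z assume z: "z \<in> U"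
      show "z \<in> \<Omega>'"
      proof (cases "Re z \<ge> 0")
        case True
        thus ?thesis using \<Omega>(2) by (auto simp: \<Omega>'_def)
      next
        case False
        have "cmod (\<i> * of_real (Im z) - z) = \<bar>Re z\<bar>" by (simp add: cmod_def)
        hence "z \<in> cball (\<i> * of_real (Im z)) e" using z False by (simp add: dist_norm U_def)
        moreover have "Im z \<in> {- (R + 1)..R + 1}" using z by (simp add: U_def)
        ultimately show ?thesis using e(2) by blast
      qed
    qed
    define d where "d = complex_of_real (- (e / 2))"
    define L where "L = linepath (\<i> * R) d +++ linepath d (- \<i> * R)"
    have Lim: "path_image L = closed_segment (\<i> * R) d \<union> closed_segment d (- \<i> * R)"
      unfolding L_def by (subst path_image_join) auto
    have seg1: "Re z \<le> 0 \<and> Re z > - e \<and> \<bar>Im z\<bar> \<le> R \<and> (Re z < 0 \<or> z = \<i> * R)" if z: "z \<in> closed_segment (\<i> * R) d" for z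
    proof -
      obtain u where u: "0 \<le> u" "u \<le> 1" "z = (1 - u) *\<^sub>R (\<i> * R) + u *\<^sub>R d" using z by (auto simp: in_segment)
      hence ri: "Re z = - (u * (e / 2))" "Im z = (1 - u) * R" by (auto simp: d_def)
      have "u * (e / 2) \<le> 1 * (e / 2)" using u e(1) by (intro mult_right_mono) auto
      moreover have "(1 - u) * R \<le> 1 * R" "0 \<le> (1 - u) * R" using u R by (auto intro!: mult_right_mono)
      moreover have "0 \<le> u * (e / 2)" using u e(1) by auto
      moreover have "Re z < 0 \<or> z = \<i> * R"
        using ri(1) u e(1) by (cases "u = 0") auto
      ultimately show ?thesis using ri e(1) by auto
    qed
    have seg2: "Re z \<le> 0 \<and> Re z > - e \<and> \<bar>Im z\<bar> \<le> R \<and> (Re z < 0 \<or> z = - \<i> * R)" if z: "z \<in> closed_segment d (- \<i> * R)" for z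
    proof -
      have "cnj z \<in> closed_segment (\<i> * R) d"
      proof -
        obtain u where u: "0 \<le> u" "u \<le> 1" "z = (1 - u) *\<^sub>R d + u *\<^sub>R (- \<i> * R)" using z by (auto simp: in_segment)
        thus ?thesis unfolding in_segment by (intro exI[of _ "1 - u"]) (auto simp: d_def complex_eq_iff)
      qed
      from seg1[OF this] show ?thesis by (auto simp: complex_eq_iff)
    qed
    have Lprops: "valid_path L" "pathstart L = \<i> * R" "pathfinish L = - \<i> * R" by (auto simp: L_def)
    have LU: "path_image L \<subseteq> U" using seg1 seg2 unfolding Lim U_def by fastforce
    have Ln: "- z \<notin> \<real>\<^sub>\<le>\<^sub>0" if "z \<in> path_image L" for z
    proof -
      have "Re z < 0 \<or> z = \<i> * R \<or> z = - \<i> * R" using that seg1 seg2 unfolding Lim by blast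
      thus ?thesis using R by (auto simp: complex_nonpos_Reals_iff)
    qed
    have rU: "path_image (right_arc R) \<subseteq> U"
    proof
      fix z assume "z \<in> path_image (right_arc R)"
      from right_arc_image[OF R this] show "z \<in> U" using abs_Im_le_cmod[of z] e(1) by (auto simp: U_def)
    qed
    have lneg: "- z \<notin> \<real>\<^sub>\<le>\<^sub>0" if "z \<in> path_image (left_arc R)" for z
      using left_arc_image[OF R that] R by (auto simp: complex_nonpos_Reals_iff cmod_eq_Re)
    define IL where "IL = (\<lambda>N. contour_integral L (\<lambda>z. G z * (q z * of_nat N powr z) / z))"
    have IL0: "IL \<longlonglongrightarrow> 0"
    proof -
      define h where "h = (\<lambda>z. G z * q z / z)"
      have hc: "continuous_on (path_image L) h" unfolding h_def q_def
      proof (intro continuous_intros)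
        show "continuous_on (path_image L) G"
          using holomorphic_on_imp_continuous_on[OF Gh] LU Usub by (blast intro: continuous_on_subset)
        show "\<forall>z\<in>path_image L. z \<noteq> 0" using Ln by force
      qed (use R in auto)
      \<comment> \<open>The kernel vanishes at the two points of the path that lie on the imaginary axis.\<close>
      have q0: "q (\<i> * R) = 0" "q (- \<i> * R) = 0" using R by (auto simp: q_def power_mult_distrib)
      have l1: "(\<lambda>N. contour_integral (linepath (\<i> * R) d) (\<lambda>z. h z * of_nat N powr z)) \<longlonglongrightarrow> 0"
        by (rule linepath_integral_limit) (use seg1 q0 in \<open>auto simp: h_def Lim intro: continuous_on_subset[OF hc, unfolded h_def]\<close>)
      have l2: "(\<lambda>N. contour_integral (linepath d (- \<i> * R)) (\<lambda>z. h z * of_nat N powr z)) \<longlonglongrightarrow> 0"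
      proof (rule linepath_integral_limit)
        show "continuous_on (closed_segment d (- \<i> * R)) h" by (rule continuous_on_subset[OF hc]) (auto simp: Lim)
        show "Re z \<le> 0 \<and> (Re z < 0 \<or> h z = 0)" if "z \<in> closed_segment d (- \<i> * R)" for z
          using seg2[OF that] q0 by (auto simp: h_def)
      qed
      have "\<forall>\<^sub>F N in sequentially. contour_integral (linepath (\<i> * R) d) (\<lambda>z. h z * of_nat N powr z) + contour_integral (linepath d (- \<i> * R)) (\<lambda>z. h z * of_nat N powr z) = IL N"
      proof (rule eventually_sequentiallyI[of 1])
        fix N :: nat assume N: "N \<ge> 1"
        have cc: "(\<lambda>z. h z * of_nat N powr z) contour_integrable_on linepath a b" if "closed_segment a b \<subseteq> path_image L" for a b
          using N by (intro contour_integrable_continuous_linepath continuous_intros continuous_on_subset[OF hc that]) auto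
        have "IL N = contour_integral L (\<lambda>z. h z * of_nat N powr z)" unfolding IL_def h_def by (simp add: mult.assoc)
        also have "\<dots> = contour_integral (linepath (\<i> * R) d) (\<lambda>z. h z * of_nat N powr z) + contour_integral (linepath d (- \<i> * R)) (\<lambda>z. h z * of_nat N powr z)"
          unfolding L_def by (intro contour_integral_join cc) (auto simp: Lim)
        finally show "contour_integral (linepath (\<i> * R) d) (\<lambda>z. h z * of_nat N powr z) + contour_integral (linepath d (- \<i> * R)) (\<lambda>z. h z * of_nat N powr z) = IL N" by simp
      qed
      from Lim_transform_eventually[OF tendsto_add[OF l1 l2] this] show ?thesis by simp
    qed
    have bound: "cmod (G 0 - S N 0) \<le> C / R * (1 + (1 + 1 / real N) powr R) + cmod (IL N)" if N: "N \<ge> 1" for N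
    proof -
      define k where "k = (\<lambda>z. q z * of_nat N powr z)"
      have kh: "k holomorphic_on X" for X unfolding k_def q_def using N R by (auto intro!: holomorphic_intros)
      have k0: "k 0 = 1" using N by (simp add: k_def q_def)
      have nk: "cmod (k z / z) = 2 * \<bar>Re z\<bar> / R\<^sup>2 * real N powr Re z" if "cmod z = R" for z
      proof -
        have "k z / z = (q z / z) * of_nat N powr z" by (simp add: k_def)
        thus ?thesis unfolding q_def by (simp only: norm_mult norm_nat_powr circle_kernel[OF that R])
      qed
      have GU: "(\<lambda>z. G z * k z) holomorphic_on U"
        by (intro holomorphic_intros kh holomorphic_on_subset[OF Gh Usub])
      have SU: "(\<lambda>z. S N z * k z) holomorphic_on UNIV" by (intro holomorphic_intros kh Sh)
      let ?GK = "\<lambda>z. G z * k z / z" and ?SK = "\<lambda>z. S N z * k z / z" and ?DK = "\<lambda>z. G z * k z / z - S N z * k z / z"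
      have cG: "contour_integral (right_arc R) ?GK + contour_integral L ?GK = 2 * pi * \<i> * (G 0 * k 0)"
          "?GK contour_integrable_on right_arc R"
        by (rule cauchy_two_paths[OF R U GU rU Lprops LU Ln]; assumption)+
      have cS: "contour_integral (right_arc R) ?SK + contour_integral (left_arc R) ?SK = 2 * pi * \<i> * (S N 0 * k 0)"
          "?SK contour_integrable_on right_arc R" "?SK contour_integrable_on left_arc R"
        by (rule cauchy_two_paths[OF R _ _ _ SU _ valid_arcs(2) arc_ends(3) arc_ends(4) _ lneg]; simp)+
      have ci: "?DK contour_integrable_on right_arc R"
        by (intro contour_integrable_diff cG(2) cS(2))
      have B1: "cmod (contour_integral (right_arc R) ?DK) \<le> 2 * C / R\<^sup>2 * R * (pi / 2 - - (pi / 2))"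
      proof (rule has_contour_integral_bound_part_circlepath)
        show "(?DK has_contour_integral contour_integral (right_arc R) ?DK) (part_circlepath 0 R (- (pi / 2)) (pi / 2))"
          using has_contour_integral_integral[OF ci] unfolding right_arc_def .
        fix z assume "z \<in> path_image (part_circlepath 0 R (- (pi / 2)) (pi / 2))"
        hence z: "cmod z = R" "Re z \<ge> 0" using right_arc_image[OF R, of z] by (auto simp: right_arc_def)
        have e: "G z * k z / z - S N z * k z / z = (G z - S N z) * (k z / z)" by (simp add: algebra_simps diff_divide_distrib)
        show "cmod (G z * k z / z - S N z * k z / z) \<le> 2 * C / R\<^sup>2"
        proof (cases "Re z = 0")
          case True
          thus ?thesis unfolding e norm_mult nk[OF z(1)] using C0 by simp
        next
          case False
          hence x: "Re z > 0" using z by simp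
          have sm: "(\<lambda>n. c n * of_nat n powr (- (z + 1))) sums G z" unfolding G_def using D[of "z + 1"] x by simp
          have "cmod (G z - S N z) \<le> C / Re z * real N powr (- Re z)" unfolding S_def by (rule tail_bound[OF C x N sm])
          hence "cmod (G z - S N z) * cmod (k z / z) \<le> C / Re z * real N powr (- Re z) * (2 * \<bar>Re z\<bar> / R\<^sup>2 * real N powr Re z)"
            unfolding nk[OF z(1)] using x by (intro mult_right_mono) auto
          also have "\<dots> = 2 * C / R\<^sup>2 * (real N powr (- Re z) * real N powr Re z)" using x by (simp add: field_simps)
          also have "real N powr (- Re z) * real N powr Re z = 1" using N by (simp add: powr_minus)
          finally show ?thesis unfolding e norm_mult by simp
        qed
      qed (use C0 R in auto)
      have B2: "cmod (contour_integral (left_arc R) ?SK) \<le> 2 * C / R\<^sup>2 * (1 + 1 / real N) powr R * R * ((pi + pi / 2) - pi / 2)"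
      proof (rule has_contour_integral_bound_part_circlepath)
        show "(?SK has_contour_integral contour_integral (left_arc R) ?SK) (part_circlepath 0 R (pi / 2) (pi + pi / 2))"
          using has_contour_integral_integral[OF cS(3)] unfolding left_arc_def .
        fix z assume "z \<in> path_image (part_circlepath 0 R (pi / 2) (pi + pi / 2))"
        hence z: "cmod z = R" "Re z \<le> 0" using left_arc_image[OF R, of z] by (auto simp: left_arc_def)
        have e: "S N z * k z / z = S N z * (k z / z)" by simp
        show "cmod (S N z * k z / z) \<le> 2 * C / R\<^sup>2 * (1 + 1 / real N) powr R"
        proof (cases "Re z = 0")
          case True
          thus ?thesis unfolding e norm_mult nk[OF z(1)] using C0 by simp
        next
          case False
          hence x: "Re z < 0" using z by simp
          define y where "y = - Re z"
          have y: "y > 0" "y \<le> R" using x abs_Re_le_cmod[of z] z by (auto simp: y_def)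
          have nky: "cmod (k z / z) = 2 * y / R\<^sup>2 * real N powr (- y)" unfolding nk[OF z(1)] using x by (simp add: y_def)
          have "cmod (S N z) \<le> C * (real (Suc N) powr y / y)" unfolding S_def y_def by (rule head_bound[OF C x])
          hence "cmod (S N z) * cmod (k z / z) \<le> C * (real (Suc N) powr y / y) * (2 * y / R\<^sup>2 * real N powr (- y))"
            unfolding nky using y by (intro mult_right_mono) auto
          also have "\<dots> = 2 * C / R\<^sup>2 * (real (Suc N) powr y * real N powr (- y))" using y by (simp add: field_simps)
          also have "real (Suc N) powr y * real N powr (- y) = (1 + 1 / real N) powr y"
          proof -
            have e1: "1 + 1 / real N = real (Suc N) / real N" using N by (simp add: field_simps)
            show ?thesis unfolding e1 powr_minus using powr_divide[of "real (Suc N)" "real N" y] by (simp add: divide_inverse)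
          qed
          also have "2 * C / R\<^sup>2 * (1 + 1 / real N) powr y \<le> 2 * C / R\<^sup>2 * (1 + 1 / real N) powr R"
            using y C0 by (intro mult_left_mono powr_mono) auto
          finally show ?thesis unfolding e norm_mult .
        qed
      qed (use C0 R in auto)
      have total: "2 * pi * \<i> * (G 0 - S N 0) = contour_integral (right_arc R) ?DK + IL N - contour_integral (left_arc R) ?SK"
      proof -
        have e1: "contour_integral L ?GK = IL N" by (simp add: IL_def k_def)
        have "2 * pi * \<i> * (G 0 - S N 0) = 2 * pi * \<i> * (G 0 * k 0) - 2 * pi * \<i> * (S N 0 * k 0)"
          unfolding k0 by (simp add: right_diff_distrib)
        thus ?thesis unfolding cG(1)[symmetric] cS(1)[symmetric] e1 contour_integral_diff[OF cG(2) cS(2)] by simp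
      qed
      have "cmod (2 * pi * \<i> * (G 0 - S N 0)) \<le> 2 * C / R\<^sup>2 * R * (pi / 2 - - (pi / 2)) + cmod (IL N) + 2 * C / R\<^sup>2 * (1 + 1 / real N) powr R * R * ((pi + pi / 2) - pi / 2)"
        unfolding total using B1 B2 norm_triangle_ineq4[of "contour_integral (right_arc R) ?DK + IL N" "contour_integral (left_arc R) ?SK"]
          norm_triangle_ineq[of "contour_integral (right_arc R) ?DK" "IL N"] by linarith
      also have "\<dots> = 2 * pi * (C / R * (1 + (1 + 1 / real N) powr R)) + cmod (IL N)"
        using R by (simp add: field_simps power2_eq_square)
      also have "\<dots> \<le> 2 * pi * (C / R * (1 + (1 + 1 / real N) powr R)) + 2 * pi * cmod (IL N)"
        using pi_ge_two by (intro add_left_mono mult_le_cancel_right1[THEN iffD2]) auto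
      finally have "2 * pi * cmod (G 0 - S N 0) \<le> 2 * pi * (C / R * (1 + (1 + 1 / real N) powr R) + cmod (IL N))"
        by (simp only: norm_mult norm_of_real norm_ii norm_numeral abs_of_pos[OF pi_gt_zero] abs_of_pos[of "2 * pi"] mult_1_right distrib_left pi_gt_zero zero_less_mult_iff zero_less_numeral simp_thms)
      thus ?thesis using pi_gt_zero by (simp only: mult_le_cancel_left_pos zero_less_mult_iff zero_less_numeral simp_thms)
    qed
    have "(\<lambda>N. (1 + 1 / real N) powr R) \<longlonglongrightarrow> 1" using R by real_asymp
    hence "(\<lambda>N. C / R * (1 + (1 + 1 / real N) powr R) + cmod (IL N)) \<longlonglongrightarrow> C / R * (1 + 1) + cmod 0"
      by (intro tendsto_intros IL0)
    moreover have "C / R * (1 + 1) + cmod 0 < \<epsilon>"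
    proof -
      have "2 * C < \<epsilon> * R" using \<epsilon> by (simp add: R_def field_simps)
      thus ?thesis using R by (simp add: field_simps)
    qed
    ultimately have "\<forall>\<^sub>F N in sequentially. C / R * (1 + (1 + 1 / real N) powr R) + cmod (IL N) < \<epsilon>"
      by (rule order_tendstoD(2))
    thus ?thesis using eventually_ge_at_top[of 1] by eventually_elim (use bound in force)
  qed
  have "(\<lambda>N. S N 0) \<longlonglongrightarrow> G 0"
    unfolding tendsto_iff dist_norm norm_minus_commute[of _ "G 0"] using main by simp
  hence "(\<lambda>N. \<Sum>n<Suc N. c n / of_nat n) \<longlonglongrightarrow> D 1"
    by (simp add: S_def G_def powr_minus_divide)
  thus ?thesis unfolding sums_def by (subst (asm) filterlim_sequentially_Suc)
qed

section \<open>The prime number theorem and the prime sum\<close>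

lemma psi_error_sum_convergent: "summable (\<lambda>n. psi_error n / real n / real n)"
proof -
  obtain \<Omega> D where *: "open \<Omega>" "{s. Re s \<ge> 1} \<subseteq> \<Omega>" "D holomorphic_on \<Omega>"
     "\<And>s. Re s > 1 \<Longrightarrow> (\<lambda>n. of_real (psi_error n / real n) * of_nat n powr (- s)) sums D s"
    using psi_error_extension by blast
  have "cmod (of_real (psi_error n / real n)) \<le> 4" for n
    using psi_error_bound[of n] by (cases "n = 0") (auto simp: norm_divide divide_simps)
  from newman_dirichlet[OF this *]
  have "(\<lambda>n. Re (of_real (psi_error n / real n) / of_nat n)) sums Re (D 1)" by (rule sums_Re)
  moreover have "Re (of_real (psi_error n / real n) / of_nat n) = psi_error n / real n / real n" for n
    by (metis Re_complex_of_real of_real_divide of_real_of_nat_eq)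
  ultimately show ?thesis by (simp add: sums_iff)
qed

text \<open>As \<psi> is monotone, \<psi>(M) \<ge> (1 + \<epsilon>) M would force \<psi>(n) - n \<ge> \<epsilon> M/2 for all n between M and (1 + \<epsilon>/2) M, and so
a contribution of order \<epsilon>^2 to the convergent series.  The other inequality is treated in the same way, to the left of M.\<close>

lemma psi_asymp: "(\<lambda>n. psi n / real n) \<longlonglongrightarrow> 1"
proof (rule LIMSEQ_I)
  fix \<epsilon>0 :: real assume e0: "\<epsilon>0 > 0"
  define \<epsilon> where "\<epsilon> = min \<epsilon>0 1 / 2"
  have e: "\<epsilon> > 0" "\<epsilon> \<le> 1 / 2" "\<epsilon> < \<epsilon>0" using e0 by (auto simp: \<epsilon>_def min_def)
  obtain N0 where N0: "\<And>m n. m \<ge> N0 \<Longrightarrow> norm (\<Sum>k=m..<n. psi_error k / real k / real k) < \<epsilon>\<^sup>2 / 32"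
    using psi_error_sum_convergent e(1) unfolding summable_Cauchy by (meson zero_less_divide_iff zero_less_numeral zero_less_power)
  obtain N1 :: nat where N1: "real N1 \<ge> 4 / \<epsilon>" using real_arch_simple by blast
  have "norm (psi M / real M - 1) < \<epsilon>0" if M: "M \<ge> 2 * N0 + N1 + 1" for M
  proof -
    have M0: "real M > 0" "M \<ge> N0" using M by auto
    have M4: "\<epsilon> * real M \<ge> 4" 
    proof -
      have "4 / \<epsilon> \<le> real M" using N1 M by linarith
      thus ?thesis using e(1) by (simp add: field_simps)
    qed
    define k where "k = nat \<lfloor>\<epsilon> * real M / 2\<rfloor>"
    have "real k = of_int \<lfloor>\<epsilon> * real M / 2\<rfloor>" unfolding k_def using e M0 by simp
    hence k: "real k \<le> \<epsilon> * real M / 2" "real k \<ge> \<epsilon> * real M / 4" using M4 by linarith+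
    have "\<epsilon> * real M \<le> 1 / 2 * real M" using e by (intro mult_right_mono) auto
    hence kM: "2 * k \<le> M" using k(1) by linarith
    have "psi M < (1 + \<epsilon>) * real M"
    proof (rule ccontr)
      assume "\<not> ?thesis"
      hence P: "psi M \<ge> (1 + \<epsilon>) * real M" by simp
      have "\<epsilon>\<^sup>2 / 32 \<le> (\<epsilon> * real M / 4) * (\<epsilon> / (8 * real M))" using M0 by (simp add: power2_eq_square)
      also have "\<dots> \<le> real k * (\<epsilon> / (8 * real M))" using k e M0 by (intro mult_right_mono) auto
      also have "\<dots> = (\<Sum>n=M..<M + k. \<epsilon> / (8 * real M))" by simp
      also have "\<dots> \<le> (\<Sum>n=M..<M + k. psi_error n / real n / real n)"
      proof (rule sum_mono)
        fix n assume n: "n \<in> {M..<M + k}"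
        hence n': "real n \<le> real M + \<epsilon> * real M / 2" "real n \<le> 2 * real M" "real n > 0" using k kM M0 by auto
        have "psi_error n \<ge> \<epsilon> * real M / 2" unfolding psi_error_def using P psi_mono[of M n] n n' by (simp add: algebra_simps)
        moreover have "\<epsilon> * real M / 2 \<ge> 0" using e M0 by simp
        ultimately have "psi_error n \<ge> \<epsilon> * real M / 2" "psi_error n \<ge> 0" "\<epsilon> * real M / 2 \<ge> 0" by linarith+
        hence "psi_error n / (real n * real n) \<ge> (\<epsilon> * real M / 2) / ((2 * real M) * (2 * real M))"
          using n' by (intro frac_le mult_mono) auto
        also have "(\<epsilon> * real M / 2) / ((2 * real M) * (2 * real M)) = \<epsilon> / (8 * real M)" using M0 by simp
        finally show "\<epsilon> / (8 * real M) \<le> psi_error n / real n / real n" by simp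
      qed
      also have "\<dots> < \<epsilon>\<^sup>2 / 32" using N0[of M "M + k"] M0(2) by simp
      finally show False by simp
    qed
    moreover have "psi M > (1 - \<epsilon>) * real M"
    proof (rule ccontr)
      assume "\<not> ?thesis"
      hence P: "psi M \<le> (1 - \<epsilon>) * real M" by simp
      have "\<epsilon>\<^sup>2 / 32 \<le> (\<epsilon> * real M / 4) * (\<epsilon> / (2 * real M))" using M0 by (simp add: power2_eq_square)
      also have "\<dots> \<le> real k * (\<epsilon> / (2 * real M))" using k e M0 by (intro mult_right_mono) auto
      also have "\<dots> = (\<Sum>n=M - k..<M. \<epsilon> / (2 * real M))" using kM by simp
      also have "\<dots> \<le> (\<Sum>n=M - k..<M. - (psi_error n / real n / real n))"
      proof (rule sum_mono)
        fix n assume n: "n \<in> {M - k..<M}"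
        hence n': "real n \<ge> real M - \<epsilon> * real M / 2" "real n \<le> real M" "real n > 0" using k kM M0 by auto
        have "- psi_error n \<ge> \<epsilon> * real M / 2" unfolding psi_error_def using P psi_mono[of n M] n n' by (simp add: algebra_simps)
        hence "(- psi_error n) / (real n * real n) \<ge> (\<epsilon> * real M / 2) / (real M * real M)"
          using n' e M0 mult_nonneg_nonneg[of \<epsilon> "real M"] by (intro frac_le mult_mono) auto
        also have "(\<epsilon> * real M / 2) / (real M * real M) = \<epsilon> / (2 * real M)" using M0 by simp
        finally show "\<epsilon> / (2 * real M) \<le> - (psi_error n / real n / real n)" by simp
      qed
      also have "\<dots> < \<epsilon>\<^sup>2 / 32"
      proof -
        have "N0 \<le> M - k" using M kM by linarith
        from N0[OF this, of M] show ?thesis unfolding sum_negf real_norm_def by linarith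
      qed
      finally show False by simp
    qed
    ultimately have "\<bar>psi M / real M - 1\<bar> < \<epsilon>" using M0 by (auto simp: abs_less_iff field_simps)
    thus ?thesis using e(3) by simp
  qed
  thus "\<exists>no. \<forall>n\<ge>no. norm (psi n / real n - 1) < \<epsilon>0" by blast
qed

definition primes_le :: "nat \<Rightarrow> nat set" where "primes_le n = {p. prime p \<and> p \<le> n}"

abbreviation prime_count :: "nat \<Rightarrow> real" where "prime_count n \<equiv> real (card (primes_le n))"

lemma finite_primes_le [simp]: "finite (primes_le n)" by (simp add: primes_le_def)

text \<open>Each prime p \<le> n contributes log p for every power of p up to n, in total at most log n.\<close>

lemma psi_le_prime_count: "psi n \<le> prime_count n * ln (real n)"
proof -
  let ?K = "{k\<in>{1..n}. primepow k}"
  have "psi n = (\<Sum>k\<in>?K. ln (real (aprimedivisor k)))"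
    unfolding psi_def by (subst sum.inter_filter) (auto simp: mangoldt_def intro!: sum.cong)
  also have "\<dots> = (\<Sum>p\<in>primes_le n. \<Sum>k\<in>{k\<in>?K. aprimedivisor k = p}. ln (real (aprimedivisor k)))"
  proof (rule sum.group[symmetric])
    show "aprimedivisor ` ?K \<subseteq> primes_le n"
    proof
      fix p assume "p \<in> aprimedivisor ` ?K"
      then obtain k where k: "k \<in> {1..n}" "primepow k" "p = aprimedivisor k" by auto
      have k1: "k > Suc 0" using k(2) by (rule primepow_gt_Suc_0)
      have "p \<le> k" using k(3) aprimedivisor_le_nat[OF k1] by simp
      moreover have "prime p" using k(3) k1 by (auto intro!: prime_aprimedivisor')
      ultimately show "p \<in> primes_le n" using k(1) by (auto simp: primes_le_def)
    qed
  qed auto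
  also have "\<dots> \<le> (\<Sum>p\<in>primes_le n. ln (real n))"
  proof (rule sum_mono)
    fix p assume "p \<in> primes_le n"
    hence p: "prime p" "p \<le> n" by (auto simp: primes_le_def)
    have p1: "p > 1" using p(1) by (rule prime_gt_1_nat)
    let ?T = "{j. j \<ge> 1 \<and> p ^ j \<le> n}"
    have T: "?T \<subseteq> {1..n}"
    proof
      fix j assume j: "j \<in> ?T"
      have "j < p ^ j" using p1 by (simp add: power_gt_expt)
      thus "j \<in> {1..n}" using j by auto
    qed
    hence fT: "finite ?T" by (rule finite_subset) simp
    have neT: "1 \<in> ?T" using p by auto
    have Mx: "Max ?T \<in> ?T" using fT neT by (intro Max_in) auto
    have "?T \<subseteq> {1..Max ?T}" using fT by auto
    from card_mono[OF _ this] have cT: "card ?T \<le> Max ?T" by simp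
    have "{k\<in>?K. aprimedivisor k = p} \<subseteq> (\<lambda>j. p ^ j) ` ?T"
    proof
      fix k assume "k \<in> {k\<in>?K. aprimedivisor k = p}"
      hence k: "k \<in> {1..n}" "primepow k" "aprimedivisor k = p" by auto
      obtain q j where q: "prime q" "j > 0" "k = q ^ j" using k(2) by (auto simp: primepow_def)
      have "p = q" using k(3) q by (simp add: aprimedivisor_prime_power)
      thus "k \<in> (\<lambda>j. p ^ j) ` ?T" using q k(1) by auto
    qed
    hence "card {k\<in>?K. aprimedivisor k = p} \<le> card ?T"
      using fT by (meson card_image_le card_mono finite_imageI le_trans)
    hence "real (card {k\<in>?K. aprimedivisor k = p}) * ln (real p) \<le> real (Max ?T) * ln (real p)"
      using cT p1 by (intro mult_right_mono) auto
    also have "\<dots> = ln (real (p ^ Max ?T))" using p1 by (simp add: ln_realpow)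
    also have "\<dots> \<le> ln (real n)" using Mx p1 p(2) by (subst ln_le_cancel_iff) (auto simp del: of_nat_power)
    finally show "(\<Sum>k\<in>{k\<in>?K. aprimedivisor k = p}. ln (real (aprimedivisor k))) \<le> ln (real n)" by simp
  qed
  also have "\<dots> = prime_count n * ln (real n)" by simp
  finally show ?thesis .
qed

text \<open>Only the primes above n^(1-\<delta>) matter, and each of them contributes at least (1 - \<delta>) log n to \<psi>(n).\<close>

lemma prime_count_le_psi:
  assumes \<delta>: "0 < \<delta>" "\<delta> < 1" and n: "n \<ge> 2"
  shows "prime_count n * ln (real n) \<le> real n powr (1 - \<delta>) * ln (real n) + psi n / (1 - \<delta>)"
proof -
  define m where "m = nat \<lfloor>real n powr (1 - \<delta>)\<rfloor>"
  have m: "real m \<le> real n powr (1 - \<delta>)" unfolding m_def by simp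
  let ?B = "{p \<in> primes_le n. p > m}"
  have "primes_le n \<subseteq> {1..m} \<union> ?B" by (auto simp: primes_le_def Suc_le_eq prime_gt_0_nat)
  hence "card (primes_le n) \<le> card ({1..m} \<union> ?B)" by (intro card_mono) auto
  also have "\<dots> \<le> m + card ?B" using card_Un_le[of "{1..m}" ?B] by simp
  finally have c: "prime_count n \<le> real m + real (card ?B)" by linarith
  have ln0: "ln (real n) > 0" using n by simp
  have "real (card ?B) * ((1 - \<delta>) * ln (real n)) = (\<Sum>p\<in>?B. (1 - \<delta>) * ln (real n))" by simp
  also have "\<dots> \<le> (\<Sum>p\<in>?B. mangoldt p)"
  proof (rule sum_mono)
    fix p assume p: "p \<in> ?B"
    hence "real p > real n powr (1 - \<delta>)" unfolding m_def by (simp add: nat_less_iff floor_less_iff) 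
    moreover have "p > 0" using p by (auto simp: primes_le_def prime_gt_0_nat)
    ultimately have "ln (real n powr (1 - \<delta>)) \<le> ln (real p)" using n by (subst ln_le_cancel_iff) auto
    thus "(1 - \<delta>) * ln (real n) \<le> mangoldt p" using p n by (simp add: primes_le_def ln_powr)
  qed
  also have "\<dots> \<le> psi n" unfolding psi_def
    by (intro sum_mono2) (auto simp: primes_le_def mangoldt_nonneg Suc_le_eq prime_gt_0_nat)
  finally have "real (card ?B) * ln (real n) \<le> psi n / (1 - \<delta>)" using \<delta> by (simp add: field_simps)
  moreover have "real m * ln (real n) \<le> real n powr (1 - \<delta>) * ln (real n)" using m ln0 by (intro mult_right_mono) auto
  moreover have "prime_count n * ln (real n) \<le> (real m + real (card ?B)) * ln (real n)"
    using c ln0 by (intro mult_right_mono) auto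
  ultimately show ?thesis by (simp add: algebra_simps)
qed

theorem prime_number_theorem: "(\<lambda>n. prime_count n * ln (real n) / real n) \<longlonglongrightarrow> 1"
proof (rule LIMSEQ_I)
  fix \<epsilon> :: real assume e: "\<epsilon> > 0"
  \<comment> \<open>Chosen such that 1/(1 - \<delta>) = 1 + \<epsilon>/2.\<close>
  define \<delta> where "\<delta> = \<epsilon> / (2 + \<epsilon>)"
  have d: "0 < \<delta>" "\<delta> < 1" "1 / (1 - \<delta>) = 1 + \<epsilon> / 2" using e by (auto simp: \<delta>_def field_simps)
  have "(\<lambda>n. real n powr (- \<delta>) * ln (real n)) \<longlonglongrightarrow> 0" using d(1) by real_asymp
  hence "(\<lambda>n. real n powr (- \<delta>) * ln (real n) + psi n / real n * (1 / (1 - \<delta>))) \<longlonglongrightarrow> 0 + 1 * (1 / (1 - \<delta>))"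
    by (intro tendsto_intros psi_asymp)
  hence "\<forall>\<^sub>F n in sequentially. real n powr (- \<delta>) * ln (real n) + psi n / real n * (1 / (1 - \<delta>)) < 1 + \<epsilon>"
    by (rule order_tendstoD(2)) (use d(3) e in auto)
  moreover have "\<forall>\<^sub>F n in sequentially. psi n / real n > 1 - \<epsilon>"
    using psi_asymp by (rule order_tendstoD(1)) (use e in auto)
  ultimately have "\<forall>\<^sub>F n in sequentially. norm (prime_count n * ln (real n) / real n - 1) < \<epsilon>"
    using eventually_ge_at_top[of 2]
  proof eventually_elim
    case (elim n)
    have n0: "real n > 0" using elim by simp
    have "psi n / real n \<le> prime_count n * ln (real n) / real n"
      using psi_le_prime_count n0 by (intro divide_right_mono) auto
    moreover have "prime_count n * ln (real n) / real n \<le> (real n powr (1 - \<delta>) * ln (real n) + psi n / (1 - \<delta>)) / real n"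
      using prime_count_le_psi[OF d(1,2)] elim n0 by (intro divide_right_mono) auto
    moreover have "(real n powr (1 - \<delta>) * ln (real n) + psi n / (1 - \<delta>)) / real n = real n powr (- \<delta>) * ln (real n) + psi n / real n * (1 / (1 - \<delta>))"
    proof -
      have "real n powr (1 - \<delta>) = real n * real n powr (- \<delta>)" using n0 powr_add[of "real n" 1 "- \<delta>"] by simp
      thus ?thesis using n0 by (simp add: add_divide_distrib mult.commute)
    qed
    ultimately show ?case using elim by (auto simp: abs_less_iff)
  qed
  thus "\<exists>no. \<forall>n\<ge>no. norm (prime_count n * ln (real n) / real n - 1) < \<epsilon>"
    by (simp add: eventually_sequentially)
qed

lemma stolz_cesaro:
  fixes f g :: "nat \<Rightarrow> real"
  assumes g: "filterlim g at_top sequentially" "\<forall>\<^sub>F n in sequentially. g n < g (Suc n)"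
    and lim: "(\<lambda>n. (f (Suc n) - f n) / (g (Suc n) - g n)) \<longlonglongrightarrow> L"
  shows "(\<lambda>n. f n / g n) \<longlonglongrightarrow> L"
proof (rule tendstoI)
  fix \<epsilon>0 :: real assume e0: "\<epsilon>0 > 0"
  define \<epsilon> where "\<epsilon> = \<epsilon>0 / 2"
  have e: "\<epsilon> > 0" "\<epsilon> < \<epsilon>0" using e0 by (auto simp: \<epsilon>_def)
  have "\<forall>\<^sub>F n in sequentially. \<bar>(f (Suc n) - f n) / (g (Suc n) - g n) - L\<bar> < \<epsilon> \<and> g n < g (Suc n)"
    using eventually_conj[OF tendstoD[OF lim e(1)] g(2)] by (simp add: dist_real_def)
  then obtain N where N: "\<And>n. n \<ge> N \<Longrightarrow> \<bar>(f (Suc n) - f n) / (g (Suc n) - g n) - L\<bar> < \<epsilon>" "\<And>n. n \<ge> N \<Longrightarrow> g n < g (Suc n)"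
    unfolding eventually_sequentially by blast
  have step: "\<bar>f (Suc n) - f n - L * (g (Suc n) - g n)\<bar> \<le> \<epsilon> * (g (Suc n) - g n)" if "n \<ge> N" for n
  proof -
    have D: "g (Suc n) - g n > 0" using N(2)[OF that] by simp
    have "f (Suc n) - f n - L * (g (Suc n) - g n) = ((f (Suc n) - f n) / (g (Suc n) - g n) - L) * (g (Suc n) - g n)"
      using D by (simp add: field_simps)
    hence "\<bar>f (Suc n) - f n - L * (g (Suc n) - g n)\<bar> = \<bar>(f (Suc n) - f n) / (g (Suc n) - g n) - L\<bar> * (g (Suc n) - g n)"
      using D by (simp add: abs_mult)
    also have "\<dots> \<le> \<epsilon> * (g (Suc n) - g n)" using N(1)[OF that] D by (intro mult_right_mono) auto
    finally show ?thesis .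
  qed
  have tot: "\<bar>f n - f N - L * (g n - g N)\<bar> \<le> \<epsilon> * (g n - g N)" if "n \<ge> N" for n
    using that
  proof (induction n rule: dec_induct)
    case (step n)
    thus ?case using assms step(3) \<open>\<And>n. n \<ge> N \<Longrightarrow> \<bar>f (Suc n) - f n - L * (g (Suc n) - g n)\<bar> \<le> \<epsilon> * (g (Suc n) - g n)\<close>[of n]
      by (simp add: algebra_simps abs_le_iff)
  qed simp
  define K where "K = \<bar>f N - L * g N\<bar> + \<epsilon> * \<bar>g N\<bar>"
  have "((\<lambda>n. K / g n + \<epsilon>) \<longlongrightarrow> 0 + \<epsilon>) sequentially"
    by (intro tendsto_intros tendsto_divide_0[OF tendsto_const] filterlim_at_top_imp_at_infinity g(1))
  hence "\<forall>\<^sub>F n in sequentially. K / g n + \<epsilon> < \<epsilon>0" by (rule order_tendstoD(2)) (use e in auto)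
  moreover have "\<forall>\<^sub>F n in sequentially. g n > 0" using g(1) by (simp add: filterlim_at_top_dense)
  ultimately show "\<forall>\<^sub>F n in sequentially. dist (f n / g n) L < \<epsilon>0"
    using eventually_ge_at_top[of N]
  proof eventually_elim
    case (elim n)
    have "- (\<epsilon> * g N) \<le> \<epsilon> * \<bar>g N\<bar>" using e mult_left_mono[of "- g N" "\<bar>g N\<bar>" \<epsilon>] by simp
    hence "\<bar>f n - L * g n\<bar> \<le> K + \<epsilon> * g n"
      using tot[OF elim(3)] unfolding K_def by (simp add: algebra_simps abs_le_iff abs_if split: if_splits)
    hence "\<bar>f n - L * g n\<bar> / g n \<le> (K + \<epsilon> * g n) / g n" using elim by (intro divide_right_mono) auto
    moreover have "\<bar>f n - L * g n\<bar> / g n = \<bar>f n / g n - L\<bar>" using elim by (simp add: field_simps abs_if)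
    moreover have "(K + \<epsilon> * g n) / g n = K / g n + \<epsilon>" using elim by (simp add: field_simps)
    ultimately show ?case using elim by (simp add: dist_real_def)
  qed
qed

definition prime_deficit :: "nat \<Rightarrow> real" where "prime_deficit r = (\<Sum>p\<in>primes_le r. (real r)\<^sup>2 - (real p)\<^sup>2)"

lemma prime_deficit_Suc: "prime_deficit (Suc r) = prime_deficit r + prime_count r * (2 * real r + 1)"
proof -
  have "prime_deficit (Suc r) = (\<Sum>p\<in>primes_le r. (real (Suc r))\<^sup>2 - (real p)\<^sup>2)"
    unfolding prime_deficit_def by (rule sum.mono_neutral_right) (auto simp: primes_le_def le_Suc_eq)
  also have "\<dots> = (\<Sum>p\<in>primes_le r. ((real r)\<^sup>2 - (real p)\<^sup>2) + (2 * real r + 1))"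
    by (intro sum.cong) (auto simp: power2_eq_square algebra_simps)
  finally show ?thesis by (simp add: sum.distrib prime_deficit_def)
qed

text \<open>By the theorem of Stolz and Cesaro it is enough to compare increments.  That of the sum is \<pi>(r) (2 r + 1), as the new prime itself
contributes nothing.\<close>

lemma prime_deficit_asymp: "(\<lambda>r. prime_deficit r * ln (real r) / (real r) ^ 3) \<longlonglongrightarrow> 2 / 3"
proof -
  have "(\<lambda>r. prime_deficit r / ((real r) ^ 3 / ln (real r))) \<longlonglongrightarrow> 2 / 3"
  proof (rule stolz_cesaro)
    show "filterlim (\<lambda>r. (real r) ^ 3 / ln (real r)) at_top sequentially" by real_asymp
    show "\<forall>\<^sub>F r in sequentially. (real r) ^ 3 / ln (real r) < (real (Suc r)) ^ 3 / ln (real (Suc r))" by real_asymp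
    have "(\<lambda>r. real r / ln (real r) * (2 * real r + 1) / ((real (Suc r)) ^ 3 / ln (real (Suc r)) - (real r) ^ 3 / ln (real r))) \<longlonglongrightarrow> 2 / 3"
      by real_asymp
    from tendsto_mult[OF prime_number_theorem this]
    have "(\<lambda>r. prime_count r * ln (real r) / real r * (real r / ln (real r) * (2 * real r + 1) / ((real (Suc r)) ^ 3 / ln (real (Suc r)) - (real r) ^ 3 / ln (real r)))) \<longlonglongrightarrow> 2 / 3"
      by simp
    moreover have "\<forall>\<^sub>F r in sequentially. prime_count r * ln (real r) / real r * (real r / ln (real r) * (2 * real r + 1) / ((real (Suc r)) ^ 3 / ln (real (Suc r)) - (real r) ^ 3 / ln (real r)))
       = (prime_deficit (Suc r) - prime_deficit r) / ((real (Suc r)) ^ 3 / ln (real (Suc r)) - (real r) ^ 3 / ln (real r))"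
      using eventually_ge_at_top[of 2]
    proof eventually_elim
      case (elim r)
      have "ln (real r) \<noteq> 0" "real r \<noteq> 0" using elim by auto
      thus ?case by (simp add: prime_deficit_Suc)
    qed
    ultimately show "(\<lambda>r. (prime_deficit (Suc r) - prime_deficit r) / ((real (Suc r)) ^ 3 / ln (real (Suc r)) - (real r) ^ 3 / ln (real r))) \<longlonglongrightarrow> 2 / 3"
      by (rule Lim_transform_eventually)
  qed
  thus ?thesis by simp
qed

section \<open>Asymptotics of both bounds\<close>

definition weight :: "nat \<Rightarrow> real" where "weight n = 3 * ln (real n) / (4 * real n powr (3 / 2))"

definition isqrt :: "nat \<Rightarrow> nat" where "isqrt n = nat \<lfloor>sqrt (real n)\<rfloor>"

definition log_ceil :: "nat \<Rightarrow> nat" where "log_ceil n = nat \<lceil>ln (real n)\<rceil>"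

lemma isqrt_bounds: "real (isqrt n) \<le> sqrt (real n)" "sqrt (real n) - 1 < real (isqrt n)"
proof -
  have "real (isqrt n) = of_int \<lfloor>sqrt (real n)\<rfloor>" unfolding isqrt_def by simp
  thus "real (isqrt n) \<le> sqrt (real n)" "sqrt (real n) - 1 < real (isqrt n)" by linarith+
qed

lemma isqrt_square: "isqrt n * isqrt n \<le> n" "n < Suc (isqrt n) * Suc (isqrt n)"
proof -
  have "real (isqrt n) * real (isqrt n) \<le> sqrt (real n) * sqrt (real n)" using isqrt_bounds by (intro mult_mono) auto
  hence "real (isqrt n * isqrt n) \<le> real n" by simp
  thus "isqrt n * isqrt n \<le> n" by (simp only: of_nat_le_iff)
  have "sqrt (real n) * sqrt (real n) < real (Suc (isqrt n)) * real (Suc (isqrt n))"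
    using isqrt_bounds(2)[of n] by (intro mult_strict_mono') auto
  hence "real n < real (Suc (isqrt n) * Suc (isqrt n))" by (simp del: of_nat_Suc mult_Suc mult_Suc_right)
  thus "n < Suc (isqrt n) * Suc (isqrt n)" by (simp only: of_nat_less_iff)
qed

lemma log_ceil_bounds: "n \<ge> 1 \<Longrightarrow> ln (real n) \<le> real (log_ceil n) \<and> real (log_ceil n) \<le> ln (real n) + 1"
proof -
  assume "n \<ge> 1"
  hence "ln (real n) \<ge> 0" by simp
  thus ?thesis unfolding log_ceil_def by linarith
qed

lemma isqrt_at_top: "filterlim isqrt at_top sequentially"
proof (rule filterlim_at_top_mono)
  show "filterlim (\<lambda>n. nat \<lfloor>sqrt (real n)\<rfloor>) at_top sequentially" by real_asymp
qed (simp add: isqrt_def)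

lemma isqrt_ratio: "(\<lambda>n. real (isqrt n) / sqrt (real n)) \<longlonglongrightarrow> 1"
proof (rule tendsto_sandwich)
  show "(\<lambda>n. (sqrt (real n) - 1) / sqrt (real n)) \<longlonglongrightarrow> 1" by real_asymp
  show "\<forall>\<^sub>F n in sequentially. (sqrt (real n) - 1) / sqrt (real n) \<le> real (isqrt n) / sqrt (real n)"
    using isqrt_bounds(2) by (intro always_eventually allI divide_right_mono) (auto intro: less_imp_le)
  show "\<forall>\<^sub>F n in sequentially. real (isqrt n) / sqrt (real n) \<le> 1"
    using eventually_ge_at_top[of 1] by eventually_elim (use isqrt_bounds(1) in simp)
qed auto

lemma ln_isqrt_ratio: "(\<lambda>n. ln (real (isqrt n)) / ln (real n)) \<longlonglongrightarrow> 1 / 2"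
proof (rule tendsto_sandwich)
  show "(\<lambda>n. ln (sqrt (real n) - 1) / ln (real n)) \<longlonglongrightarrow> 1 / 2" by real_asymp
  show "(\<lambda>n. ln (sqrt (real n)) / ln (real n)) \<longlonglongrightarrow> 1 / 2" by real_asymp
  have ev: "\<forall>\<^sub>F n in sequentially. sqrt (real n) - 1 > 0 \<and> ln (real n) > 0"
    by (intro eventually_conj; real_asymp)
  show "\<forall>\<^sub>F n in sequentially. ln (sqrt (real n) - 1) / ln (real n) \<le> ln (real (isqrt n)) / ln (real n)"
    using ev
  proof eventually_elim
    case (elim n)
    hence "ln (sqrt (real n) - 1) \<le> ln (real (isqrt n))"
      using isqrt_bounds(2)[of n] by (subst ln_le_cancel_iff) linarith+
    thus ?case using elim by (intro divide_right_mono) auto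
  qed
  show "\<forall>\<^sub>F n in sequentially. ln (real (isqrt n)) / ln (real n) \<le> ln (sqrt (real n)) / ln (real n)"
    using ev
  proof eventually_elim
    case (elim n)
    have "real (isqrt n) > 0" using elim isqrt_bounds(2)[of n] by linarith
    hence "ln (real (isqrt n)) \<le> ln (sqrt (real n))"
      using elim isqrt_bounds(1)[of n] by (subst ln_le_cancel_iff) linarith+
    thus ?case using elim by (intro divide_right_mono) auto
  qed
qed

lemma weight_sqrt: "n \<ge> 1 \<Longrightarrow> weight n = 3 * ln (real n) / (4 * (sqrt (real n)) ^ 3)"
proof -
  assume "n \<ge> 1"
  hence "real n powr (3 / 2) = (sqrt (real n)) ^ 3"
    by (simp add: powr_half_sqrt[symmetric] powr_powr flip: powr_realpow)
  thus ?thesis by (simp add: weight_def)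
qed

lemma weight_nonneg: "n \<ge> 1 \<Longrightarrow> weight n \<ge> 0" by (simp add: weight_def)

lemma prime_count_weight: "(\<lambda>n. prime_count (isqrt n) * real n * weight n) \<longlonglongrightarrow> 3 / 2"
proof -
  have "(\<lambda>n. (prime_count (isqrt n) * ln (real (isqrt n)) / real (isqrt n)) * (3 / 4 * (real (isqrt n) / sqrt (real n)) / (ln (real (isqrt n)) / ln (real n)))) \<longlonglongrightarrow> 1 * (3 / 4 * 1 / (1 / 2))"
    by (intro tendsto_intros filterlim_compose[OF prime_number_theorem isqrt_at_top] isqrt_ratio ln_isqrt_ratio) auto
  moreover have "\<forall>\<^sub>F n in sequentially. (prime_count (isqrt n) * ln (real (isqrt n)) / real (isqrt n)) * (3 / 4 * (real (isqrt n) / sqrt (real n)) / (ln (real (isqrt n)) / ln (real n)))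
     = prime_count (isqrt n) * real n * weight n"
    using eventually_gt_at_top[of 1] filterlim_at_top[THEN iffD1, OF isqrt_at_top, rule_format, of 2]
  proof eventually_elim
    case (elim n)
    define s where "s = sqrt (real n)"
    have s: "s > 0" "real n = s * s" using elim by (auto simp: s_def)
    have "ln (real (isqrt n)) > 0" "ln (real n) > 0" "real (isqrt n) > 0" using elim by auto
    moreover have "real n * weight n = 3 * ln (real n) / (4 * s)"
    proof -
      have "s * s * (3 * L / (4 * s ^ 3)) = 3 * L / (4 * s)" for L using s(1) by (simp add: field_simps power3_eq_cube)
      moreover have w: "weight n = 3 * ln (real n) / (4 * s ^ 3)" using weight_sqrt[of n] elim by (simp add: s_def)
      have "real n * weight n = s * s * (3 * ln (real n) / (4 * s ^ 3))" by (simp only: w s(2)[symmetric])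
      ultimately show ?thesis by simp
    qed
    ultimately show ?case unfolding s_def[symmetric] mult.assoc[of _ "real n"] using s(1) by (simp add: field_simps)
  qed
  ultimately show ?thesis using Lim_transform_eventually by fastforce
qed

definition prime_span :: "nat \<Rightarrow> real" where "prime_span n = (\<Sum>p\<in>primes_le (isqrt n). real n - (real p)\<^sup>2)"

text \<open>The sum of n - p^2 differs from that of r^2 - p^2 by (n - r^2) \<pi>(r), which is negligible as n - r^2 = o(n).\<close>

lemma prime_span_weight: "(\<lambda>n. prime_span n * weight n) \<longlonglongrightarrow> 1"
proof -
  have "(\<lambda>n. (prime_deficit (isqrt n) * ln (real (isqrt n)) / (real (isqrt n)) ^ 3) * (3 / 4 * (real (isqrt n) / sqrt (real n)) ^ 3 / (ln (real (isqrt n)) / ln (real n)))) \<longlonglongrightarrow> 2 / 3 * (3 / 4 * 1 ^ 3 / (1 / 2))"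
    by (intro tendsto_intros filterlim_compose[OF prime_deficit_asymp isqrt_at_top] isqrt_ratio ln_isqrt_ratio) auto
  moreover have "\<forall>\<^sub>F n in sequentially. (prime_deficit (isqrt n) * ln (real (isqrt n)) / (real (isqrt n)) ^ 3) * (3 / 4 * (real (isqrt n) / sqrt (real n)) ^ 3 / (ln (real (isqrt n)) / ln (real n)))
     = prime_deficit (isqrt n) * weight n"
    using eventually_gt_at_top[of 1] filterlim_at_top[THEN iffD1, OF isqrt_at_top, rule_format, of 2]
  proof eventually_elim
    case (elim n)
    have "ln (real (isqrt n)) > 0" "ln (real n) > 0" "real (isqrt n) > 0" "sqrt (real n) > 0" using elim by auto
    moreover have "weight n = 3 * ln (real n) / (4 * (sqrt (real n)) ^ 3)" using weight_sqrt[of n] elim by simp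
    ultimately show ?case by (simp add: field_simps power_divide)
  qed
  ultimately have 1: "(\<lambda>n. prime_deficit (isqrt n) * weight n) \<longlonglongrightarrow> 1" using Lim_transform_eventually by fastforce
  have 2: "(\<lambda>n. (real n - (real (isqrt n))\<^sup>2) / real n * (prime_count (isqrt n) * real n * weight n)) \<longlonglongrightarrow> 0 * (3 / 2)"
  proof (intro tendsto_mult prime_count_weight)
    have "(\<lambda>n. 1 - (real (isqrt n) / sqrt (real n))\<^sup>2) \<longlonglongrightarrow> 1 - 1\<^sup>2" by (intro tendsto_intros isqrt_ratio)
    moreover have "\<forall>\<^sub>F n in sequentially. 1 - (real (isqrt n) / sqrt (real n))\<^sup>2 = (real n - (real (isqrt n))\<^sup>2) / real n"
      using eventually_gt_at_top[of 0] by eventually_elim (simp add: power_divide diff_divide_distrib)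
    ultimately show "(\<lambda>n. (real n - (real (isqrt n))\<^sup>2) / real n) \<longlonglongrightarrow> 0" using Lim_transform_eventually by fastforce
  qed
  have "(\<lambda>n. prime_deficit (isqrt n) * weight n + (real n - (real (isqrt n))\<^sup>2) / real n * (prime_count (isqrt n) * real n * weight n)) \<longlonglongrightarrow> 1"
    using tendsto_add[OF 1 2] by simp
  moreover have "\<forall>\<^sub>F n in sequentially. prime_deficit (isqrt n) * weight n + (real n - (real (isqrt n))\<^sup>2) / real n * (prime_count (isqrt n) * real n * weight n) = prime_span n * weight n"
    using eventually_gt_at_top[of 0]
  proof eventually_elim
    case (elim n)
    have "prime_span n = (\<Sum>p\<in>primes_le (isqrt n). ((real (isqrt n))\<^sup>2 - (real p)\<^sup>2) + (real n - (real (isqrt n))\<^sup>2))"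
      unfolding prime_span_def by (intro sum.cong) auto
    also have "\<dots> = prime_deficit (isqrt n) + prime_count (isqrt n) * (real n - (real (isqrt n))\<^sup>2)"
      unfolding prime_deficit_def by (simp only: sum.distrib sum_constant)
    finally have e1: "prime_span n = prime_deficit (isqrt n) + prime_count (isqrt n) * (real n - (real (isqrt n))\<^sup>2)" .
    have e2: "x / real n * (y * real n * z) = x * y * z" for x y z using elim by simp
    show ?case unfolding e1 e2 by (simp add: algebra_simps)
  qed
  ultimately show ?thesis by (rule Lim_transform_eventually)
qed

lemma harmonic_sum_le: "n \<ge> 1 \<Longrightarrow> (\<Sum>d=1..n. 1 / real d) \<le> 1 + ln (real n)"
proof -
  assume n: "n \<ge> 1"
  have "harm (Suc (n - 1)) - ln (real (Suc (n - 1))) \<le> harm (Suc 0) - ln (real (Suc 0))"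
    using decseqD[OF decseq_harm_diff_ln, of 0 "n - 1"] by simp
  hence "harm n \<le> 1 + ln (real n)" using n by (simp add: harm_expand)
  thus ?thesis by (simp add: harm_def inverse_eq_divide)
qed

lemma min_pack_lower:
  assumes n: "n \<ge> 4" and k: "sqrt (real n) \<le> real k"
  shows "real (min_pack k n) \<ge> prime_span n - 2 * real (isqrt n) * prime_count (isqrt n) - real n"
proof -
  have k1: "k \<ge> 1"
  proof -
    have "sqrt (real n) > 0" using n by simp
    thus ?thesis using k by linarith
  qed
  have r2: "isqrt n \<ge> 2"
  proof -
    have "sqrt (real n) \<ge> sqrt 4" using n by (intro real_sqrt_le_mono) simp
    hence "\<lfloor>sqrt (real n)\<rfloor> \<ge> 2" by simp
    thus ?thesis unfolding isqrt_def by linarith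
  qed
  have "real (min_pack k n) \<ge> (\<Sum>p | prime p \<and> p \<le> isqrt n. real n - 2 * real (isqrt n) - (real p)\<^sup>2) - real n"
  proof (rule packing_lower_bound[OF min_pack_properties(1)[OF k1] _ isqrt_square(1) r2])
    fix p assume p: "prime p" "p \<le> isqrt n"
    have "real p \<le> real k" using p isqrt_bounds(1)[of n] k by linarith
    thus "p \<in> {1..k}" using p by (simp add: prime_gt_0_nat Suc_le_eq)
  qed
  also have "(\<Sum>p | prime p \<and> p \<le> isqrt n. real n - 2 * real (isqrt n) - (real p)\<^sup>2) = (\<Sum>p\<in>primes_le (isqrt n). (real n - (real p)\<^sup>2) - 2 * real (isqrt n))"
    unfolding primes_le_def by (intro sum.cong) auto
  also have "\<dots> = prime_span n - 2 * real (isqrt n) * prime_count (isqrt n)"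
    unfolding prime_span_def by (simp only: sum_subtractf sum_constant mult.commute)
  finally show ?thesis .
qed

lemma lower_limit: "(\<lambda>n. (prime_span n - 2 * real (isqrt n) * prime_count (isqrt n) - real n) * weight n) \<longlonglongrightarrow> 1"
proof -
  have 1: "(\<lambda>n. 2 * (real (isqrt n) / sqrt (real n)) * (1 / sqrt (real n)) * (prime_count (isqrt n) * real n * weight n)) \<longlonglongrightarrow> 2 * 1 * 0 * (3 / 2)"
  proof (intro tendsto_intros isqrt_ratio prime_count_weight)
    show "(\<lambda>n. 1 / sqrt (real n)) \<longlonglongrightarrow> 0" by real_asymp
  qed
  have 2: "(\<lambda>n. real n * weight n) \<longlonglongrightarrow> 0" unfolding weight_def by real_asymp
  have "(\<lambda>n. prime_span n * weight n - 2 * (real (isqrt n) / sqrt (real n)) * (1 / sqrt (real n)) * (prime_count (isqrt n) * real n * weight n) - real n * weight n) \<longlonglongrightarrow> 1 - 2 * 1 * 0 * (3 / 2) - 0"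
    by (intro tendsto_diff prime_span_weight 1 2)
  moreover have "\<forall>\<^sub>F n in sequentially. prime_span n * weight n - 2 * (real (isqrt n) / sqrt (real n)) * (1 / sqrt (real n)) * (prime_count (isqrt n) * real n * weight n) - real n * weight n
      = (prime_span n - 2 * real (isqrt n) * prime_count (isqrt n) - real n) * weight n"
    using eventually_gt_at_top[of 0]
  proof eventually_elim
    case (elim n)
    have e: "2 * (real (isqrt n) / sqrt (real n)) * (1 / sqrt (real n)) * (prime_count (isqrt n) * real n * weight n) = 2 * real (isqrt n) * prime_count (isqrt n) * weight n"
      using elim by (simp add: field_simps)
    show ?case unfolding e by (simp only: left_diff_distrib)
  qed
  ultimately show ?thesis using Lim_transform_eventually by fastforce
qed

text \<open>The bound of \<open>packing_upper_bound\<close> for X = l^2, W = l^5, V = r div W and D = r l^3 with l = \<open>log_ceil n\<close>.  With X = l^2, the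
blocks, each of which loses a bounded number of primes, are few compared with the primes.  The factor l^3 in D makes the greedy step negligible, and
l^5 in W does so for the terms with D/W.\<close>

definition upper_cost :: "real \<Rightarrow> nat \<Rightarrow> nat \<Rightarrow> nat \<Rightarrow> real" where
  "upper_cost \<tau> R H n = prime_span n
     + prime_count (isqrt n) * (real (isqrt n) + real ((log_ceil n)\<^sup>2) + 1 + 2 * real (isqrt n) * real ((log_ceil n)\<^sup>2) + (8 * \<tau> + 2 / real H) * real n)
     + (real (isqrt n) / real ((log_ceil n)\<^sup>2) + 1) * (2 * (4 * real R + 8) ^ H * real n)
     + 2 * real ((log_ceil n) ^ 5) * real n
     + 2 * real n * (real (isqrt n * (log_ceil n) ^ 3) / (real ((log_ceil n) ^ 5) - 1) + real (isqrt n div (log_ceil n) ^ 5))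
     + real n + real n / real (isqrt n * (log_ceil n) ^ 3) * (real n * (\<Sum>d=1..n. 1 / real d))"

lemma min_pack_upper:
  assumes \<tau>: "0 < \<tau>" "\<tau> \<le> 1 / 2" "real R * \<tau> \<ge> 1" and H: "H \<ge> 1"
  shows "\<forall>\<^sub>F n in sequentially. \<forall>k. 1 \<le> k \<and> k \<le> n \<longrightarrow> real (min_pack k n) \<le> upper_cost \<tau> R H n"
proof -
  define s where "s = (\<lambda>n. sqrt (real n))"
  define L where "L = (\<lambda>n. ln (real n))"
  define v where "v = (\<lambda>n. (s n - 1) / (L n + 1) ^ 5 - 1)"
  have "\<forall>\<^sub>F n in sequentially. 2 * ((L n + 1)\<^sup>2) ^ H * (L n + 1) ^ 5 \<le> \<tau> * (v n - (L n + 1)\<^sup>2)"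
    unfolding s_def L_def v_def using \<tau>(1) by real_asymp
  moreover have "\<forall>\<^sub>F n in sequentially. 2 * (L n + 1)\<^sup>2 < v n" unfolding s_def L_def v_def by real_asymp
  moreover have "\<forall>\<^sub>F n in sequentially. (L n + 1) ^ 5 + (L n + 1)\<^sup>2 \<le> v n" unfolding s_def L_def v_def by real_asymp
  moreover have "\<forall>\<^sub>F n in sequentially. (L n + 1) ^ 5 * (L n + 1) ^ 5 \<le> v n" unfolding s_def L_def v_def by real_asymp
  moreover have "\<forall>\<^sub>F n in sequentially. s n * (L n + 1) ^ 3 \<le> v n * v n" unfolding s_def L_def v_def by real_asymp
  moreover have "\<forall>\<^sub>F n in sequentially. s n + (L n + 1)\<^sup>2 \<le> real n" unfolding s_def L_def v_def by real_asymp
  moreover have "\<forall>\<^sub>F n in sequentially. L n > 1" unfolding s_def L_def v_def by real_asymp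
  moreover have "\<forall>\<^sub>F n in sequentially. s n > 2" unfolding s_def L_def v_def by real_asymp
  ultimately show ?thesis using eventually_ge_at_top[of 1]
  proof eventually_elim
    case (elim n)
    define r where "r = isqrt n"
    define l where "l = log_ceil n"
    define X where "X = l\<^sup>2"
    define W where "W = l ^ 5"
    define V where "V = r div W"
    define D where "D = r * l ^ 3"
    have n: "n \<ge> 1" by fact
    have l: "L n \<le> real l" "real l \<le> L n + 1" using log_ceil_bounds[OF n] by (auto simp: l_def L_def)
    have r: "real r \<le> s n" "s n - 1 < real r" using isqrt_bounds by (auto simp: r_def s_def)
    have l2: "l \<ge> 2" using l(1) elim(7) by linarith
    have r1: "r \<ge> 1" using r(2) elim(8) by linarith
    have X: "real X \<le> (L n + 1)\<^sup>2" unfolding X_def of_nat_power using l(2) by (intro power_mono) auto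
    have W: "real W \<le> (L n + 1) ^ 5" unfolding W_def of_nat_power using l(2) by (intro power_mono) auto
    have l3: "real (l ^ 3) \<le> (L n + 1) ^ 3" unfolding of_nat_power using l(2) by (intro power_mono) auto
    have W0: "W \<ge> 2"
    proof -
      have "(2::nat) ^ 5 \<le> W" unfolding W_def using l2 by (intro power_mono) auto
      thus ?thesis by simp
    qed
    have V: "v n \<le> real V"
    proof -
      have "v n \<le> real r / real W - 1" unfolding v_def using r W W0 elim(8)
        by (intro diff_right_mono frac_le) auto
      also have "\<dots> \<le> real (r div W)"
      proof -
        have "r < W * (r div W + 1)" using W0 dividend_less_times_div[of W r] by (simp add: algebra_simps)
        hence "real r < real (W * (r div W + 1))" by (simp only: of_nat_less_iff)
        hence "real r < real W * (real (r div W) + 1)" by (simp only: of_nat_mult of_nat_add of_nat_1)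
        thus ?thesis using W0 by (simp add: field_simps)
      qed
      finally show ?thesis by (simp add: V_def)
    qed
    have v0: "v n \<ge> 0"
    proof -
      have "2 * (L n + 1)\<^sup>2 \<ge> 0" by simp
      thus ?thesis using elim(2) by linarith
    qed
    have "\<exists>N. packed_into {1..n} (multiples n) N \<and>
     real N \<le> (\<Sum>p | prime p \<and> p \<le> r. real n - (real p)\<^sup>2)
       + real (card {p. prime p \<and> p \<le> r}) * (real r + real X + 1 + 2 * real r * real X + (8 * \<tau> + 2 / real H) * real n)
       + (real r / real X + 1) * (2 * (4 * real R + 8) ^ H * real n)
       + 2 * real W * real n + 2 * real n * (real D / (real W - 1) + real V) + real n + real n / real D * (real n * (\<Sum>d=1..n. 1 / real d))"
    proof (rule packing_upper_bound[OF \<tau> H])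
      have "2 * real X ^ H * real W \<le> 2 * ((L n + 1)\<^sup>2) ^ H * (L n + 1) ^ 5"
        using X W by (intro mult_mono power_mono) auto
      also have "\<dots> \<le> \<tau> * (v n - (L n + 1)\<^sup>2)" by fact
      also have "\<dots> \<le> \<tau> * (real V - real X)" using X V \<tau> by (intro mult_left_mono) linarith+
      finally show "2 * real X ^ H * real W \<le> \<tau> * (real V - real X)" .
      show "X \<ge> 1" using l2 by (simp add: X_def)
      show "W \<ge> 2" by (rule W0)
      have "2 * real X < real V" using elim(2) X V by linarith
      thus "2 * X < V" by linarith
      have "real W + real X \<le> real V" using elim(3) X W V by linarith
      thus "W + X \<le> V" by linarith
      have "real W * real W \<le> (L n + 1) ^ 5 * (L n + 1) ^ 5" using W elim(7) by (intro mult_mono) auto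
      hence "real W * real W \<le> real V" using elim(4) V by linarith
      thus "W * W \<le> V" by (simp only: of_nat_le_iff flip: of_nat_mult)
      show "r * r \<le> n" "n < Suc r * Suc r" unfolding r_def by (rule isqrt_square)+
      have "real r + real X \<le> real n" using elim(6) r X by linarith
      thus "r + X \<le> n" by linarith
      have "real r * real (l ^ 3) \<le> s n * (L n + 1) ^ 3" using r l3 elim(8) by (intro mult_mono) auto
      also have "\<dots> \<le> v n * v n" by fact
      also have "\<dots> \<le> real V * real V" using V v0 by (intro mult_mono) auto
      finally show "D \<le> V * V" unfolding D_def by (simp only: of_nat_le_iff flip: of_nat_mult)
      show "D \<ge> 1" unfolding D_def using r1 l2 by simp
      have "V \<le> r" by (simp add: V_def)
      also have "r \<le> r * r" using r1 by simp
      also have "r * r \<le> n" unfolding r_def by (rule isqrt_square)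
      finally show "V \<le> n" .
    qed
    then obtain N where N: "packed_into {1..n} (multiples n) N" "real N \<le> upper_cost \<tau> R H n"
      unfolding upper_cost_def prime_span_def primes_le_def V_def D_def W_def X_def r_def l_def by blast
    show ?case
    proof (intro allI impI)
      fix k assume k: "1 \<le> k \<and> k \<le> n"
      have "N \<ge> 1"
      proof (rule ccontr)
        assume "\<not> N \<ge> 1"
        hence "N = 0" by simp
        hence "packed_into {1..n} (multiples n) 0" using N(1) by (simp only:)
        then obtain \<sigma> where "\<And>d c. d \<in> {1..n} \<Longrightarrow> c \<in> multiples n d \<Longrightarrow> 1 \<le> \<sigma> d + c \<and> \<sigma> d + c \<le> int 0"
          by (rule packed_intoE) blast
        moreover have "int (1 * 1) \<in> multiples n 1" using n by (intro multiplesI) auto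
        ultimately show False using n by fastforce
      qed
      moreover have "packed_into {1..k} (multiples n) N" by (rule packed_into_mono[OF N(1)]) (use k in auto)
      ultimately have "min_pack k n \<le> N" using k by (intro min_pack_properties(2)) auto
      thus "real (min_pack k n) \<le> upper_cost \<tau> R H n" using N(2) by linarith
    qed
  qed
qed

lemma null_sandwich:
  fixes f g :: "nat \<Rightarrow> real"
  assumes "\<forall>\<^sub>F n in sequentially. 0 \<le> f n \<and> f n \<le> g n" "g \<longlonglongrightarrow> 0"
  shows "f \<longlonglongrightarrow> 0"
  by (rule tendsto_sandwich[of "\<lambda>_. 0" f _ g]) (use assms in \<open>auto elim: eventually_mono\<close>)

lemma upper_cost_limit:
  assumes \<tau>: "0 < \<tau>" and H: "H \<ge> 1"
  shows "(\<lambda>n. upper_cost \<tau> R H n * weight n) \<longlonglongrightarrow> 1 + 3 / 2 * (8 * \<tau> + 2 / real H)"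
proof -
  define s where "s = (\<lambda>n. sqrt (real n))"
  define L where "L = (\<lambda>n. ln (real n))"
  have ev: "\<forall>\<^sub>F n in sequentially. L n > 2 \<and> s n > 2 \<and> n \<ge> 1"
  proof (intro eventually_conj)
    show "\<forall>\<^sub>F n in sequentially. L n > 2" unfolding L_def by real_asymp
    show "\<forall>\<^sub>F n in sequentially. s n > 2" unfolding s_def by real_asymp
  qed (rule eventually_ge_at_top)
  have b: "L n \<le> real (log_ceil n) \<and> real (log_ceil n) \<le> L n + 1 \<and> real (isqrt n) \<le> s n \<and> s n - 1 \<le> real (isqrt n) \<and> weight n \<ge> 0"
    if "n \<ge> 1" for n using log_ceil_bounds[OF that] isqrt_bounds[of n] weight_nonneg[OF that] by (simp add: s_def L_def)
  have pw: "L n ^ i \<le> real (log_ceil n ^ i) \<and> real (log_ceil n ^ i) \<le> (L n + 1) ^ i" if "n \<ge> 1" "L n > 2" for n i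
    using b[OF that(1)] that(2) by (auto intro!: power_mono)
  define t1 where "t1 = (\<lambda>n. (real (isqrt n) + real ((log_ceil n)\<^sup>2) + 1 + 2 * real (isqrt n) * real ((log_ceil n)\<^sup>2)) / real n)"
  have "t1 \<longlonglongrightarrow> 0"
  proof (rule null_sandwich)
    show "(\<lambda>n. (s n + (L n + 1)\<^sup>2 + 1 + 2 * s n * (L n + 1)\<^sup>2) / real n) \<longlonglongrightarrow> 0" unfolding s_def L_def by real_asymp
    show "\<forall>\<^sub>F n in sequentially. 0 \<le> t1 n \<and> t1 n \<le> (s n + (L n + 1)\<^sup>2 + 1 + 2 * s n * (L n + 1)\<^sup>2) / real n"
      using ev
    proof eventually_elim
      case (elim n)
      show ?case unfolding t1_def using elim b[of n] pw[of n 2]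
        by (intro conjI divide_right_mono add_mono mult_mono) auto
    qed
  qed
  from tendsto_mult[OF this prime_count_weight]
  have T1: "(\<lambda>n. t1 n * (prime_count (isqrt n) * real n * weight n)) \<longlonglongrightarrow> 0" by simp
  have T2: "(\<lambda>n. (8 * \<tau> + 2 / real H) * (prime_count (isqrt n) * real n * weight n)) \<longlonglongrightarrow> (8 * \<tau> + 2 / real H) * (3 / 2)"
    by (intro tendsto_intros prime_count_weight)
  define c where "c = (4 * real R + 8) ^ H"
  have c: "c \<ge> 0" by (simp add: c_def)
  let ?e3 = "\<lambda>n. (real (isqrt n) / real ((log_ceil n)\<^sup>2) + 1) * (2 * c * real n) * weight n"
    and ?e4 = "\<lambda>n. 2 * real ((log_ceil n) ^ 5) * real n * weight n"
    and ?e5 = "\<lambda>n. 2 * real n * (real (isqrt n * (log_ceil n) ^ 3) / (real ((log_ceil n) ^ 5) - 1) + real (isqrt n div (log_ceil n) ^ 5)) * weight n"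
    and ?e7 = "\<lambda>n. real n / real (isqrt n * (log_ceil n) ^ 3) * (real n * (\<Sum>d=1..n. 1 / real d)) * weight n"
  have T3: "?e3 \<longlonglongrightarrow> 0"
  proof (rule null_sandwich)
    show "(\<lambda>n. (s n / (L n)\<^sup>2 + 1) * (2 * c * real n) * weight n) \<longlonglongrightarrow> 0" unfolding s_def L_def weight_def by real_asymp
    show "\<forall>\<^sub>F n in sequentially. 0 \<le> ?e3 n \<and>
        ?e3 n \<le> (s n / (L n)\<^sup>2 + 1) * (2 * c * real n) * weight n"
      using ev
    proof eventually_elim
      case (elim n)
      have "real (isqrt n) / real ((log_ceil n)\<^sup>2) \<le> s n / (L n)\<^sup>2" using elim b[of n] pw[of n 2] by (intro frac_le) auto
      thus ?case using elim b[of n] c by (intro conjI mult_right_mono mult_nonneg_nonneg add_mono) auto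
    qed
  qed
  have T4: "?e4 \<longlonglongrightarrow> 0"
  proof (rule null_sandwich)
    show "(\<lambda>n. 2 * (L n + 1) ^ 5 * real n * weight n) \<longlonglongrightarrow> 0" unfolding L_def weight_def by real_asymp
    show "\<forall>\<^sub>F n in sequentially. 0 \<le> ?e4 n \<and> ?e4 n \<le> 2 * (L n + 1) ^ 5 * real n * weight n"
      using ev
    proof eventually_elim
      case (elim n)
      thus ?case using b[of n] pw[of n 5] by (intro conjI mult_right_mono mult_left_mono mult_nonneg_nonneg) auto
    qed
  qed
  have T5: "?e5 \<longlonglongrightarrow> 0"
  proof (rule null_sandwich)
    show "(\<lambda>n. 2 * real n * (s n * (L n + 1) ^ 3 / (L n ^ 5 - 1) + s n / L n ^ 5) * weight n) \<longlonglongrightarrow> 0" unfolding s_def L_def weight_def by real_asymp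
    show "\<forall>\<^sub>F n in sequentially. 0 \<le> ?e5 n \<and>
       ?e5 n
       \<le> 2 * real n * (s n * (L n + 1) ^ 3 / (L n ^ 5 - 1) + s n / L n ^ 5) * weight n"
      using ev
    proof eventually_elim
      case (elim n)
      have L5: "L n ^ 5 > 1" using elim by (intro one_less_power) auto
      have P: "L n ^ 5 \<le> real (log_ceil n ^ 5)" "real (log_ceil n ^ 3) \<le> (L n + 1) ^ 3" using pw[of n] elim by auto
      have A: "real (isqrt n * log_ceil n ^ 3) / (real (log_ceil n ^ 5) - 1) \<le> s n * (L n + 1) ^ 3 / (L n ^ 5 - 1)"
        unfolding of_nat_mult using elim b[of n] P L5 by (intro frac_le mult_mono) auto
      have "real (isqrt n div log_ceil n ^ 5) \<le> real (isqrt n) / real (log_ceil n ^ 5)" by (rule of_nat_div_le_of_nat)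
      also have "\<dots> \<le> s n / L n ^ 5" using elim b[of n] P L5 by (intro frac_le) auto
      finally have B: "real (isqrt n div log_ceil n ^ 5) \<le> s n / L n ^ 5" .
      have "0 \<le> real (isqrt n * log_ceil n ^ 3) / (real (log_ceil n ^ 5) - 1)" using P L5 by (intro divide_nonneg_nonneg) linarith+
      thus ?case using A B b[of n] elim by (intro conjI mult_right_mono mult_left_mono mult_nonneg_nonneg add_mono add_nonneg_nonneg) auto
    qed
  qed
  have T6: "(\<lambda>n. real n * weight n) \<longlonglongrightarrow> 0" unfolding weight_def by real_asymp
  have T7: "?e7 \<longlonglongrightarrow> 0"
  proof (rule null_sandwich)
    show "(\<lambda>n. real n / ((s n - 1) * L n ^ 3) * (real n * (1 + L n)) * weight n) \<longlonglongrightarrow> 0" unfolding s_def L_def weight_def by real_asymp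
    show "\<forall>\<^sub>F n in sequentially. 0 \<le> ?e7 n \<and>
        ?e7 n \<le> real n / ((s n - 1) * L n ^ 3) * (real n * (1 + L n)) * weight n"
      using ev
    proof eventually_elim
      case (elim n)
      have P: "L n ^ 3 \<le> real (log_ceil n ^ 3)" using pw[of n] elim by auto
      have h0: "0 \<le> (\<Sum>d=1..n. 1 / real d)" by (intro sum_nonneg) auto
      have h1: "(\<Sum>d=1..n. 1 / real d) \<le> 1 + L n" using harmonic_sum_le[of n] elim by (simp add: L_def)
      have "0 < (s n - 1) * L n ^ 3" using elim by (intro mult_pos_pos) auto
      moreover have "(s n - 1) * L n ^ 3 \<le> real (isqrt n * log_ceil n ^ 3)" unfolding of_nat_mult
        using elim b[of n] P by (intro mult_mono) auto
      ultimately have "real n / real (isqrt n * (log_ceil n) ^ 3) \<le> real n / ((s n - 1) * L n ^ 3)" by (intro divide_left_mono) auto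
      moreover have "0 \<le> real n / real (isqrt n * (log_ceil n) ^ 3)" by simp
      ultimately show ?case using h0 h1 b[of n] elim
        by (intro conjI mult_right_mono mult_mono mult_nonneg_nonneg) auto
    qed
  qed
  let ?sum = "\<lambda>n. prime_span n * weight n + t1 n * (prime_count (isqrt n) * real n * weight n) + (8 * \<tau> + 2 / real H) * (prime_count (isqrt n) * real n * weight n)
     + ?e3 n
     + ?e4 n
     + ?e5 n
     + real n * weight n + ?e7 n"
  have "?sum \<longlonglongrightarrow> 1 + 0 + (8 * \<tau> + 2 / real H) * (3 / 2) + 0 + 0 + 0 + 0 + 0"
    by (intro tendsto_add prime_span_weight T1 T2 T3 T4 T5 T6 T7)
  moreover have "\<forall>\<^sub>F n in sequentially. ?sum n = upper_cost \<tau> R H n * weight n"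
    using eventually_gt_at_top[of 0]
  proof eventually_elim
    case (elim n)
    define P where "P = prime_count (isqrt n)"
    define x where "x = real (isqrt n) + real ((log_ceil n)\<^sup>2) + 1 + 2 * real (isqrt n) * real ((log_ceil n)\<^sup>2)"
    define \<eta> where "\<eta> = 8 * \<tau> + 2 / real H"
    have "t1 n * (P * real n * weight n) = P * x * weight n" using elim by (simp add: t1_def x_def)
    moreover have "P * (x + \<eta> * real n) * weight n = P * x * weight n + \<eta> * (P * real n * weight n)" by (simp add: algebra_simps)
    ultimately show ?case
      unfolding upper_cost_def P_def[symmetric] \<eta>_def[symmetric] c_def[symmetric] x_def[symmetric] mult.assoc[of 2 c] by (simp only: distrib_right)
  qed
  ultimately have "(\<lambda>n. upper_cost \<tau> R H n * weight n) \<longlonglongrightarrow> 1 + 0 + (8 * \<tau> + 2 / real H) * (3 / 2) + 0 + 0 + 0 + 0 + 0"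
    by (rule Lim_transform_eventually)
  thus ?thesis by (simp add: algebra_simps)
qed

theorem corollary1p3:
  shows "\<forall>\<epsilon>::real. \<epsilon> > 0 \<longrightarrow>
    (\<exists>n0::nat. n0 \<ge> 1 \<and>
      (\<forall>n::nat. n \<ge> n0 \<longrightarrow>
        (\<forall>k::nat. sqrt (real n) \<le> real k \<and> k \<le> n \<longrightarrow>
          \<bar>real (min_pack k n) * (3 * ln (real n) / (4 * real n powr (3 / 2))) - 1\<bar> \<le> \<epsilon>)))"
proof (intro allI impI)
  fix \<epsilon> :: real assume e: "\<epsilon> > 0"
  \<comment> \<open>In the limit the upper bound exceeds the main term by the relative error 12\<tau> + 3/H.\<close>
  define \<tau> where "\<tau> = min (1 / 2) (\<epsilon> / 48)"
  have \<tau>: "0 < \<tau>" "\<tau> \<le> 1 / 2" "12 * \<tau> \<le> \<epsilon> / 4" using e by (auto simp: \<tau>_def min_def)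
  define R where "R = nat \<lceil>1 / \<tau>\<rceil>"
  have "real R \<ge> 1 / \<tau>" unfolding R_def by (rule real_nat_ceiling_ge)
  hence R: "real R * \<tau> \<ge> 1" using \<tau>(1) by (simp add: field_simps)
  define H where "H = nat \<lceil>12 / \<epsilon>\<rceil> + 1"
  have H1: "H \<ge> 1" by (simp add: H_def)
  have "real H \<ge> 12 / \<epsilon>" unfolding H_def using real_nat_ceiling_ge[of "12 / \<epsilon>"] by simp
  hence H: "3 / real H \<le> \<epsilon> / 4" using e H1 by (simp add: field_simps)
  have "3 / 2 * (8 * \<tau> + 2 / real H) = 12 * \<tau> + 3 / real H" by simp
  also have "\<dots> < \<epsilon>" using \<tau>(3) H e by linarith
  finally have lim: "1 + 3 / 2 * (8 * \<tau> + 2 / real H) < 1 + \<epsilon>" by simp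
  have up: "\<forall>\<^sub>F n in sequentially. upper_cost \<tau> R H n * weight n < 1 + \<epsilon>"
    by (rule order_tendstoD(2)[OF upper_cost_limit[OF \<tau>(1) H1] lim])
  have lo: "\<forall>\<^sub>F n in sequentially. (prime_span n - 2 * real (isqrt n) * prime_count (isqrt n) - real n) * weight n > 1 - \<epsilon>"
    by (rule order_tendstoD(1)[OF lower_limit]) (use e in simp)
  have "\<forall>\<^sub>F n in sequentially. \<forall>k::nat. sqrt (real n) \<le> real k \<and> k \<le> n \<longrightarrow> \<bar>real (min_pack k n) * weight n - 1\<bar> \<le> \<epsilon>"
    using up lo min_pack_upper[OF \<tau>(1,2) R H1] eventually_ge_at_top[of 4]
  proof eventually_elim
    case (elim n)
    show ?case
    proof (intro allI impI)
      fix k assume k: "sqrt (real n) \<le> real k \<and> k \<le> n"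
      have w: "weight n \<ge> 0" using elim by (intro weight_nonneg) auto
      have "sqrt (real n) > 0" using elim by simp
      hence k1: "1 \<le> k" using k by linarith
      have "real (min_pack k n) * weight n \<le> upper_cost \<tau> R H n * weight n" using elim(3) k k1 w by (intro mult_right_mono) auto
      moreover have "(prime_span n - 2 * real (isqrt n) * prime_count (isqrt n) - real n) * weight n \<le> real (min_pack k n) * weight n"
        using min_pack_lower[of n k] elim(4) k w by (intro mult_right_mono) auto
      ultimately show "\<bar>real (min_pack k n) * weight n - 1\<bar> \<le> \<epsilon>" using elim(1,2) by linarith
    qed
  qed
  then obtain N where N: "\<And>n k. n \<ge> N \<Longrightarrow> sqrt (real n) \<le> real k \<and> k \<le> n \<Longrightarrow> \<bar>real (min_pack k n) * weight n - 1\<bar> \<le> \<epsilon>"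
    unfolding eventually_sequentially by blast
  show "\<exists>n0::nat. n0 \<ge> 1 \<and> (\<forall>n::nat. n \<ge> n0 \<longrightarrow> (\<forall>k::nat. sqrt (real n) \<le> real k \<and> k \<le> n \<longrightarrow>
          \<bar>real (min_pack k n) * (3 * ln (real n) / (4 * real n powr (3 / 2))) - 1\<bar> \<le> \<epsilon>))"
    using N unfolding weight_def by (intro exI[of _ "max N 1"]) auto
qed

end
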